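(* Let $M$ be a compact oriented $C^\infty$ manifold without boundary with a smooth volume form $\mu$. Suppose that $\mathcal{S}\subset \mathrm{Diff}^\infty_\mu(M)$ is a closed subspace (closed in the $C^\infty$ topology) such that $\dot{\mathcal{H}}^{-\sigma}(M)\cap\mathcal{S}$ is dense in $\mathcal{S}$ for some $\sigma\ge 0$. Then $CR(M)\cap\mathcal{S}$ is meagre in $\mathcal{S}$ (or empty).
   Context: $\mathrm{Diff}^\infty_\mu(M)$ is the group of $C^\infty$ diffeomorphisms of $M$ preserving $\mu$ (normalized to a probability), with the $C^\infty$ topology. $C^\infty_\mu(M)$ is the space of smooth complex-valued functions on $M$ with zero $\mu$-mean. For $f\in \mathrm{Diff}^\infty_\mu(M)$, $Cob^\infty(f)=\{\varphi\in C^\infty_\mu(M): \exists\,\psi\in C^\infty_\mu(M),\ \psi\circ f-\psi=\varphi\}$. $f$ is Cohomologically Rigid, $f\in CR(M)$, iff $Cob^\infty(f)=C^\infty_\mu(M)$. Fix a Riemannian metric on $M$ inducing $\mu$, with an $L^2(\mu)$-orthonormal basis $\{\phi_i\}_{i\ge0}$ of eigenfunctions of the Laplacian, $\Delta\phi_i=-\lambda_i^2\phi_i$, $0=\lambda_0<\lambda_1\le\lambda_2\le\cdots$. For $s\in\mathbb{R}$, $H^s$ is the Sobolev space of $u=\sum_i\hat u_i\phi_i$ with $\|u\|_{H^s}^2=\sum_i(1+\lambda_i)^{2s}|\hat u_i|^2<\infty$ (distributions if $s<0$), and $\dot H^{s}=\{u\in H^s:\hat u_0=0\}$. A distribution $u$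 is preserved by $f$ if $\langle u,\psi\circ f\rangle=\langle u,\psi\rangle$ for all $\psi\in C^\infty(M)$. $\dot{\mathcal{H}}^{-\sigma}(M)$ is the set of $f\in\mathrm{Diff}^\infty_\mu(M)$ that preserve some non-zero distribution in $\dot H^{-\sigma}$. *)

theory Defs
  imports "HOL-Probability.Probability_Measure"
begin

definition partial_deriv :: "'n::finite \<Rightarrow> (real^'n \<Rightarrow> 'b::real_normed_vector) \<Rightarrow> real^'n \<Rightarrow> 'b" where
  "partial_deriv i f z = frechet_derivative f (at z) (axis i 1)"

fun iter_partial :: "'n::finite list \<Rightarrow> (real^'n \<Rightarrow> 'b::real_normed_vector) \<Rightarrow> real^'n \<Rightarrow> 'b" where
  "iter_partial [] f = f"
| "iter_partial (i # is) f = partial_deriv i (iter_partial is f)"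

text \<open>
  Only meaningful for open sets: a function is of class \<open>C\<^sup>\<infinity>\<close> iff all its iterated partial
  derivatives exist and are differentiable.
\<close>

definition smooth_on :: "(real^'n::finite) set \<Rightarrow> (real^'n \<Rightarrow> 'b::real_normed_vector) \<Rightarrow> bool" where
  "smooth_on S f \<longleftrightarrow> (\<forall>is. \<forall>z\<in>S. iter_partial is f differentiable (at z))"

text \<open>
  The manifold is the whole type \<open>'m\<close>. A chart is a pair \<open>(U, x)\<close>; the values of \<open>x\<close> outside
  \<open>U\<close> are irrelevant.
\<close>

type_synonym ('m, 'n) chart = "'m set \<times> ('m \<Rightarrow> real^'n)"

abbreviation chart_dom :: "('m, 'n::finite) chart \<Rightarrow> 'm set" where
  "chart_dom c \<equiv> fst c"

abbreviation chart_map :: "('m, 'n::finite) chart \<Rightarrow> 'm \<Rightarrow> real^'n" where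
  "chart_map c \<equiv> snd c"

definition chart_inv :: "('m, 'n::finite) chart \<Rightarrow> real^'n \<Rightarrow> 'm" where
  "chart_inv c = inv_into (fst c) (snd c)"

definition transition :: "('m, 'n::finite) chart \<Rightarrow> ('m, 'n) chart \<Rightarrow> real^'n \<Rightarrow> real^'n" where
  "transition c d = chart_map d \<circ> chart_inv c"

definition jacobian :: "('m, 'n::finite) chart \<Rightarrow> ('m, 'n) chart \<Rightarrow> 'm \<Rightarrow> real^'n^'n" where
  "jacobian c d p = matrix (frechet_derivative (transition c d) (at (chart_map c p)))"

definition oriented_atlas :: "('m::{t2_space, second_countable_topology}, 'n::finite) chart set \<Rightarrow> bool" where
  "oriented_atlas A \<longleftrightarrow>
     (\<Union>c\<in>A. chart_dom c) = UNIV \<and>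
     (\<forall>c\<in>A. open (chart_dom c) \<and> open (chart_map c ` chart_dom c) \<and>
        homeomorphism (chart_dom c) (chart_map c ` chart_dom c) (chart_map c) (chart_inv c)) \<and>
     (\<forall>c\<in>A. \<forall>d\<in>A.
        smooth_on (chart_map c ` (chart_dom c \<inter> chart_dom d)) (transition c d) \<and>
        (\<forall>p\<in>chart_dom c \<inter> chart_dom d. det (jacobian c d p) > 0))"

definition closed_oriented_manifold ::
    "('m::{t2_space, second_countable_topology}, 'n::finite) chart set \<Rightarrow> bool" where
  "closed_oriented_manifold A \<longleftrightarrow> compact (UNIV :: 'm set) \<and> oriented_atlas A"

text \<open>
  A volume form is given by its components: in the chart \<open>c = (U, x)\<close> it reads
  \<open>\<omega> c \<cdot> dx\<^sub>1 \<and> \<dots> \<and> dx\<^sub>n\<close> with \<open>\<omega> c\<close> a function on \<open>U\<close>. Positivity means compatibility with the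
  orientation.
\<close>

definition volume_form ::
    "('m, 'n::finite) chart set \<Rightarrow> (('m, 'n) chart \<Rightarrow> 'm \<Rightarrow> real) \<Rightarrow> bool" where
  "volume_form A \<omega> \<longleftrightarrow>
     (\<forall>c\<in>A. smooth_on (chart_map c ` chart_dom c) (\<omega> c \<circ> chart_inv c) \<and>
        (\<forall>p\<in>chart_dom c. \<omega> c p > 0)) \<and>
     (\<forall>c\<in>A. \<forall>d\<in>A. \<forall>p\<in>chart_dom c \<inter> chart_dom d. \<omega> c p = \<omega> d p * det (jacobian c d p))"

definition measure_of_volume_form ::
    "('m::{t2_space, second_countable_topology}, 'n::finite) chart set \<Rightarrow>
     (('m, 'n) chart \<Rightarrow> 'm \<Rightarrow> real) \<Rightarrow> 'm measure \<Rightarrow> bool" where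
  "measure_of_volume_form A \<omega> \<mu> \<longleftrightarrow>
     sets \<mu> = sets borel \<and>
     (\<forall>c\<in>A. \<forall>B\<in>sets borel. B \<subseteq> chart_dom c \<longrightarrow>
        emeasure \<mu> B = (\<integral>\<^sup>+z\<in>chart_map c ` B. ennreal (\<omega> c (chart_inv c z)) \<partial>lborel))"

definition riemannian_metric ::
    "('m, 'n::finite) chart set \<Rightarrow> (('m, 'n) chart \<Rightarrow> 'm \<Rightarrow> real^'n^'n) \<Rightarrow> bool" where
  "riemannian_metric A G \<longleftrightarrow>
     (\<forall>c\<in>A.
        (\<forall>i j. smooth_on (chart_map c ` chart_dom c) (\<lambda>z. G c (chart_inv c z) $ i $ j)) \<and>
        (\<forall>p\<in>chart_dom c. transpose (G c p) = G c p \<and> (\<forall>v. v \<noteq> 0 \<longrightarrow> v \<bullet> (G c p *v v) > 0))) \<and>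
     (\<forall>c\<in>A. \<forall>d\<in>A. \<forall>p\<in>chart_dom c \<inter> chart_dom d.
        G c p = transpose (jacobian c d p) ** G d p ** jacobian c d p)"

definition metric_induces ::
    "('m, 'n::finite) chart set \<Rightarrow> (('m, 'n) chart \<Rightarrow> 'm \<Rightarrow> real^'n^'n) \<Rightarrow>
     (('m, 'n) chart \<Rightarrow> 'm \<Rightarrow> real) \<Rightarrow> bool" where
  "metric_induces A G \<omega> \<longleftrightarrow> (\<forall>c\<in>A. \<forall>p\<in>chart_dom c. \<omega> c p = sqrt (det (G c p)))"

text \<open>
  The Laplace-Beltrami operator in the chart \<open>c\<close>, i.e.
  \<open>\<Delta>f = (1 / \<surd>g) \<Sum>\<^sub>i\<^sub>j \<partial>\<^sub>i (\<surd>g g\<^sup>i\<^sup>j \<partial>\<^sub>j f)\<close> with \<open>g = det G\<close>; its value at a point does not depend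
  on the chart.
\<close>

definition laplacian ::
    "(('m, 'n::finite) chart \<Rightarrow> 'm \<Rightarrow> real^'n^'n) \<Rightarrow> ('m, 'n) chart \<Rightarrow> ('m \<Rightarrow> complex) \<Rightarrow> 'm \<Rightarrow> complex" where
  "laplacian G c f p =
     (1 / sqrt (det (G c p))) *\<^sub>R
     (\<Sum>i\<in>UNIV. partial_deriv i
        (\<lambda>w. \<Sum>j\<in>UNIV. (sqrt (det (G c (chart_inv c w))) * matrix_inv (G c (chart_inv c w)) $ i $ j)
               *\<^sub>R partial_deriv j (f \<circ> chart_inv c) w)
        (chart_map c p))"

definition smooth_functions :: "('m, 'n::finite) chart set \<Rightarrow> ('m \<Rightarrow> complex) set" where
  "smooth_functions A = {f. \<forall>c\<in>A. smooth_on (chart_map c ` chart_dom c) (f \<circ> chart_inv c)}"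

definition zero_mean_functions ::
    "('m, 'n::finite) chart set \<Rightarrow> 'm measure \<Rightarrow> ('m \<Rightarrow> complex) set" where
  "zero_mean_functions A \<mu> = {f \<in> smooth_functions A. (\<integral>p. f p \<partial>\<mu>) = 0}"

definition local_rep ::
    "('m, 'n::finite) chart \<Rightarrow> ('m, 'n) chart \<Rightarrow> ('m \<Rightarrow> 'm) \<Rightarrow> real^'n \<Rightarrow> real^'n" where
  "local_rep c d f = chart_map d \<circ> f \<circ> chart_inv c"

definition smooth_maps ::
    "('m::topological_space, 'n::finite) chart set \<Rightarrow> ('m \<Rightarrow> 'm) set" where
  "smooth_maps A = {f. continuous_on UNIV f \<and>
     (\<forall>c\<in>A. \<forall>d\<in>A. smooth_on (chart_map c ` (chart_dom c \<inter> f -` chart_dom d)) (local_rep c d f))}"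

text \<open>
  The usual subbasis of the \<open>C\<^sup>\<infinity>\<close> topology: closeness, on a compact subset \<open>K\<close> of a chart that is
  mapped into a chart, of all partial derivatives up to order \<open>k\<close>.
\<close>

definition cinf_nbhd ::
    "('m::topological_space, 'n::finite) chart set \<Rightarrow> ('m, 'n) chart \<Rightarrow> ('m, 'n) chart \<Rightarrow>
     'm set \<Rightarrow> nat \<Rightarrow> real \<Rightarrow> ('m \<Rightarrow> 'm) \<Rightarrow> ('m \<Rightarrow> 'm) set" where
  "cinf_nbhd A c d K k \<epsilon> f =
     {g \<in> smooth_maps A. g ` K \<subseteq> chart_dom d \<and>
        (\<forall>is. length is \<le> k \<longrightarrow> (\<forall>p\<in>K.
           norm (iter_partial is (local_rep c d g) (chart_map c p)
               - iter_partial is (local_rep c d f) (chart_map c p)) < \<epsilon>))}"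

definition cinf_topology ::
    "('m::topological_space, 'n::finite) chart set \<Rightarrow> ('m \<Rightarrow> 'm) topology" where
  "cinf_topology A = topology_generated_by
     {cinf_nbhd A c d K k \<epsilon> f | c d K k \<epsilon> f.
        c \<in> A \<and> d \<in> A \<and> compact K \<and> K \<subseteq> chart_dom c \<and> f \<in> smooth_maps A \<and>
        f ` K \<subseteq> chart_dom d \<and> \<epsilon> > 0}"

text \<open>
  Preservation of \<open>\<mu>\<close> is preservation of the measure; orientation-reversing maps are allowed.
\<close>

definition Diff_mu ::
    "('m::topological_space, 'n::finite) chart set \<Rightarrow> 'm measure \<Rightarrow> ('m \<Rightarrow> 'm) set" where
  "Diff_mu A \<mu> =
     {f \<in> smooth_maps A. bij f \<and> inv f \<in> smooth_maps A \<and> distr \<mu> \<mu> f = \<mu>}"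

definition Cob ::
    "('m, 'n::finite) chart set \<Rightarrow> 'm measure \<Rightarrow> ('m \<Rightarrow> 'm) \<Rightarrow> ('m \<Rightarrow> complex) set" where
  "Cob A \<mu> f = {\<phi> \<in> zero_mean_functions A \<mu>.
     \<exists>\<psi>\<in>zero_mean_functions A \<mu>. \<forall>p. \<psi> (f p) - \<psi> p = \<phi> p}"

definition CR ::
    "('m::topological_space, 'n::finite) chart set \<Rightarrow> 'm measure \<Rightarrow> ('m \<Rightarrow> 'm) set" where
  "CR A \<mu> = {f \<in> Diff_mu A \<mu>. Cob A \<mu> f = zero_mean_functions A \<mu>}"

definition laplace_eigenbasis ::
    "('m::topological_space, 'n::finite) chart set \<Rightarrow> (('m, 'n) chart \<Rightarrow> 'm \<Rightarrow> real^'n^'n) \<Rightarrow>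
     'm measure \<Rightarrow> (nat \<Rightarrow> real) \<Rightarrow> (nat \<Rightarrow> 'm \<Rightarrow> complex) \<Rightarrow> bool" where
  "laplace_eigenbasis A G \<mu> ev \<phi> \<longleftrightarrow>
     (\<forall>i. \<phi> i \<in> smooth_functions A) \<and>
     (\<forall>i. \<forall>c\<in>A. \<forall>p\<in>chart_dom c. laplacian G c (\<phi> i) p = - of_real ((ev i)\<^sup>2) * \<phi> i p) \<and>
     ev 0 = 0 \<and> 0 < ev 1 \<and> (\<forall>i\<ge>1. ev i \<le> ev (Suc i)) \<and>
     (\<forall>i j. (\<integral>p. \<phi> i p * cnj (\<phi> j p) \<partial>\<mu>) = (if i = j then 1 else 0)) \<and>
     (\<forall>f\<in>borel_measurable \<mu>. integrable \<mu> (\<lambda>p. (cmod (f p))\<^sup>2) \<longrightarrow>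
        (\<lambda>N. \<integral>p. (cmod (f p - (\<Sum>i<N. (\<integral>q. f q * cnj (\<phi> i q) \<partial>\<mu>) * \<phi> i p)))\<^sup>2 \<partial>\<mu>)
          \<longlonglongrightarrow> 0)"

definition cinf_convergent ::
    "('m::topological_space, 'n::finite) chart set \<Rightarrow> (nat \<Rightarrow> 'm \<Rightarrow> complex) \<Rightarrow> ('m \<Rightarrow> complex) \<Rightarrow> bool" where
  "cinf_convergent A \<psi> \<psi>' \<longleftrightarrow>
     (\<forall>c\<in>A. \<forall>K is. compact K \<and> K \<subseteq> chart_dom c \<longrightarrow>
        uniform_limit (chart_map c ` K) (\<lambda>n. iter_partial is (\<psi> n \<circ> chart_inv c))
          (iter_partial is (\<psi>' \<circ> chart_inv c)) sequentially)"

text \<open>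
  Distributions are the continuous linear functionals on \<open>C\<^sup>\<infinity>(M)\<close>; since that space is metrizable,
  continuity is sequential continuity. Values on non-smooth functions are irrelevant.
\<close>

definition distribution ::
    "('m::topological_space, 'n::finite) chart set \<Rightarrow> (('m \<Rightarrow> complex) \<Rightarrow> complex) \<Rightarrow> bool" where
  "distribution A u \<longleftrightarrow>
     (\<forall>\<psi>\<in>smooth_functions A. \<forall>\<psi>'\<in>smooth_functions A. u (\<lambda>p. \<psi> p + \<psi>' p) = u \<psi> + u \<psi>') \<and>
     (\<forall>a. \<forall>\<psi>\<in>smooth_functions A. u (\<lambda>p. a * \<psi> p) = a * u \<psi>) \<and>
     (\<forall>\<psi> \<psi>'. (\<forall>n. \<psi> n \<in> smooth_functions A) \<and> \<psi>' \<in> smooth_functions A \<and> cinf_convergent A \<psi> \<psi>'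
        \<longrightarrow> (\<lambda>n. u (\<psi> n)) \<longlonglongrightarrow> u \<psi>')"

text \<open>
  \<open>u = \<Sum>\<^sub>i a\<^sub>i \<phi>\<^sub>i\<close> as distributions, a function \<open>\<phi>\<close> being the distribution \<open>\<psi> \<mapsto> \<integral>\<phi> \<psi> d\<mu>\<close>.
  The coefficients are determined by \<open>u\<close> when the \<open>\<phi>\<^sub>i\<close> are orthonormal: test with \<open>\<psi> = cnj \<phi>\<^sub>j\<close>.
\<close>

definition has_expansion ::
    "('m, 'n::finite) chart set \<Rightarrow> 'm measure \<Rightarrow> (nat \<Rightarrow> 'm \<Rightarrow> complex) \<Rightarrow>
     (('m \<Rightarrow> complex) \<Rightarrow> complex) \<Rightarrow> (nat \<Rightarrow> complex) \<Rightarrow> bool" where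
  "has_expansion A \<mu> \<phi> u a \<longleftrightarrow>
     (\<forall>\<psi>\<in>smooth_functions A. (\<lambda>i. a i * (\<integral>p. \<phi> i p * \<psi> p \<partial>\<mu>)) sums u \<psi>)"

definition sobolev_dot ::
    "('m::topological_space, 'n::finite) chart set \<Rightarrow> 'm measure \<Rightarrow> (nat \<Rightarrow> real) \<Rightarrow>
     (nat \<Rightarrow> 'm \<Rightarrow> complex) \<Rightarrow> real \<Rightarrow> (('m \<Rightarrow> complex) \<Rightarrow> complex) set" where
  "sobolev_dot A \<mu> ev \<phi> s = {u. distribution A u \<and>
     (\<exists>a. has_expansion A \<mu> \<phi> u a \<and> summable (\<lambda>i. (1 + ev i) powr (2 * s) * (cmod (a i))\<^sup>2) \<and> a 0 = 0)}"

definition preserves_distribution ::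
    "('m, 'n::finite) chart set \<Rightarrow> ('m \<Rightarrow> 'm) \<Rightarrow> (('m \<Rightarrow> complex) \<Rightarrow> complex) \<Rightarrow> bool" where
  "preserves_distribution A f u \<longleftrightarrow> (\<forall>\<psi>\<in>smooth_functions A. u (\<psi> \<circ> f) = u \<psi>)"

definition H_dot ::
    "('m::topological_space, 'n::finite) chart set \<Rightarrow> 'm measure \<Rightarrow> (nat \<Rightarrow> real) \<Rightarrow>
     (nat \<Rightarrow> 'm \<Rightarrow> complex) \<Rightarrow> real \<Rightarrow> ('m \<Rightarrow> 'm) set" where
  "H_dot A \<mu> ev \<phi> s = {f \<in> Diff_mu A \<mu>.
     \<exists>u\<in>sobolev_dot A \<mu> ev \<phi> s. (\<exists>\<psi>\<in>smooth_functions A. u \<psi> \<noteq> 0) \<and> preserves_distribution A f u}"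

definition nowhere_dense_in :: "'a topology \<Rightarrow> 'a set \<Rightarrow> bool" where
  "nowhere_dense_in X N \<longleftrightarrow> N \<subseteq> topspace X \<and> X interior_of (X closure_of N) = {}"

definition meagre_in :: "'a topology \<Rightarrow> 'a set \<Rightarrow> bool" where
  "meagre_in X B \<longleftrightarrow> (\<exists>N :: nat \<Rightarrow> 'a set. (\<forall>n. nowhere_dense_in X (N n)) \<and> B = (\<Union>n. N n))"

end

theory Submission
  imports Defs
begin

text \<open>
  If \<open>f\<close> is cohomologically rigid, let \<open>\<psi>\<^sub>j\<close> solve \<open>\<psi>\<^sub>j \<circ> f - \<psi>\<^sub>j = e\<^sub>j\<close>, where \<open>e\<^sub>j\<close> is a conjugated
  eigenfunction scaled by a rapidly decreasing weight that does not depend on \<open>f\<close>. By the uniform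
  boundedness principle the \<open>C\<^sup>k\<close> norms of the \<open>\<psi>\<^sub>j\<close> are bounded in \<open>j\<close>, for every \<open>k\<close>. Hence \<open>CR\<close> is
  the union over \<open>n\<close> of the sets \<open>B\<^sub>n\<close> of those \<open>f\<close> for which this bound is at most \<open>n\<close>.

  If \<open>f\<close> preserves a non-zero \<open>u\<close> in the dotted Sobolev space of order \<open>-\<sigma>\<close>, then \<open>u(e\<^sub>j) \<noteq> 0\<close> for some \<open>j\<close>.
  For \<open>g \<in> B\<^sub>n\<close> with solutions \<open>\<psi>\<^sub>j\<close>, invariance gives \<open>u(e\<^sub>j) = u(\<psi>\<^sub>j \<circ> g - \<psi>\<^sub>j \<circ> f)\<close>. Green's identity
  bounds \<open>u\<close> by a \<open>C\<^sup>2\<^sup>m\<close> norm with \<open>m \<ge> \<sigma>\<close>, and the \<open>C\<^sup>2\<^sup>m\<^sup>+\<^sup>1\<close> bound on \<open>\<psi>\<^sub>j\<close> makes this small when \<open>g\<close> is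
  close to \<open>f\<close>. So \<open>f\<close> is not in the closure of \<open>B\<^sub>n\<close>, and density makes \<open>B\<^sub>n\<close> nowhere dense.
\<close>

section \<open>Smooth functions on open subsets of Euclidean space\<close>

text \<open>The index \<open>j\<close> that detects \<open>u\<close> varies with \<open>f\<close>,
  so each set of the countable cover must control all solutions \<psi>_j at once: separate bounds
  for each \<open>j\<close> would be indexed by sequences of integers, which are uncountably many. A
  single integer suffices because the e_j are bounded in every C^k norm and the solution operator is
  bounded.

  C^\<infinity>(M) is not a Banach space, so that operator is studied on bounded sequences (c_j),
  sent to the sum of c_j e_j. Its boundedness comes from duality: as \<open>f\<close> preserves
  \<mu>, pairing a solution with a test function equals pairing the right-hand side with a fixed
  continuous function. This also gives uniqueness of zero-mean solutions, hence linearity. Point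
  values are limits of such pairings, derivatives are limits of difference quotients, and pointwise
  limits of bounded functionals are bounded. Each single solution is smooth, so the family of all
  derivative evaluations up to order k is pointwise bounded.

  The extra order in 2m + 1 pays for the mean value inequality between \<psi> o g and \<psi> o f.
  The zeroth coefficient of \<open>u\<close> vanishes, so the detecting eigenfunction can be taken
  with zero mean.\<close>

lemma frechet_derivative_cong_open:
  assumes "open V" "x \<in> V" "\<And>y. y \<in> V \<Longrightarrow> f y = g y"
  shows "frechet_derivative f (at x) = frechet_derivative g (at x)"
proof -
  have "(f has_derivative D) (at x) \<longleftrightarrow> (g has_derivative D) (at x)" for D
    using assms by (metis has_derivative_transform_within_open)
  then show ?thesis by (simp add: frechet_derivative_def)
qed

lemma differentiable_cong_open:
  assumes "open V" "x \<in> V" "\<And>y. y \<in> V \<Longrightarrow> f y = g y"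
  shows "f differentiable (at x) \<longleftrightarrow> g differentiable (at x)"
  using assms unfolding differentiable_def by (metis has_derivative_transform_within_open)

lemma partial_deriv_cong:
  assumes "open V" "x \<in> V" "\<And>y. y \<in> V \<Longrightarrow> f y = g y"
  shows "partial_deriv i f x = partial_deriv i g x"
  using frechet_derivative_cong_open[OF assms] by (simp add: partial_deriv_def)

text \<open>Derivatives at a point see only a neighbourhood, so agreement on the whole open set
  \<open>V\<close> passes from one order to the next. Agreement at \<open>x\<close> alone would not
  survive a single step.\<close>

lemma iter_partial_cong:
  assumes "open V" "x \<in> V" "\<And>y. y \<in> V \<Longrightarrow> f y = g y"
  shows "iter_partial is f x = iter_partial is g x"
  using assms(2)
proof (induction "is" arbitrary: x)
  case (Cons i "is")
  then show ?case using partial_deriv_cong[OF assms(1)] by (metis iter_partial.simps(2))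
qed (use assms in auto)

lemma iter_partial_append: "iter_partial (xs @ ys) f = iter_partial xs (iter_partial ys f)"
  by (induction xs) auto

lemma partial_deriv_eqI: "(f has_derivative D) (at x) \<Longrightarrow> partial_deriv i f x = D (axis i 1)"
  using frechet_derivative_at[of f D x] by (simp add: partial_deriv_def)

text \<open>The chain rule and the mean value inequality need the total derivative, whereas
  \<open>smooth_on\<close> and all later bounds speak of partial derivatives. This passes between
  the two.\<close>

lemma has_derivative_partial:
  assumes "f differentiable (at (x::real^'n::finite))"
  shows "(f has_derivative (\<lambda>v. \<Sum>i\<in>UNIV. (v $ i) *\<^sub>R partial_deriv i f x)) (at x)"
proof -
  have "frechet_derivative f (at x) v = (\<Sum>i\<in>UNIV. (v $ i) *\<^sub>R partial_deriv i f x)" for v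
  proof -
    have lin: "linear (frechet_derivative f (at x))" by (rule linear_frechet_derivative[OF assms])
    have "frechet_derivative f (at x) v = frechet_derivative f (at x) (\<Sum>i\<in>UNIV. (v $ i) *\<^sub>R axis i 1)"
      using basis_expansion[of v] by (simp add: scalar_mult_eq_scaleR)
    then show ?thesis using lin
      by (simp add: linear_sum linear_cmul partial_deriv_def)
  qed
  then show ?thesis using assms frechet_derivative_works by (metis (no_types, lifting) ext)
qed

text \<open>The finite-order form of \<open>smooth_on\<close>, on which closure properties can be
  proved by induction on the order. The strict inequality makes order 0 vacuous and the base cases
  trivial.\<close>

definition Ck_on :: "nat \<Rightarrow> (real^'n::finite) set \<Rightarrow> (real^'n \<Rightarrow> 'b::real_normed_vector) \<Rightarrow> bool" where
  "Ck_on k V f \<longleftrightarrow> (\<forall>is. length is < k \<longrightarrow> (\<forall>z\<in>V. iter_partial is f differentiable (at z)))"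

lemma Ck_on_0 [simp]: "Ck_on 0 V f"
  by (simp add: Ck_on_def)

lemma Ck_on_Suc:
  fixes f :: "real^'n::finite \<Rightarrow> 'b::real_normed_vector"
  shows "Ck_on (Suc k) V f \<longleftrightarrow> (\<forall>z\<in>V. f differentiable (at z)) \<and> (\<forall>i. Ck_on k V (partial_deriv i f))"
proof
  assume L: "Ck_on (Suc k) V f"
  have "f differentiable (at z)" if "z \<in> V" for z
    using L that unfolding Ck_on_def by (metis iter_partial.simps(1) length_0_conv zero_less_Suc)
  moreover have "Ck_on k V (partial_deriv i f)" for i
    unfolding Ck_on_def
  proof (intro allI impI ballI)
    fix "is" :: "'n list" and z assume "length is < k" "z \<in> V"
    then have "iter_partial (is @ [i]) f differentiable (at z)"
      using L unfolding Ck_on_def by simp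
    then show "iter_partial is (partial_deriv i f) differentiable (at z)"
      by (simp add: iter_partial_append)
  qed
  ultimately show "(\<forall>z\<in>V. f differentiable (at z)) \<and> (\<forall>i. Ck_on k V (partial_deriv i f))" by blast
next
  assume R: "(\<forall>z\<in>V. f differentiable (at z)) \<and> (\<forall>i. Ck_on k V (partial_deriv i f))"
  show "Ck_on (Suc k) V f" unfolding Ck_on_def
  proof (intro allI impI ballI)
    fix "is" :: "'n list" and z assume l: "length is < Suc k" "z \<in> V"
    show "iter_partial is f differentiable (at z)"
    \<comment> \<open>\<open>iter_partial\<close> applies the head of the list last, so the
      derivative taken first is the last entry, and the list is split from its end.\<close>
    proof (cases "is" rule: rev_cases)
      case Nil then show ?thesis using R l by auto
    next
      case (snoc js i)
      then have "iter_partial js (partial_deriv i f) differentiable (at z)"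
        using R l unfolding Ck_on_def by auto
      then show ?thesis using snoc by (simp add: iter_partial_append)
    qed
  qed
qed

lemma smooth_on_iff_Ck: "smooth_on V f \<longleftrightarrow> (\<forall>k. Ck_on k V f)"
  unfolding smooth_on_def Ck_on_def by blast

lemma Ck_on_mono: "Ck_on k V f \<Longrightarrow> l \<le> k \<Longrightarrow> Ck_on l V f"
  by (auto simp: Ck_on_def)

lemma Ck_on_cong:
  assumes "open V" "\<And>y. y \<in> V \<Longrightarrow> f y = g y"
  shows "Ck_on k V f \<longleftrightarrow> Ck_on k V g"
proof -
  have "iter_partial is f differentiable (at z) \<longleftrightarrow> iter_partial is g differentiable (at z)"
    if "z \<in> V" for z "is"
    by (rule differentiable_cong_open[OF assms(1) that]) (use iter_partial_cong[OF assms(1)] assms in auto)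
  then show ?thesis unfolding Ck_on_def by blast
qed

lemma smooth_on_cong:
  assumes "open V" "\<And>y. y \<in> V \<Longrightarrow> f y = g y"
  shows "smooth_on V f \<longleftrightarrow> smooth_on V g"
  using Ck_on_cong[OF assms] by (simp add: smooth_on_iff_Ck)

lemma smooth_on_subset: "smooth_on V f \<Longrightarrow> W \<subseteq> V \<Longrightarrow> smooth_on W f"
  by (auto simp: smooth_on_def)

lemma smooth_on_locally:
  assumes "\<And>x. x \<in> V \<Longrightarrow> \<exists>W g. open W \<and> x \<in> W \<and> smooth_on W g \<and> (\<forall>y\<in>W. f y = g y)"
  shows "smooth_on V f"
  unfolding smooth_on_def
proof (intro allI ballI)
  fix "is" z assume "z \<in> V"
  then obtain W g where W: "open W" "z \<in> W" "smooth_on W g" "\<forall>y\<in>W. f y = g y" using assms by metis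
  then have "smooth_on W f" using smooth_on_cong[of W f g] by auto
  then show "iter_partial is f differentiable (at z)" using W(2) by (auto simp: smooth_on_def)
qed

lemma smooth_on_differentiable: "smooth_on V f \<Longrightarrow> x \<in> V \<Longrightarrow> f differentiable (at x)"
  unfolding smooth_on_def by (metis iter_partial.simps(1))

lemma smooth_on_iter_partial: "smooth_on V f \<Longrightarrow> smooth_on V (iter_partial is f)"
  unfolding smooth_on_def by (metis iter_partial_append)

lemma smooth_on_partial: "smooth_on V f \<Longrightarrow> smooth_on V (partial_deriv i f)"
  using smooth_on_iter_partial[of V f "[i]"] by simp

lemma smooth_on_continuous: "smooth_on V f \<Longrightarrow> continuous_on V f"
  by (meson differentiable_imp_continuous_within continuous_at_imp_continuous_on smooth_on_differentiable)

lemma smooth_on_has_derivative: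
  "smooth_on V f \<Longrightarrow> x \<in> V \<Longrightarrow> (f has_derivative (\<lambda>v. \<Sum>i\<in>UNIV. (v $ i) *\<^sub>R partial_deriv i f x)) (at x)"
  by (rule has_derivative_partial[OF smooth_on_differentiable])

lemma partial_deriv_const [simp]: "partial_deriv i (\<lambda>x. c) = (\<lambda>x. 0)"
  by (rule ext) (simp add: partial_deriv_def)

lemma Ck_on_const: "Ck_on k V (\<lambda>x. c)"
  by (induction k arbitrary: c) (auto simp: Ck_on_Suc)

lemma smooth_on_const [simp, intro]: "smooth_on V (\<lambda>x. c)"
  by (simp add: smooth_on_iff_Ck Ck_on_const)

lemma partial_deriv_add:
  assumes "f differentiable (at x)" "g differentiable (at x)"
  shows "partial_deriv i (\<lambda>x. f x + g x) x = partial_deriv i f x + partial_deriv i g x"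
  by (subst partial_deriv_eqI[OF has_derivative_add])
     (use assms in \<open>auto simp: partial_deriv_def frechet_derivative_works\<close>)

lemma partial_deriv_linear:
  assumes "bounded_linear L" "f differentiable (at x)"
  shows "partial_deriv i (\<lambda>x. L (f x)) x = L (partial_deriv i f x)"
  by (subst partial_deriv_eqI[OF bounded_linear.has_derivative[OF assms(1)]])
     (use assms(2) in \<open>auto simp: partial_deriv_def frechet_derivative_works\<close>)

lemma partial_deriv_bilinear:
  assumes "bounded_bilinear p" "f differentiable (at x)" "g differentiable (at x)"
  shows "partial_deriv i (\<lambda>x. p (f x) (g x)) x = p (f x) (partial_deriv i g x) + p (partial_deriv i f x) (g x)"
  by (subst partial_deriv_eqI[OF bounded_bilinear.FDERIV[OF assms(1)]])
     (use assms(2,3) in \<open>auto simp: partial_deriv_def frechet_derivative_works\<close>)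

lemma Ck_on_add:
  assumes "open V"
  shows "Ck_on k V f \<Longrightarrow> Ck_on k V g \<Longrightarrow> Ck_on k V (\<lambda>x. f x + g x)"
proof (induction k arbitrary: f g)
  case (Suc k)
  have "Ck_on k V (partial_deriv i (\<lambda>x. f x + g x))" for i
    using Suc Ck_on_cong[OF assms, of "partial_deriv i (\<lambda>x. f x + g x)" "\<lambda>x. partial_deriv i f x + partial_deriv i g x"]
    by (auto simp: Ck_on_Suc partial_deriv_add)
  then show ?case using Suc.prems by (auto simp: Ck_on_Suc)
qed simp

lemma Ck_on_linear:
  assumes "open V" "bounded_linear L"
  shows "Ck_on k V f \<Longrightarrow> Ck_on k V (\<lambda>x. L (f x))"
proof (induction k arbitrary: f)
  case (Suc k)
  have "Ck_on k V (partial_deriv i (\<lambda>x. L (f x)))" for i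
    using Suc Ck_on_cong[OF assms(1), of "partial_deriv i (\<lambda>x. L (f x))" "\<lambda>x. L (partial_deriv i f x)"]
    by (auto simp: Ck_on_Suc partial_deriv_linear[OF assms(2)])
  moreover have "(\<lambda>x. L (f x)) differentiable (at z)" if "z \<in> V" for z
    using Suc.prems that bounded_linear.has_derivative[OF assms(2)] unfolding Ck_on_Suc differentiable_def by blast
  ultimately show ?case by (auto simp: Ck_on_Suc)
qed simp

lemma Ck_on_bilinear:
  assumes "open V" "bounded_bilinear p"
  shows "Ck_on k V f \<Longrightarrow> Ck_on k V g \<Longrightarrow> Ck_on k V (\<lambda>x. p (f x) (g x))"
proof (induction k arbitrary: f g)
  case (Suc k)
  have f: "Ck_on k V f" and g: "Ck_on k V g" using Suc.prems Ck_on_mono le_SucI by blast+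
  have "Ck_on k V (\<lambda>x. p (f x) (partial_deriv i g x) + p (partial_deriv i f x) (g x))" for i
    using Suc f g by (intro Ck_on_add[OF assms(1)]) (auto simp: Ck_on_Suc)
  then have "Ck_on k V (partial_deriv i (\<lambda>x. p (f x) (g x)))" for i
    using Suc.prems Ck_on_cong[OF assms(1), of "partial_deriv i (\<lambda>x. p (f x) (g x))"
      "\<lambda>x. p (f x) (partial_deriv i g x) + p (partial_deriv i f x) (g x)"]
    by (auto simp: Ck_on_Suc partial_deriv_bilinear[OF assms(2)])
  moreover have "(\<lambda>x. p (f x) (g x)) differentiable (at z)" if "z \<in> V" for z
    using Suc.prems that bounded_bilinear.FDERIV[OF assms(2)] unfolding Ck_on_Suc differentiable_def by blast
  ultimately show ?case by (auto simp: Ck_on_Suc)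
qed simp

lemma smooth_on_add: "open V \<Longrightarrow> smooth_on V f \<Longrightarrow> smooth_on V g \<Longrightarrow> smooth_on V (\<lambda>x. f x + g x)"
  by (simp add: smooth_on_iff_Ck Ck_on_add)

lemma smooth_on_linear: "open V \<Longrightarrow> bounded_linear L \<Longrightarrow> smooth_on V f \<Longrightarrow> smooth_on V (\<lambda>x. L (f x))"
  by (simp add: smooth_on_iff_Ck Ck_on_linear)

lemma smooth_on_bilinear:
  "open V \<Longrightarrow> bounded_bilinear p \<Longrightarrow> smooth_on V f \<Longrightarrow> smooth_on V g \<Longrightarrow> smooth_on V (\<lambda>x. p (f x) (g x))"
  by (simp add: smooth_on_iff_Ck Ck_on_bilinear)

lemmas smooth_on_mult = smooth_on_bilinear[OF _ bounded_bilinear_mult]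
lemmas smooth_on_scaleR = smooth_on_bilinear[OF _ bounded_bilinear_scaleR]
lemmas smooth_on_minus = smooth_on_linear[OF _ bounded_linear_minus[OF bounded_linear_ident]]
lemmas smooth_on_cnj = smooth_on_linear[OF _ bounded_linear_cnj]
lemmas smooth_on_of_real = smooth_on_linear[OF _ bounded_linear_of_real]

lemma smooth_on_diff:
  assumes "open V" "smooth_on V f" "smooth_on V g"
  shows "smooth_on V (\<lambda>x. f x - g x)"
  using smooth_on_add[OF assms(1,2) smooth_on_minus[OF assms(1,3)]] by simp

lemma smooth_on_sum: "open V \<Longrightarrow> (\<And>i. i \<in> I \<Longrightarrow> smooth_on V (f i)) \<Longrightarrow> smooth_on V (\<lambda>x. \<Sum>i\<in>I. f i x)"
  by (induction I rule: infinite_finite_induct) (auto intro: smooth_on_add)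

lemma smooth_on_prod:
  fixes f :: "'i \<Rightarrow> real^'n::finite \<Rightarrow> 'b::{real_normed_algebra,comm_ring_1}"
  shows "open V \<Longrightarrow> (\<And>i. i \<in> I \<Longrightarrow> smooth_on V (f i)) \<Longrightarrow> smooth_on V (\<lambda>x. \<Prod>i\<in>I. f i x)"
  by (induction I rule: infinite_finite_induct) (auto intro: smooth_on_mult)

lemma smooth_on_ident: "open V \<Longrightarrow> smooth_on V (\<lambda>x. x)"
proof -
  have "partial_deriv i (\<lambda>x. x) = (\<lambda>x. axis i 1)" for i :: 'a
    by (auto simp: partial_deriv_def)
  then have "Ck_on k V (\<lambda>x. x)" for k by (cases k) (auto simp: Ck_on_Suc Ck_on_const)
  then show ?thesis by (simp add: smooth_on_iff_Ck)
qed

lemma iter_partial_add: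
  assumes "open V" "smooth_on V f" "smooth_on V g" "x \<in> V"
  shows "iter_partial is (\<lambda>x. f x + g x) x = iter_partial is f x + iter_partial is g x"
  using assms(4)
proof (induction "is" arbitrary: x)
  case (Cons i "is")
  have "partial_deriv i (iter_partial is (\<lambda>x. f x + g x)) x = partial_deriv i (\<lambda>x. iter_partial is f x + iter_partial is g x) x"
    by (rule partial_deriv_cong[OF assms(1)]) (use Cons in auto)
  then show ?case using assms Cons.prems
    by (simp add: partial_deriv_add smooth_on_differentiable[OF smooth_on_iter_partial])
qed simp

lemma iter_partial_linear:
  assumes "open V" "bounded_linear L" "smooth_on V f" "x \<in> V"
  shows "iter_partial is (\<lambda>x. L (f x)) x = L (iter_partial is f x)"
  using assms(4)
proof (induction "is" arbitrary: x)
  case (Cons i "is")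
  have "partial_deriv i (iter_partial is (\<lambda>x. L (f x))) x = partial_deriv i (\<lambda>x. L (iter_partial is f x)) x"
    by (rule partial_deriv_cong[OF assms(1)]) (use Cons in auto)
  then show ?case using assms Cons.prems
    by (simp add: partial_deriv_linear smooth_on_differentiable[OF smooth_on_iter_partial])
qed simp

lemma iter_partial_diff:
  assumes "open V" "smooth_on V f" "smooth_on V g" "x \<in> V"
  shows "iter_partial is (\<lambda>x. f x - g x) x = iter_partial is f x - iter_partial is g x"
  using iter_partial_add[OF assms(1,2) smooth_on_minus[OF assms(1,3)] assms(4), of "is"]
    iter_partial_linear[OF assms(1) bounded_linear_minus[OF bounded_linear_ident] assms(3,4), of "is"]
  by simp

lemma iter_partial_eq_0:
  fixes f :: "real^'n::finite \<Rightarrow> 'b::real_normed_vector"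
  assumes "open V" "x \<in> V" "\<And>y. y \<in> V \<Longrightarrow> f y = 0"
  shows "iter_partial is f x = 0"
proof -
  have "iter_partial is (\<lambda>x. 0 :: 'b) = (\<lambda>x. 0)" for "is" :: "'n list" by (induction "is") auto
  then show ?thesis using iter_partial_cong[OF assms(1,2), of f "\<lambda>x. 0"] assms(3) by simp
qed

lemma partial_deriv_eq_0:
  "open V \<Longrightarrow> x \<in> V \<Longrightarrow> (\<And>y. y \<in> V \<Longrightarrow> f y = 0) \<Longrightarrow> partial_deriv i f x = 0"
  using iter_partial_eq_0[of V x f "[i]"] by simp

text \<open>The derivative of 1/f is -(1/f) f' (1/f), which involves only f' and 1/f itself, so
  order k + 1 reduces to order k by the product rule.\<close>

lemma Ck_on_inverse:
  fixes f :: "real^'n::finite \<Rightarrow> 'b::real_normed_field"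
  assumes "open V" "\<And>x. x \<in> V \<Longrightarrow> f x \<noteq> 0"
  shows "Ck_on k V f \<Longrightarrow> Ck_on k V (\<lambda>x. inverse (f x))"
proof (induction k)
  case (Suc k)
  have f: "Ck_on k V (\<lambda>x. inverse (f x))" using Suc Ck_on_mono le_SucI by blast
  have d: "((\<lambda>x. inverse (f x)) has_derivative (\<lambda>h. - (inverse (f x) * frechet_derivative f (at x) h * inverse (f x)))) (at x)"
    if "x \<in> V" for x
    using Suc.prems that by (intro Deriv.has_derivative_inverse assms(2)) (auto simp: Ck_on_Suc frechet_derivative_works)
  have "Ck_on k V (\<lambda>x. - ((inverse (f x) * partial_deriv i f x) * inverse (f x)))" for i
    using Suc.prems f
    by (intro Ck_on_linear[OF assms(1) bounded_linear_minus[OF bounded_linear_ident]]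
        Ck_on_bilinear[OF assms(1) bounded_bilinear_mult]) (auto simp: Ck_on_Suc)
  then have "Ck_on k V (partial_deriv i (\<lambda>x. inverse (f x)))" for i
    using Ck_on_cong[OF assms(1), of "partial_deriv i (\<lambda>x. inverse (f x))"
       "\<lambda>x. - ((inverse (f x) * partial_deriv i f x) * inverse (f x))" k] partial_deriv_eqI[OF d]
    by (auto simp: partial_deriv_def)
  then show ?case using d by (auto simp: Ck_on_Suc differentiable_def)
qed simp

lemma smooth_on_inverse:
  fixes f :: "real^'n::finite \<Rightarrow> 'b::real_normed_field"
  shows "open V \<Longrightarrow> smooth_on V f \<Longrightarrow> (\<And>x. x \<in> V \<Longrightarrow> f x \<noteq> 0) \<Longrightarrow> smooth_on V (\<lambda>x. inverse (f x))"
  by (simp add: smooth_on_iff_Ck Ck_on_inverse)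

text \<open>
  The functions \<open>p (1 / t) exp (- 1 / t)\<close>, extended by \<open>0\<close> to \<open>t \<le> 0\<close>, are closed under
  differentiation, which makes them smooth.
\<close>

definition flat_exp :: "real poly \<Rightarrow> real \<Rightarrow> real" where
  "flat_exp p t = (if t > 0 then poly p (1 / t) * exp (- (1 / t)) else 0)"

lemma poly_mult_exp_minus_tendsto_0: "((\<lambda>t. poly p t * exp (- t)) \<longlongrightarrow> (0::real)) at_top"
proof -
  have "((\<lambda>t. \<Sum>i\<le>degree p. coeff p i * (t ^ i / exp t)) \<longlongrightarrow> (\<Sum>i\<le>degree p. coeff p i * 0)) at_top"
    by (intro tendsto_intros tendsto_power_div_exp_0)
  moreover have "(\<lambda>t. poly p t * exp (- t)) = (\<lambda>t. \<Sum>i\<le>degree p. coeff p i * (t ^ i / exp t))"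
    by (simp add: poly_altdef sum_distrib_right exp_minus divide_inverse mult.assoc)
  ultimately show ?thesis by simp
qed

lemma flat_exp_tendsto_0: "(flat_exp p \<longlongrightarrow> 0) (at 0)"
proof -
  have "(flat_exp p \<longlongrightarrow> 0) (at_right 0)"
  proof (rule Lim_transform_eventually)
    show "((\<lambda>t. poly p (inverse t) * exp (- inverse t)) \<longlongrightarrow> 0) (at_right 0)"
      using filterlim_compose[OF poly_mult_exp_minus_tendsto_0 filterlim_inverse_at_top_right] .
    show "\<forall>\<^sub>F t in at_right 0. poly p (inverse t) * exp (- inverse t) = flat_exp p t"
      using eventually_at_right_less[of "0::real"] by eventually_elim (auto simp: flat_exp_def inverse_eq_divide)
  qed
  moreover have "(flat_exp p \<longlongrightarrow> 0) (at_left 0)"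
  proof (rule Lim_transform_eventually[OF tendsto_const])
    show "\<forall>\<^sub>F t in at_left 0. 0 = flat_exp p t"
      unfolding eventually_at_filter by (auto simp: flat_exp_def)
  qed
  ultimately show ?thesis by (simp add: filterlim_at_split)
qed

text \<open>With s = 1/t one has d/dt = -s^2 d/ds, which turns p(s) exp(-s) into s^2 (p - p')(s)
  exp(-s); the two \<open>pCons 0\<close> are the factor s^2. At 0 the difference quotient is again
  a member of the family, with p(s) replaced by s p(s), so it tends to 0.\<close>

lemma DERIV_flat_exp: "(flat_exp p has_real_derivative flat_exp (pCons 0 (pCons 0 (p - pderiv p))) t) (at t)"
proof -
  consider "t > 0" | "t < 0" | "t = 0" by linarith
  then show ?thesis
  proof cases
    case 1
    have "((\<lambda>t. poly p (1 / t) * exp (- (1 / t))) has_real_derivative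
        flat_exp (pCons 0 (pCons 0 (p - pderiv p))) t) (at t)"
      using 1 by (auto intro!: derivative_eq_intros DERIV_chain2[OF poly_DERIV] simp: flat_exp_def field_simps power2_eq_square)
    moreover have "\<forall>\<^sub>F s in nhds t. flat_exp p s = poly p (1 / s) * exp (- (1 / s))"
      using eventually_nhds_in_open[of "{0<..}" t] 1 by (auto elim!: eventually_mono simp: flat_exp_def)
    ultimately show ?thesis using DERIV_cong_ev[OF refl _ refl, of "flat_exp p"] by simp
  next
    case 2
    have "((\<lambda>t. 0) has_real_derivative flat_exp (pCons 0 (pCons 0 (p - pderiv p))) t) (at t)"
      using 2 by (auto simp: flat_exp_def)
    moreover have "\<forall>\<^sub>F s in nhds t. flat_exp p s = 0"
      using eventually_nhds_in_open[of "{..<0}" t] 2 by (auto elim!: eventually_mono simp: flat_exp_def)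
    ultimately show ?thesis using DERIV_cong_ev[OF refl _ refl, of "flat_exp p"] by simp
  next
    case 3
    have "((\<lambda>h. (flat_exp p (0 + h) - flat_exp p 0) / h) \<longlongrightarrow> 0) (at 0)"
    proof (rule Lim_transform_eventually[OF flat_exp_tendsto_0[of "pCons 0 p"]])
      show "\<forall>\<^sub>F h in at 0. flat_exp (pCons 0 p) h = (flat_exp p (0 + h) - flat_exp p 0) / h"
        by (rule always_eventually) (auto simp: flat_exp_def)
    qed
    then show ?thesis using 3 by (simp add: DERIV_def flat_exp_def)
  qed
qed

lemma Ck_on_flat_exp:
  assumes "open V"
  shows "Ck_on k V h \<Longrightarrow> Ck_on k V (\<lambda>x. flat_exp p (h x))"
proof (induction k arbitrary: p)
  case (Suc k)
  let ?q = "pCons 0 (pCons 0 (p - pderiv p))"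
  have h: "Ck_on k V (\<lambda>x. flat_exp q (h x))" for q using Suc Ck_on_mono le_SucI by blast
  have d: "((\<lambda>x. flat_exp p (h x)) has_derivative (\<lambda>v. flat_exp ?q (h x) * frechet_derivative h (at x) v)) (at x)"
    if "x \<in> V" for x
  proof -
    have "(h has_derivative frechet_derivative h (at x)) (at x)"
      using Suc.prems that by (auto simp: Ck_on_Suc frechet_derivative_works)
    moreover have "(flat_exp p has_derivative (*) (flat_exp ?q (h x))) (at (h x))"
      using DERIV_flat_exp[of p "h x"] by (simp add: has_field_derivative_def)
    ultimately show ?thesis by (rule has_derivative_compose)
  qed
  have "Ck_on k V (\<lambda>x. flat_exp ?q (h x) * partial_deriv i h x)" for i
    using Suc.prems h by (intro Ck_on_bilinear[OF assms(1) bounded_bilinear_mult]) (auto simp: Ck_on_Suc)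
  then have "Ck_on k V (partial_deriv i (\<lambda>x. flat_exp p (h x)))" for i
    using Ck_on_cong[OF assms(1), of "partial_deriv i (\<lambda>x. flat_exp p (h x))"
       "\<lambda>x. flat_exp ?q (h x) * partial_deriv i h x" k] partial_deriv_eqI[OF d]
    by (auto simp: partial_deriv_def)
  then show ?case using d by (auto simp: Ck_on_Suc differentiable_def)
qed simp

section \<open>Bump functions on balls\<close>

definition ball_bump :: "real^'n::finite \<Rightarrow> real \<Rightarrow> real^'n \<Rightarrow> real" where
  "ball_bump z r x = flat_exp 1 (r\<^sup>2 - (x - z) \<bullet> (x - z))"

lemma smooth_on_ball_bump: "smooth_on UNIV (ball_bump z r)"
proof -
  have "smooth_on UNIV (\<lambda>x. r\<^sup>2 - (x - z) \<bullet> (x - z))"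
    by (intro smooth_on_diff smooth_on_bilinear[OF _ bounded_bilinear_inner] smooth_on_ident smooth_on_const) auto
  then show ?thesis unfolding ball_bump_def[abs_def] smooth_on_iff_Ck by (simp add: Ck_on_flat_exp)
qed

lemma ball_bump_nonneg: "ball_bump z r x \<ge> 0"
  by (simp add: ball_bump_def flat_exp_def)

lemma ball_bump_pos_iff: "r > 0 \<Longrightarrow> ball_bump z r x > 0 \<longleftrightarrow> x \<in> ball z r"
proof -
  assume r: "r > 0"
  have "ball_bump z r x > 0 \<longleftrightarrow> (norm (x - z))\<^sup>2 < r\<^sup>2"
    by (simp add: ball_bump_def flat_exp_def dot_square_norm)
  also have "\<dots> \<longleftrightarrow> norm (x - z) < r"
    using r power2_less_imp_less[of "norm (x - z)" r] power_strict_mono[of "norm (x - z)" r 2] by auto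
  finally show ?thesis by (simp add: dist_norm norm_minus_commute)
qed

lemma ball_bump_eq_0: "r > 0 \<Longrightarrow> x \<notin> ball z r \<Longrightarrow> ball_bump z r x = 0"
  using ball_bump_pos_iff[of r z x] ball_bump_nonneg[of z r x] by linarith

section \<open>Jets, differential operators and the chain rule\<close>

text \<open>A relation to an arbitrary bound \<open>M\<close> instead of a norm, so that no supremum
  has to exist; it is pointwise, so that the compact set can be chosen later.\<close>

definition jet_le :: "nat \<Rightarrow> (real^'n::finite \<Rightarrow> 'b::real_normed_vector) \<Rightarrow> real^'n \<Rightarrow> real \<Rightarrow> bool" where
  "jet_le k h x M \<longleftrightarrow> (\<forall>is. length is \<le> k \<longrightarrow> norm (iter_partial is h x) \<le> M)"

lemma jet_leD: "jet_le k h x M \<Longrightarrow> length is \<le> k \<Longrightarrow> norm (iter_partial is h x) \<le> M"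
  by (simp add: jet_le_def)

lemma jet_le_norm: "jet_le k h x M \<Longrightarrow> norm (h x) \<le> M"
  using jet_leD[of k h x M "[]"] by simp

lemma jet_le_nonneg: "jet_le k h x M \<Longrightarrow> 0 \<le> M"
  using jet_le_norm norm_ge_zero order_trans by blast

lemma jet_le_mono: "jet_le k h x M \<Longrightarrow> l \<le> k \<Longrightarrow> M \<le> N \<Longrightarrow> jet_le l h x N"
  unfolding jet_le_def by (meson order_trans)

lemma jet_le_0: "jet_le 0 h x M \<longleftrightarrow> norm (h x) \<le> M"
  by (simp add: jet_le_def)

lemma jet_le_Suc:
  fixes h :: "real^'n::finite \<Rightarrow> 'b::real_normed_vector"
  shows "jet_le (Suc k) h x M \<longleftrightarrow> norm (h x) \<le> M \<and> (\<forall>i. jet_le k (partial_deriv i h) x M)"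
proof
  assume L: "jet_le (Suc k) h x M"
  have "jet_le k (partial_deriv i h) x M" for i
    unfolding jet_le_def using jet_leD[OF L, of "js @ [i]" for js] by (simp add: iter_partial_append)
  then show "norm (h x) \<le> M \<and> (\<forall>i. jet_le k (partial_deriv i h) x M)" using jet_le_norm[OF L] by blast
next
  assume R: "norm (h x) \<le> M \<and> (\<forall>i. jet_le k (partial_deriv i h) x M)"
  show "jet_le (Suc k) h x M" unfolding jet_le_def
  proof (intro allI impI)
    fix "is" :: "'n list" assume l: "length is \<le> Suc k"
    show "norm (iter_partial is h x) \<le> M"
    proof (cases "is" rule: rev_cases)
      case Nil then show ?thesis using R by simp
    next
      case (snoc js i) then show ?thesis using R l by (auto simp: iter_partial_append jet_le_def)
    qed
  qed
qed

lemma jet_le_cong: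
  assumes "open V" "x \<in> V" "\<And>y. y \<in> V \<Longrightarrow> f y = g y"
  shows "jet_le k f x M \<longleftrightarrow> jet_le k g x M"
  using iter_partial_cong[OF assms] by (simp add: jet_le_def)

lemma jet_le_add:
  assumes "open V" "x \<in> V" "smooth_on V f" "smooth_on V g" "jet_le k f x M" "jet_le k g x N"
  shows "jet_le k (\<lambda>x. f x + g x) x (M + N)"
  unfolding jet_le_def using assms
  by (auto simp: iter_partial_add[OF assms(1,3,4,2)] intro!: norm_triangle_le add_mono jet_leD)

lemma smooth_on_jet_bound:
  fixes h :: "real^'n::finite \<Rightarrow> 'b::real_normed_vector"
  assumes "smooth_on V h" "compact K" "K \<subseteq> V"
  shows "\<exists>M\<ge>0. \<forall>x\<in>K. jet_le k h x M"
proof -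
  let ?L = "{is :: 'n list. length is \<le> k}"
  have fin: "finite ?L" using finite_lists_length_le[of "UNIV :: 'n set" k] by simp
  have "\<exists>M\<ge>0. \<forall>x\<in>K. norm (iter_partial is h x) \<le> M" for "is"
  proof -
    have "compact (iter_partial is h ` K)"
      using smooth_on_continuous[OF smooth_on_iter_partial[OF assms(1)]] assms(2,3) compact_continuous_image continuous_on_subset by blast
    then obtain M where "M > 0" "\<forall>y\<in>iter_partial is h ` K. norm y \<le> M"
      using compact_imp_bounded bounded_pos by blast
    then show ?thesis by (intro exI[of _ M]) auto
  qed
  then obtain M where M: "\<And>is. M is \<ge> 0" "\<And>is x. x \<in> K \<Longrightarrow> norm (iter_partial is h x) \<le> M is" by metis
  \<comment> \<open>There are finitely many such lists because the index type is finite, and the sum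
    of the bounds serves as their maximum.\<close>
  have "M is \<le> (\<Sum>is\<in>?L. M is)" if "length is \<le> k" for "is"
    using M(1) fin that by (intro member_le_sum) auto
  then have "jet_le k h x (\<Sum>is\<in>?L. M is)" if "x \<in> K" for x
    unfolding jet_le_def using M(2)[OF that] order_trans by blast
  moreover have "(\<Sum>is\<in>?L. M is) \<ge> 0" using M(1) by (rule sum_nonneg)
  ultimately show ?thesis by blast
qed

lemma jet_le_cmult:
  fixes h :: "real^'n::finite \<Rightarrow> complex"
  assumes "open V" "smooth_on V h" "x \<in> V" "jet_le k h x M"
  shows "jet_le k (\<lambda>x. a * h x) x (cmod a * M)"
  unfolding jet_le_def iter_partial_linear[OF assms(1) bounded_linear_mult_right assms(2,3)]
  using jet_leD[OF assms(4)] by (simp add: norm_mult mult_left_mono)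

text \<open>By the product rule a derivative falls either on \<open>h\<close> or on
  \<open>a\<close>. In the second case the induction hypothesis is applied to a partial derivative
  of \<open>a\<close>, so \<open>a\<close> must vary in the induction. The constant depends on
  \<open>a\<close>, \<open>K\<close> and \<open>r\<close>, but not on \<open>h\<close>.\<close>

lemma jet_le_bilinear:
  fixes a :: "real^'n::finite \<Rightarrow> 'a::real_normed_vector"
    and p :: "'a \<Rightarrow> 'b::real_normed_vector \<Rightarrow> 'c::real_normed_vector"
  assumes "open V" "compact K" "K \<subseteq> V" "bounded_bilinear p"
  shows "smooth_on V a \<Longrightarrow> \<exists>C\<ge>0. \<forall>h x M. smooth_on V h \<longrightarrow> x \<in> K \<longrightarrow> jet_le r h x M \<longrightarrow>
           jet_le r (\<lambda>x. p (a x) (h x)) x (C * M)"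
proof (induction r arbitrary: a)
  have ex0: "\<exists>C\<ge>0. \<forall>h x M. x \<in> K \<longrightarrow> norm (h x) \<le> M \<longrightarrow> norm (p (a x) (h x)) \<le> C * M"
    if a: "smooth_on V a" for a
  proof -
    obtain B where B: "\<And>u v. norm (p u v) \<le> norm u * norm v * B" "B \<ge> 0"
      using bounded_bilinear.nonneg_bounded[OF assms(4)] by blast
    have "compact (a ` K)"
      using smooth_on_continuous[OF a] assms compact_continuous_image continuous_on_subset by blast
    then obtain N where N: "\<And>x. x \<in> K \<Longrightarrow> norm (a x) \<le> N" "N > 0"
      using compact_imp_bounded bounded_pos by (metis imageI)
    have "norm (p (a x) (h x)) \<le> (N * B) * M" if "x \<in> K" "norm (h x) \<le> M" for h x M
    proof -
      have "norm (a x) * norm (h x) * B \<le> N * M * B"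
        using N that B(2) by (intro mult_right_mono mult_mono) auto
      then show ?thesis using B(1)[of "a x" "h x"] by (simp add: algebra_simps)
    qed
    then show ?thesis using N(2) B(2) by (intro exI[of _ "N * B"]) auto
  qed
  case 0
  then show ?case
    unfolding jet_le_0 using ex0[OF 0] by (elim exE conjE) (rule exI, rule conjI, assumption, blast)
next
  case (Suc r)
  obtain C0 where C0: "C0 \<ge> 0" "\<And>h x M. smooth_on V h \<Longrightarrow> x \<in> K \<Longrightarrow> jet_le r h x M \<Longrightarrow>
      jet_le r (\<lambda>x. p (a x) (h x)) x (C0 * M)" using Suc.IH[OF Suc.prems] by blast
  obtain D where D: "\<And>i. D i \<ge> 0" "\<And>i h x M. smooth_on V h \<Longrightarrow> x \<in> K \<Longrightarrow> jet_le r h x M \<Longrightarrow>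
      jet_le r (\<lambda>x. p (partial_deriv i a x) (h x)) x (D i * M)"
    using Suc.IH[OF smooth_on_partial[OF Suc.prems]] by metis
  \<comment> \<open>\<open>C0\<close> pays for the derivative falling on \<open>h\<close> and
    \<open>D i\<close> for the one falling on \<open>a\<close>; the sum over all directions stands
    in for a maximum over \<open>i\<close>.\<close>
  define C where "C = C0 + (\<Sum>i\<in>UNIV. D i)"
  have "jet_le (Suc r) (\<lambda>x. p (a x) (h x)) x (C * M)"
    if h: "smooth_on V h" "x \<in> K" "jet_le (Suc r) h x M" for h x M
  proof -
    have M: "M \<ge> 0" using jet_le_nonneg h by blast
    have "C0 \<le> C" using D(1) by (simp add: C_def sum_nonneg)
    then have le0: "C0 * M \<le> C * M" using M mult_right_mono by blast
    have hr: "jet_le r h x M" using h jet_le_mono by (metis le_Suc_eq order_refl)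
    then have "norm (p (a x) (h x)) \<le> C * M" using jet_le_norm[OF C0(2)[OF h(1,2) hr]] le0 by linarith
    moreover have "jet_le r (partial_deriv i (\<lambda>x. p (a x) (h x))) x (C * M)" for i
    proof -
      have "jet_le r (\<lambda>x. p (a x) (partial_deriv i h x) + p (partial_deriv i a x) (h x)) x (C0 * M + D i * M)"
      proof (rule jet_le_add[OF assms(1)])
        show "x \<in> V" using h assms by blast
        show "jet_le r (\<lambda>x. p (a x) (partial_deriv i h x)) x (C0 * M)"
          using C0(2) smooth_on_partial[OF h(1)] h by (simp add: jet_le_Suc)
        show "jet_le r (\<lambda>x. p (partial_deriv i a x) (h x)) x (D i * M)"
          using D(2) h hr by blast
      qed (intro smooth_on_bilinear[OF assms(1,4)] smooth_on_partial h Suc.prems)+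
      moreover have "D i \<le> (\<Sum>i\<in>UNIV. D i)" using D(1) by (intro member_le_sum) auto
      then have "C0 * M + D i * M \<le> C * M" using M by (simp add: C_def mult_right_mono flip: distrib_right)
      ultimately have "jet_le r (\<lambda>x. p (a x) (partial_deriv i h x) + p (partial_deriv i a x) (h x)) x (C * M)"
        using jet_le_mono by blast
      moreover have "x \<in> V" using h assms by blast
      ultimately show ?thesis
        by (subst jet_le_cong[OF assms(1), where g = "\<lambda>x. p (a x) (partial_deriv i h x) + p (partial_deriv i a x) (h x)"])
          (auto intro!: partial_deriv_bilinear[OF assms(4)] smooth_on_differentiable[OF Suc.prems] smooth_on_differentiable[OF h(1)])
    qed
    ultimately show ?thesis by (simp add: jet_le_Suc)
  qed
  moreover have "C \<ge> 0" using C0(1) D(1) by (simp add: C_def sum_nonneg)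
  ultimately show ?case by blast
qed

text \<open>All that is retained of a differential operator of order k: on \<open>K\<close> it costs
  k derivatives, with a constant uniform in the function. Quantifying over every target order r
  makes the notion stable under composition.\<close>

definition order_le ::
    "(real^'n::finite) set \<Rightarrow> (real^'n) set \<Rightarrow> nat \<Rightarrow>
     ((real^'n \<Rightarrow> 'b::real_normed_vector) \<Rightarrow> real^'n \<Rightarrow> 'c::real_normed_vector) \<Rightarrow> bool" where
  "order_le V K k P \<longleftrightarrow> (\<forall>h. smooth_on V h \<longrightarrow> smooth_on V (P h)) \<and>
     (\<forall>r. \<exists>C\<ge>0. \<forall>h x M. smooth_on V h \<longrightarrow> x \<in> K \<longrightarrow> jet_le (r + k) h x M \<longrightarrow> jet_le r (P h) x (C * M))"

lemma order_le_smooth: "order_le V K k P \<Longrightarrow> smooth_on V h \<Longrightarrow> smooth_on V (P h)"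
  by (simp add: order_le_def)

lemma order_le_sup_bound:
  assumes "order_le V K k P"
  obtains C where "C \<ge> 0"
    "\<And>h x M. smooth_on V h \<Longrightarrow> x \<in> K \<Longrightarrow> jet_le k h x M \<Longrightarrow> norm (P h x) \<le> C * M"
proof -
  have "\<exists>C\<ge>0. \<forall>h x M. smooth_on V h \<longrightarrow> x \<in> K \<longrightarrow> jet_le (0 + k) h x M \<longrightarrow> jet_le 0 (P h) x (C * M)"
    using assms unfolding order_le_def by blast
  then obtain C where "C \<ge> 0" "\<forall>h x M. smooth_on V h \<longrightarrow> x \<in> K \<longrightarrow> jet_le (0 + k) h x M \<longrightarrow> jet_le 0 (P h) x (C * M)"
    by blast
  then show thesis using that[of C] by (simp add: jet_le_0)
qed

lemma order_le_ident: "order_le V K 0 (\<lambda>h. h)"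
  unfolding order_le_def by (auto intro: exI[of _ 1])

lemma order_le_partial: "order_le V K 1 (partial_deriv i)"
  unfolding order_le_def by (auto simp: smooth_on_partial jet_le_Suc intro!: exI[of _ 1])

lemma order_le_bilinear:
  assumes "open V" "compact K" "K \<subseteq> V" "bounded_bilinear p" "smooth_on V a"
  shows "order_le V K 0 (\<lambda>h x. p (a x) (h x))"
  unfolding order_le_def using jet_le_bilinear[OF assms] smooth_on_bilinear[OF assms(1,4,5)] by auto

lemma order_le_compose:
  assumes "order_le V K k P" "order_le V K l Q"
  shows "order_le V K (k + l) (\<lambda>h. P (Q h))"
  unfolding order_le_def
proof (intro conjI allI impI)
  fix r
  obtain C where C: "C \<ge> 0" "\<And>h x M. smooth_on V h \<Longrightarrow> x \<in> K \<Longrightarrow> jet_le (r + k) h x M \<Longrightarrow> jet_le r (P h) x (C * M)"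
    using assms(1) unfolding order_le_def by meson
  obtain D where D: "D \<ge> 0" "\<And>h x M. smooth_on V h \<Longrightarrow> x \<in> K \<Longrightarrow> jet_le (r + k + l) h x M \<Longrightarrow> jet_le (r + k) (Q h) x (D * M)"
    using assms(2) unfolding order_le_def by meson
  show "\<exists>C\<ge>0. \<forall>h x M. smooth_on V h \<longrightarrow> x \<in> K \<longrightarrow> jet_le (r + (k + l)) h x M \<longrightarrow> jet_le r (P (Q h)) x (C * M)"
    using C D order_le_smooth[OF assms(2)] by (intro exI[of _ "C * D"]) (simp add: mult.assoc add.assoc)
qed (auto intro: order_le_smooth[OF assms(1)] order_le_smooth[OF assms(2)])

lemma order_le_add:
  assumes "open V" "K \<subseteq> V" "order_le V K k P" "order_le V K k Q"
  shows "order_le V K k (\<lambda>h x. P h x + Q h x)"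
  unfolding order_le_def
proof (intro conjI allI impI)
  fix r
  obtain C where C: "C \<ge> 0" "\<And>h x M. smooth_on V h \<Longrightarrow> x \<in> K \<Longrightarrow> jet_le (r + k) h x M \<Longrightarrow> jet_le r (P h) x (C * M)"
    using assms(3) unfolding order_le_def by meson
  obtain D where D: "D \<ge> 0" "\<And>h x M. smooth_on V h \<Longrightarrow> x \<in> K \<Longrightarrow> jet_le (r + k) h x M \<Longrightarrow> jet_le r (Q h) x (D * M)"
    using assms(4) unfolding order_le_def by meson
  have "jet_le r (\<lambda>x. P h x + Q h x) x ((C + D) * M)"
    if "smooth_on V h" "x \<in> K" "jet_le (r + k) h x M" for h x M
    unfolding distrib_right
    by (rule jet_le_add[OF assms(1)]) (use that assms C D order_le_smooth in auto)
  then show "\<exists>C\<ge>0. \<forall>h x M. smooth_on V h \<longrightarrow> x \<in> K \<longrightarrow> jet_le (r + k) h x M \<longrightarrow> jet_le r (\<lambda>x. P h x + Q h x) x (C * M)"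
    using C(1) D(1) by (intro exI[of _ "C + D"]) auto
qed (use assms order_le_smooth in \<open>auto intro!: smooth_on_add\<close>)

lemma order_le_zero: "order_le V K k (\<lambda>h x. 0)"
  unfolding order_le_def jet_le_def
proof (intro conjI allI impI)
  fix r
  show "\<exists>C\<ge>0. \<forall>h x M. smooth_on V h \<longrightarrow> x \<in> K \<longrightarrow> (\<forall>is. length is \<le> r + k \<longrightarrow> norm (iter_partial is h x) \<le> M) \<longrightarrow>
      (\<forall>is. length is \<le> r \<longrightarrow> norm (iter_partial is (\<lambda>x. 0) x) \<le> C * M)"
    using iter_partial_eq_0[of UNIV _ "\<lambda>x. 0"] by (intro exI[of _ 0]) auto
qed auto

lemma order_le_sum:
  assumes "open V" "K \<subseteq> V" "\<And>i. i \<in> I \<Longrightarrow> order_le V K k (P i)"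
  shows "order_le V K k (\<lambda>h x. \<Sum>i\<in>I. P i h x)"
  using assms(3)
proof (induction I rule: infinite_finite_induct)
  case (insert j I)
  then show ?case using order_le_add[OF assms(1,2), of k "P j" "\<lambda>h x. \<Sum>i\<in>I. P i h x"] by simp
qed (auto intro: order_le_zero)

lemma order_le_funpow:
  fixes P :: "(real^'n::finite \<Rightarrow> 'b::real_normed_vector) \<Rightarrow> real^'n \<Rightarrow> 'b"
  assumes "order_le V K k P"
  shows "order_le V K (m * k) (P ^^ m)"
proof (induction m)
  case 0 show ?case unfolding funpow.simps mult_0 id_def by (rule order_le_ident)
next
  case (Suc m)
  then show ?case using order_le_compose[OF assms Suc] by (simp add: comp_def)
qed

text \<open>
  The shape of the iterated derivatives of a composition \<open>\<psi> \<circ> G\<close>: the class is closed under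
  differentiation and stable under perturbations of \<open>G\<close>, so the coefficients in Faa di Bruno's
  formula are never needed.
\<close>

inductive chain_form ::
    "nat \<Rightarrow> ((real^'m::finite \<Rightarrow> 'b::real_normed_vector) \<Rightarrow> (real^'n::finite \<Rightarrow> real^'m) \<Rightarrow> real^'n \<Rightarrow> 'b) \<Rightarrow> bool"
  for k where
  base: "length js \<le> k \<Longrightarrow> chain_form k (\<lambda>\<psi> G x. iter_partial js \<psi> (G x))"
| mult: "chain_form k \<Theta> \<Longrightarrow> length js \<le> k \<Longrightarrow> chain_form k (\<lambda>\<psi> G x. (iter_partial js G x $ j) *\<^sub>R \<Theta> \<psi> G x)"
| add: "chain_form k \<Theta> \<Longrightarrow> chain_form k \<Theta>' \<Longrightarrow> chain_form k (\<lambda>\<psi> G x. \<Theta> \<psi> G x + \<Theta>' \<psi> G x)"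
| zero: "chain_form k (\<lambda>\<psi> G x. 0)"

lemma chain_form_mono: "chain_form k \<Theta> \<Longrightarrow> k \<le> l \<Longrightarrow> chain_form l \<Theta>"
  by (induction rule: chain_form.induct) (auto intro: chain_form.intros)

lemma chain_form_sum: "finite J \<Longrightarrow> (\<And>j. j \<in> J \<Longrightarrow> chain_form k (\<Theta> j)) \<Longrightarrow> chain_form k (\<lambda>\<psi> G x. \<Sum>j\<in>J. \<Theta> j \<psi> G x)"
  by (induction J rule: finite_induct) (auto intro: chain_form.intros)

lemma chain_form_partial:
  fixes \<Theta> :: "(real^'m::finite \<Rightarrow> 'b::real_normed_vector) \<Rightarrow> (real^'n::finite \<Rightarrow> real^'m) \<Rightarrow> real^'n \<Rightarrow> 'b"
  assumes "chain_form k \<Theta>"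
  shows "\<exists>\<Theta>'. chain_form (Suc k) \<Theta>' \<and>
    (\<forall>\<psi> G V W x. smooth_on V \<psi> \<longrightarrow> smooth_on W G \<longrightarrow> G ` W \<subseteq> V \<longrightarrow> x \<in> W \<longrightarrow>
       \<Theta> \<psi> G differentiable (at x) \<and> partial_deriv i (\<Theta> \<psi> G) x = \<Theta>' \<psi> G x)"
  using assms
proof (induction rule: chain_form.induct)
  case (base js)
  let ?T = "\<lambda>\<psi> G x. \<Sum>j\<in>UNIV. (iter_partial [i] G x $ j) *\<^sub>R iter_partial (j # js) \<psi> (G x)"
  have "chain_form (Suc k) (\<lambda>\<psi> G x. iter_partial (j # js) \<psi> (G x))" for j :: 'm
    using base chain_form.base[of "j # js" "Suc k"] by simp
  then have "chain_form (Suc k) ?T"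
    by (intro chain_form_sum chain_form.mult) auto
  moreover have "(\<lambda>x. iter_partial js \<psi> (G x)) differentiable (at x) \<and> partial_deriv i (\<lambda>x. iter_partial js \<psi> (G x)) x = ?T \<psi> G x"
    if "smooth_on V \<psi>" "smooth_on W G" "G ` W \<subseteq> V" "x \<in> W" for \<psi> G V W x
  proof -
    have dG: "(G has_derivative frechet_derivative G (at x)) (at x)"
      using smooth_on_differentiable[OF that(2,4)] frechet_derivative_works by blast
    have "(iter_partial js \<psi> has_derivative (\<lambda>v. \<Sum>j\<in>UNIV. (v $ j) *\<^sub>R partial_deriv j (iter_partial js \<psi>) (G x))) (at (G x))"
      using that(3,4) by (intro smooth_on_has_derivative[OF smooth_on_iter_partial[OF that(1)]]) auto
    from has_derivative_compose[OF dG this]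
    have "((\<lambda>x. iter_partial js \<psi> (G x)) has_derivative
        (\<lambda>v. \<Sum>j\<in>UNIV. (frechet_derivative G (at x) v $ j) *\<^sub>R partial_deriv j (iter_partial js \<psi>) (G x))) (at x)" .
    then show ?thesis using partial_deriv_eqI by (fastforce simp: differentiable_def partial_deriv_def)
  qed
  ultimately show ?case by blast
next
  case (mult \<Theta> js j)
  then obtain \<Theta>' where \<Theta>': "chain_form (Suc k) \<Theta>'"
    "\<And>\<psi> G V W x. smooth_on V \<psi> \<Longrightarrow> smooth_on W G \<Longrightarrow> G ` W \<subseteq> V \<Longrightarrow> x \<in> W \<Longrightarrow>
       \<Theta> \<psi> G differentiable (at x) \<and> partial_deriv i (\<Theta> \<psi> G) x = \<Theta>' \<psi> G x" by blast
  let ?T = "\<lambda>\<psi> G x. (iter_partial js G x $ j) *\<^sub>R \<Theta>' \<psi> G x + (iter_partial (i # js) G x $ j) *\<^sub>R \<Theta> \<psi> G x"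
  have "chain_form (Suc k) \<Theta>" using mult(1) chain_form_mono by (metis le_SucI order_refl)
  then have "chain_form (Suc k) ?T"
    using mult(2) \<Theta>'(1) by (intro chain_form.add chain_form.mult) auto
  moreover have "(\<lambda>x. (iter_partial js G x $ j) *\<^sub>R \<Theta> \<psi> G x) differentiable (at x) \<and>
      partial_deriv i (\<lambda>x. (iter_partial js G x $ j) *\<^sub>R \<Theta> \<psi> G x) x = ?T \<psi> G x"
    if "smooth_on V \<psi>" "smooth_on W G" "G ` W \<subseteq> V" "x \<in> W" for \<psi> G V W x
  proof -
    have G: "iter_partial js G differentiable (at x)"
      using that smooth_on_differentiable smooth_on_iter_partial by blast
    have Gj: "(\<lambda>x. iter_partial js G x $ j) differentiable (at x)"
      using G bounded_linear.has_derivative[OF bounded_linear_vec_nth] unfolding differentiable_def by blast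
    have T: "\<Theta> \<psi> G differentiable (at x)" "partial_deriv i (\<Theta> \<psi> G) x = \<Theta>' \<psi> G x" using \<Theta>'(2)[OF that] by auto
    have "(\<lambda>x. (iter_partial js G x $ j) *\<^sub>R \<Theta> \<psi> G x) differentiable (at x)"
      using Gj T(1) bounded_bilinear.FDERIV[OF bounded_bilinear_scaleR] unfolding differentiable_def by blast
    then show ?thesis
      using partial_deriv_bilinear[OF bounded_bilinear_scaleR Gj T(1), of i] T(2)
        partial_deriv_linear[OF bounded_linear_vec_nth G, of i j] by simp
  qed
  ultimately show ?case by blast
next
  case (add \<Theta>1 \<Theta>2)
  from add.IH(1) obtain \<Theta>1' :: "(real^'m \<Rightarrow> 'b) \<Rightarrow> (real^'n \<Rightarrow> real^'m) \<Rightarrow> real^'n \<Rightarrow> 'b" where T1: "chain_form (Suc k) \<Theta>1'"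
    "\<forall>\<psi> G V W x. smooth_on V \<psi> \<longrightarrow> smooth_on W G \<longrightarrow> G ` W \<subseteq> V \<longrightarrow> x \<in> W \<longrightarrow>
       \<Theta>1 \<psi> G differentiable (at x) \<and> partial_deriv i (\<Theta>1 \<psi> G) x = \<Theta>1' \<psi> G x"
    by (elim exE conjE) (rule that)
  from add.IH(2) obtain \<Theta>2' :: "(real^'m \<Rightarrow> 'b) \<Rightarrow> (real^'n \<Rightarrow> real^'m) \<Rightarrow> real^'n \<Rightarrow> 'b" where T2: "chain_form (Suc k) \<Theta>2'"
    "\<forall>\<psi> G V W x. smooth_on V \<psi> \<longrightarrow> smooth_on W G \<longrightarrow> G ` W \<subseteq> V \<longrightarrow> x \<in> W \<longrightarrow>
       \<Theta>2 \<psi> G differentiable (at x) \<and> partial_deriv i (\<Theta>2 \<psi> G) x = \<Theta>2' \<psi> G x"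
    by (elim exE conjE) (rule that)
  show ?case
  proof (intro exI[of _ "\<lambda>\<psi> G x. \<Theta>1' \<psi> G x + \<Theta>2' \<psi> G x"] conjI allI impI)
    show "chain_form (Suc k) (\<lambda>\<psi> G x. \<Theta>1' \<psi> G x + \<Theta>2' \<psi> G x)" by (rule chain_form.add[OF T1(1) T2(1)])
    fix \<psi> :: "real^'m \<Rightarrow> 'b" and G :: "real^'n \<Rightarrow> real^'m" and V W x assume a: "smooth_on V \<psi>" "smooth_on W G" "G ` W \<subseteq> V" "x \<in> W"
    note t = T1(2)[rule_format, OF a] T2(2)[rule_format, OF a]
    show "(\<lambda>x. \<Theta>1 \<psi> G x + \<Theta>2 \<psi> G x) differentiable (at x)" using t by simp
    show "partial_deriv i (\<lambda>x. \<Theta>1 \<psi> G x + \<Theta>2 \<psi> G x) x = \<Theta>1' \<psi> G x + \<Theta>2' \<psi> G x"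
      using t by (simp add: partial_deriv_add)
  qed
next
  case zero
  show ?case by (intro exI[of _ "\<lambda>\<psi> G x. 0"]) (auto intro: chain_form.zero)
qed

text \<open>The form is chosen before \<psi> and \<open>G\<close>, so that a single estimate for it
  is uniform in both.\<close>

lemma iter_partial_chain_form:
  fixes "is" :: "'n::finite list"
  shows "\<exists>\<Theta> :: (real^'m::finite \<Rightarrow> 'b::real_normed_vector) \<Rightarrow> (real^'n \<Rightarrow> real^'m) \<Rightarrow> real^'n \<Rightarrow> 'b. chain_form (length is) \<Theta> \<and>
    (\<forall>\<psi> G V W x. open W \<longrightarrow> smooth_on V \<psi> \<longrightarrow> smooth_on W G \<longrightarrow> G ` W \<subseteq> V \<longrightarrow> x \<in> W \<longrightarrow>
       iter_partial is (\<lambda>x. \<psi> (G x)) x = \<Theta> \<psi> G x)"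
proof (induction "is")
  case Nil
  have "chain_form 0 (\<lambda>\<psi> G x. iter_partial [] \<psi> (G x))" by (rule chain_form.base) simp
  then show ?case by auto
next
  case (Cons i "is")
  from Cons.IH obtain \<Theta> :: "(real^'m \<Rightarrow> 'b) \<Rightarrow> (real^'n \<Rightarrow> real^'m) \<Rightarrow> real^'n \<Rightarrow> 'b" where T: "chain_form (length is) \<Theta>"
    "\<forall>\<psi> G V W x. open W \<longrightarrow> smooth_on V \<psi> \<longrightarrow> smooth_on W G \<longrightarrow> G ` W \<subseteq> V \<longrightarrow> x \<in> W \<longrightarrow>
       iter_partial is (\<lambda>x. \<psi> (G x)) x = \<Theta> \<psi> G x"
    by (elim exE conjE) (rule that)
  from chain_form_partial[OF T(1), of i] obtain \<Theta>' :: "(real^'m \<Rightarrow> 'b) \<Rightarrow> (real^'n \<Rightarrow> real^'m) \<Rightarrow> real^'n \<Rightarrow> 'b" where T': "chain_form (Suc (length is)) \<Theta>'"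
    "\<forall>\<psi> G V W x. smooth_on V \<psi> \<longrightarrow> smooth_on W G \<longrightarrow> G ` W \<subseteq> V \<longrightarrow> x \<in> W \<longrightarrow>
       \<Theta> \<psi> G differentiable (at x) \<and> partial_deriv i (\<Theta> \<psi> G) x = \<Theta>' \<psi> G x"
    by (elim exE conjE) (rule that)
  have "iter_partial (i # is) (\<lambda>x. \<psi> (G x)) x = \<Theta>' \<psi> G x"
    if "open W" "smooth_on V \<psi>" "smooth_on W G" "G ` W \<subseteq> V" "x \<in> W" for \<psi> G V W x
  proof -
    have "iter_partial is (\<lambda>x. \<psi> (G x)) y = \<Theta> \<psi> G y" if "y \<in> W" for y
      using T(2)[rule_format, OF \<open>open W\<close> \<open>smooth_on V \<psi>\<close> \<open>smooth_on W G\<close> \<open>G ` W \<subseteq> V\<close> that] .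
    then show ?thesis
      using partial_deriv_cong[OF that(1,5), of "iter_partial is (\<lambda>x. \<psi> (G x))" "\<Theta> \<psi> G" i]
        T'(2)[rule_format, OF that(2-5)] by simp
  qed
  then show ?case using T'(1) by (intro exI[of _ \<Theta>'] conjI allI impI) simp_all
qed

text \<open>Every iterated derivative of the composite agrees on \<open>W\<close> with a chain form,
  and chain forms are differentiable.\<close>

lemma smooth_on_compose:
  assumes "open W" "smooth_on V \<psi>" "smooth_on W G" "G ` W \<subseteq> V"
  shows "smooth_on W (\<lambda>x. \<psi> (G x))"
  unfolding smooth_on_def
proof (intro allI ballI)
  fix "is" z assume z: "z \<in> W"
  obtain \<Theta> where T: "chain_form (length is) \<Theta>"
    "\<And>x. x \<in> W \<Longrightarrow> iter_partial is (\<lambda>x. \<psi> (G x)) x = \<Theta> \<psi> G x"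
    using iter_partial_chain_form assms by metis
  have "\<Theta> \<psi> G differentiable (at z)"
    using chain_form_partial[OF T(1)] assms z by metis
  then show "iter_partial is (\<lambda>x. \<psi> (G x)) differentiable (at z)"
    using differentiable_cong_open[OF assms(1) z, of "iter_partial is (\<lambda>x. \<psi> (G x))" "\<Theta> \<psi> G"] T(2) by simp
qed

text \<open>The mean value inequality, with the operator norm of the derivative bounded by the sum
  of its coordinate contributions; hence the factor \<open>CARD('n)\<close>.\<close>

lemma smooth_on_lipschitz:
  fixes h :: "real^'n::finite \<Rightarrow> 'b::real_normed_vector"
  assumes "convex D" "\<And>x. x \<in> D \<Longrightarrow> h differentiable (at x)"
    "\<And>x i. x \<in> D \<Longrightarrow> norm (partial_deriv i h x) \<le> M" "M \<ge> 0" "x \<in> D" "y \<in> D"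
  shows "norm (h x - h y) \<le> real CARD('n) * M * norm (x - y)"
proof (rule differentiable_bound[OF assms(1) _ _ assms(5,6)])
  fix x assume x: "x \<in> D"
  show "(h has_derivative (\<lambda>v. \<Sum>i\<in>UNIV. (v $ i) *\<^sub>R partial_deriv i h x)) (at x within D)"
    using has_derivative_partial[OF assms(2)[OF x]] has_derivative_at_withinI by blast
  have "norm (\<Sum>i\<in>UNIV. (v $ i) *\<^sub>R partial_deriv i h x) \<le> real CARD('n) * M * norm v" for v
  proof -
    have "norm (\<Sum>i\<in>UNIV. (v $ i) *\<^sub>R partial_deriv i h x) \<le> (\<Sum>i\<in>(UNIV::'n set). norm v * M)"
      using component_le_norm_cart assms(3)[OF x] by (intro sum_norm_le) (auto intro!: mult_mono)
    then show ?thesis by (simp add: algebra_simps)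
  qed
  then show "onorm (\<lambda>v. \<Sum>i\<in>UNIV. (v $ i) *\<^sub>R partial_deriv i h x) \<le> real CARD('n) * M"
    by (intro onorm_le) auto
qed

text \<open>For a derivative of \<psi> the mean value inequality on the convex set \<open>D\<close>
  gives the estimate, at the price of one more derivative of \<psi>; hence \<open>Suc k\<close>.
  Products are telescoped, which needs a bound on the form itself next to the bound on its
  variation, so both are carried through the induction.\<close>

lemma chain_form_stable:
  fixes \<Theta> :: "(real^'m::finite \<Rightarrow> 'b::real_normed_vector) \<Rightarrow> (real^'n::finite \<Rightarrow> real^'m) \<Rightarrow> real^'n \<Rightarrow> 'b"
  assumes "chain_form k \<Theta>" "convex D" "\<forall>x\<in>P. jet_le k F x B" "B \<ge> 0"
  shows "\<exists>C\<ge>0. \<forall>\<psi> G x \<delta> M. smooth_on D \<psi> \<longrightarrow> (\<forall>y\<in>D. jet_le (Suc k) \<psi> y M) \<longrightarrow> M \<ge> 0 \<longrightarrow> x \<in> P \<longrightarrow>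
     F x \<in> D \<longrightarrow> G x \<in> D \<longrightarrow> \<delta> \<le> 1 \<longrightarrow>
     (\<forall>js. length js \<le> k \<longrightarrow> norm (iter_partial js G x - iter_partial js F x) \<le> \<delta>) \<longrightarrow>
     norm (\<Theta> \<psi> G x - \<Theta> \<psi> F x) \<le> C * M * \<delta> \<and> norm (\<Theta> \<psi> F x) \<le> C * M"
  using assms(1)
proof (induction rule: chain_form.induct)
  case (base js)
  show ?case
  proof (intro exI[of _ "real CARD('m)"] conjI allI impI)
    fix \<psi> :: "real^'m \<Rightarrow> 'b" and G x \<delta> M
    assume a: "smooth_on D \<psi>" "\<forall>y\<in>D. jet_le (Suc k) \<psi> y M" "M \<ge> 0" "x \<in> P" "F x \<in> D" "G x \<in> D" "\<delta> \<le> 1"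
      and d: "\<forall>js. length js \<le> k \<longrightarrow> norm (iter_partial js G x - iter_partial js F x) \<le> \<delta>"
    have "norm (G x - F x) \<le> \<delta>" using d by (metis iter_partial.simps(1) le0 list.size(3))
    moreover have "norm (iter_partial js \<psi> (G x) - iter_partial js \<psi> (F x)) \<le> real CARD('m) * M * norm (G x - F x)"
    proof (rule smooth_on_lipschitz[OF assms(2) _ _ a(3,6,5)])
      fix y i assume y: "y \<in> D"
      show "iter_partial js \<psi> differentiable (at y)"
        using smooth_on_differentiable[OF smooth_on_iter_partial[OF a(1)] y] .
      show "norm (partial_deriv i (iter_partial js \<psi>) y) \<le> M"
        using jet_leD[OF a(2)[rule_format, OF y], of "i # js"] base by simp
    qed
    ultimately show "norm (iter_partial js \<psi> (G x) - iter_partial js \<psi> (F x)) \<le> real CARD('m) * M * \<delta>"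
      using a(3) by (meson mult_left_mono order_trans mult_nonneg_nonneg of_nat_0_le_iff)
    have "norm (iter_partial js \<psi> (F x)) \<le> M" using a base jet_leD by (metis le_SucI)
    moreover have "M \<le> real CARD('m) * M" using a(3) by (simp add: mult_le_cancel_right1 Suc_leI)
    ultimately show "norm (iter_partial js \<psi> (F x)) \<le> real CARD('m) * M" by linarith
  qed auto
next
  case (mult \<Theta> js j)
  then obtain C where C: "C \<ge> 0" "\<And>\<psi> G x \<delta> M. smooth_on D \<psi> \<Longrightarrow> (\<forall>y\<in>D. jet_le (Suc k) \<psi> y M) \<Longrightarrow> M \<ge> 0 \<Longrightarrow> x \<in> P \<Longrightarrow>
     F x \<in> D \<Longrightarrow> G x \<in> D \<Longrightarrow> \<delta> \<le> 1 \<Longrightarrow>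
     (\<forall>js. length js \<le> k \<longrightarrow> norm (iter_partial js G x - iter_partial js F x) \<le> \<delta>) \<Longrightarrow>
     norm (\<Theta> \<psi> G x - \<Theta> \<psi> F x) \<le> C * M * \<delta> \<and> norm (\<Theta> \<psi> F x) \<le> C * M" by blast
  show ?case
  \<comment> \<open>Since \<delta> \<le> 1, the form at the perturbed map is at most 2 C M; the
    coefficient taken from \<open>F\<close> is at most \<open>B\<close>. Telescoping the product
    therefore costs the factor 2 + B.\<close>
  proof (intro exI[of _ "C * (2 + B)"] conjI allI impI)
    fix \<psi> :: "real^'m \<Rightarrow> 'b" and G x \<delta> M
    assume a: "smooth_on D \<psi>" "\<forall>y\<in>D. jet_le (Suc k) \<psi> y M" "M \<ge> 0" "x \<in> P" "F x \<in> D" "G x \<in> D" "\<delta> \<le> 1"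
      and d: "\<forall>js. length js \<le> k \<longrightarrow> norm (iter_partial js G x - iter_partial js F x) \<le> \<delta>"
    have T: "norm (\<Theta> \<psi> G x - \<Theta> \<psi> F x) \<le> C * M * \<delta>" "norm (\<Theta> \<psi> F x) \<le> C * M" using C(2)[OF a d] by auto
    have d0: "0 \<le> \<delta>" using d by (metis le0 list.size(3) norm_ge_zero order_trans)
    let ?g = "iter_partial js G x $ j" and ?f = "iter_partial js F x $ j"
    have CM: "0 \<le> C * M" using C a by simp
    have f: "\<bar>?f\<bar> \<le> B" using assms(3)[rule_format, OF a(4)] mult(2) component_le_norm_cart order_trans jet_leD
      by (metis (no_types, lifting))
    have gf: "\<bar>?g - ?f\<bar> \<le> \<delta>"
      using component_le_norm_cart[of "iter_partial js G x - iter_partial js F x" j] d mult(2) by force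
    have "norm (\<Theta> \<psi> G x) \<le> norm (\<Theta> \<psi> G x - \<Theta> \<psi> F x) + norm (\<Theta> \<psi> F x)"
      by (metis diff_add_cancel norm_triangle_ineq)
    also have "\<dots> \<le> C * M * 1 + C * M" using T CM a(7) mult_left_mono[OF a(7) CM] by linarith
    finally have G: "norm (\<Theta> \<psi> G x) \<le> 2 * (C * M)" by simp
    have "?g *\<^sub>R \<Theta> \<psi> G x - ?f *\<^sub>R \<Theta> \<psi> F x = (?g - ?f) *\<^sub>R \<Theta> \<psi> G x + ?f *\<^sub>R (\<Theta> \<psi> G x - \<Theta> \<psi> F x)"
      by (simp add: algebra_simps)
    also have "norm \<dots> \<le> \<bar>?g - ?f\<bar> * norm (\<Theta> \<psi> G x) + \<bar>?f\<bar> * norm (\<Theta> \<psi> G x - \<Theta> \<psi> F x)"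
      by (rule norm_triangle_le) simp
    also have "\<dots> \<le> \<delta> * (2 * (C * M)) + B * (C * M * \<delta>)"
      using T(1) f gf G d0 assms(4) by (intro add_mono mult_mono) auto
    finally show "norm (?g *\<^sub>R \<Theta> \<psi> G x - ?f *\<^sub>R \<Theta> \<psi> F x) \<le> C * (2 + B) * M * \<delta>"
      by (simp add: algebra_simps)
    have "\<bar>?f\<bar> * norm (\<Theta> \<psi> F x) \<le> B * (C * M)" using f T(2) assms(4) by (intro mult_mono) auto
    then show "norm (?f *\<^sub>R \<Theta> \<psi> F x) \<le> C * (2 + B) * M" using CM by (simp add: algebra_simps)
  qed (use C(1) assms(4) in auto)
next
  case (add \<Theta>1 \<Theta>2)
  then obtain C1 C2 where C: "C1 \<ge> 0" "C2 \<ge> 0" "\<And>\<psi> G x \<delta> M. smooth_on D \<psi> \<Longrightarrow> (\<forall>y\<in>D. jet_le (Suc k) \<psi> y M) \<Longrightarrow> M \<ge> 0 \<Longrightarrow> x \<in> P \<Longrightarrow>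
     F x \<in> D \<Longrightarrow> G x \<in> D \<Longrightarrow> \<delta> \<le> 1 \<Longrightarrow>
     (\<forall>js. length js \<le> k \<longrightarrow> norm (iter_partial js G x - iter_partial js F x) \<le> \<delta>) \<Longrightarrow>
     norm (\<Theta>1 \<psi> G x - \<Theta>1 \<psi> F x) \<le> C1 * M * \<delta> \<and> norm (\<Theta>1 \<psi> F x) \<le> C1 * M"
    "\<And>\<psi> G x \<delta> M. smooth_on D \<psi> \<Longrightarrow> (\<forall>y\<in>D. jet_le (Suc k) \<psi> y M) \<Longrightarrow> M \<ge> 0 \<Longrightarrow> x \<in> P \<Longrightarrow>
     F x \<in> D \<Longrightarrow> G x \<in> D \<Longrightarrow> \<delta> \<le> 1 \<Longrightarrow>
     (\<forall>js. length js \<le> k \<longrightarrow> norm (iter_partial js G x - iter_partial js F x) \<le> \<delta>) \<Longrightarrow>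
     norm (\<Theta>2 \<psi> G x - \<Theta>2 \<psi> F x) \<le> C2 * M * \<delta> \<and> norm (\<Theta>2 \<psi> F x) \<le> C2 * M" by blast
  show ?case
  proof (intro exI[of _ "C1 + C2"] conjI allI impI)
    fix \<psi> :: "real^'m \<Rightarrow> 'b" and G x \<delta> M
    assume a: "smooth_on D \<psi>" "\<forall>y\<in>D. jet_le (Suc k) \<psi> y M" "M \<ge> 0" "x \<in> P" "F x \<in> D" "G x \<in> D" "\<delta> \<le> 1"
      and d: "\<forall>js. length js \<le> k \<longrightarrow> norm (iter_partial js G x - iter_partial js F x) \<le> \<delta>"
    have "\<Theta>1 \<psi> G x + \<Theta>2 \<psi> G x - (\<Theta>1 \<psi> F x + \<Theta>2 \<psi> F x) = (\<Theta>1 \<psi> G x - \<Theta>1 \<psi> F x) + (\<Theta>2 \<psi> G x - \<Theta>2 \<psi> F x)" by simp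
    then show "norm (\<Theta>1 \<psi> G x + \<Theta>2 \<psi> G x - (\<Theta>1 \<psi> F x + \<Theta>2 \<psi> F x)) \<le> (C1 + C2) * M * \<delta>"
      using C(3)[OF a d] C(4)[OF a d] norm_triangle_mono by (metis (no_types, lifting) distrib_right)
    show "norm (\<Theta>1 \<psi> F x + \<Theta>2 \<psi> F x) \<le> (C1 + C2) * M"
      using C(3)[OF a d] C(4)[OF a d] norm_triangle_mono by (metis (no_types, lifting) distrib_right)
  qed (use C(1,2) in auto)
next
  case zero
  show ?case by (intro exI[of _ 0]) auto
qed

text \<open>Quantitative continuity of composition on the left by \<psi>. The constant precedes
  \<psi> and \<open>G\<close>, so one neighbourhood of \<open>F\<close> will serve all \<psi> with a
  common jet bound.\<close>

lemma compose_stable: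
  fixes F :: "real^'n::finite \<Rightarrow> real^'m::finite"
  assumes D: "convex D" "D \<subseteq> V" and W: "open W" "smooth_on W F" "F ` W \<subseteq> V"
    and P: "P \<subseteq> W" "\<forall>x\<in>P. jet_le k F x B" "B \<ge> 0"
  shows "\<exists>C\<ge>0. \<forall>(\<psi> :: real^'m \<Rightarrow> complex) G W' \<delta> M x.
     smooth_on V \<psi> \<and> (\<forall>y\<in>D. jet_le (Suc k) \<psi> y M) \<and> M \<ge> 0 \<and> open W' \<and> smooth_on W' G \<and> G ` W' \<subseteq> V \<and>
     x \<in> P \<and> x \<in> W' \<and> F x \<in> D \<and> G x \<in> D \<and> \<delta> \<le> 1 \<and>
     (\<forall>js. length js \<le> k \<longrightarrow> norm (iter_partial js G x - iter_partial js F x) \<le> \<delta>) \<longrightarrow>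
     jet_le k (\<lambda>x. \<psi> (G x) - \<psi> (F x)) x (C * M * \<delta>)"
proof -
  define hyp where "hyp \<psi> G W' \<delta> M x \<longleftrightarrow>
     smooth_on V \<psi> \<and> (\<forall>y\<in>D. jet_le (Suc k) \<psi> y M) \<and> M \<ge> 0 \<and> open W' \<and> smooth_on W' G \<and> G ` W' \<subseteq> V \<and>
     x \<in> P \<and> x \<in> W' \<and> F x \<in> D \<and> G x \<in> D \<and> \<delta> \<le> 1 \<and>
     (\<forall>js. length js \<le> k \<longrightarrow> norm (iter_partial js G x - iter_partial js F x) \<le> \<delta>)"
    for \<psi> :: "real^'m \<Rightarrow> complex" and G W' \<delta> M x
  let ?L = "{is :: 'n list. length is \<le> k}"
  have fin: "finite ?L" using finite_lists_length_le[of "UNIV :: 'n set" k] by simp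
  have "\<forall>is\<in>?L. \<exists>C. C \<ge> 0 \<and> (\<forall>\<psi> G W' \<delta> M x. hyp \<psi> G W' \<delta> M x \<longrightarrow>
      norm (iter_partial is (\<lambda>x. \<psi> (G x) - \<psi> (F x)) x) \<le> C * M * \<delta>)"
  proof
    fix "is" assume "is \<in> ?L"
    then have len: "length is \<le> k" by simp
    from iter_partial_chain_form[of "is"] obtain \<Theta> :: "(real^'m \<Rightarrow> complex) \<Rightarrow> (real^'n \<Rightarrow> real^'m) \<Rightarrow> real^'n \<Rightarrow> complex"
      where \<Theta>: "chain_form (length is) \<Theta>"
      "\<forall>\<psi> G V W x. open W \<longrightarrow> smooth_on V \<psi> \<longrightarrow> smooth_on W G \<longrightarrow> G ` W \<subseteq> V \<longrightarrow> x \<in> W \<longrightarrow>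
         iter_partial is (\<lambda>x. \<psi> (G x)) x = \<Theta> \<psi> G x"
      by (elim exE conjE) (rule that)
    from chain_form_stable[OF chain_form_mono[OF \<Theta>(1) len] D(1) P(2,3)]
    obtain C where C: "C \<ge> 0" "\<forall>\<psi> G x \<delta> M. smooth_on D \<psi> \<longrightarrow> (\<forall>y\<in>D. jet_le (Suc k) \<psi> y M) \<longrightarrow> M \<ge> 0 \<longrightarrow> x \<in> P \<longrightarrow>
       F x \<in> D \<longrightarrow> G x \<in> D \<longrightarrow> \<delta> \<le> 1 \<longrightarrow>
       (\<forall>js. length js \<le> k \<longrightarrow> norm (iter_partial js G x - iter_partial js F x) \<le> \<delta>) \<longrightarrow>
       norm (\<Theta> \<psi> G x - \<Theta> \<psi> F x) \<le> C * M * \<delta> \<and> norm (\<Theta> \<psi> F x) \<le> C * M"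
      by (elim exE conjE) (rule that)
    have "norm (iter_partial is (\<lambda>x. \<psi> (G x) - \<psi> (F x)) x) \<le> C * M * \<delta>" if h: "hyp \<psi> G W' \<delta> M x" for \<psi> G W' \<delta> M x
    proof -
      note h' = h[unfolded hyp_def]
      have \<psi>: "smooth_on V \<psi>" and W': "open W'" "smooth_on W' G" "G ` W' \<subseteq> V" and x: "x \<in> P" "x \<in> W'" "x \<in> W"
        using h' P(1) by auto
      have o: "open (W \<inter> W')" using W(1) W'(1) by auto
      have sF: "smooth_on (W \<inter> W') F" "F ` (W \<inter> W') \<subseteq> V" and sG: "smooth_on (W \<inter> W') G" "G ` (W \<inter> W') \<subseteq> V"
        using smooth_on_subset[OF W(2)] smooth_on_subset[OF W'(2)] W(3) W'(3) by auto
      have xW: "x \<in> W \<inter> W'" using x by simp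
      have "iter_partial is (\<lambda>x. \<psi> (G x) - \<psi> (F x)) x = iter_partial is (\<lambda>x. \<psi> (G x)) x - iter_partial is (\<lambda>x. \<psi> (F x)) x"
        by (rule iter_partial_diff[OF o smooth_on_compose[OF o \<psi> sG] smooth_on_compose[OF o \<psi> sF] xW])
      also have "\<dots> = \<Theta> \<psi> G x - \<Theta> \<psi> F x"
        using \<Theta>(2)[rule_format, OF o \<psi> sG xW] \<Theta>(2)[rule_format, OF o \<psi> sF xW] by simp
      finally show ?thesis
        using C(2)[rule_format, OF smooth_on_subset[OF \<psi> D(2)], of M x G \<delta>] h' by auto
    qed
    then show "\<exists>C. C \<ge> 0 \<and> (\<forall>\<psi> G W' \<delta> M x. hyp \<psi> G W' \<delta> M x \<longrightarrow>
      norm (iter_partial is (\<lambda>x. \<psi> (G x) - \<psi> (F x)) x) \<le> C * M * \<delta>)" using C(1) by blast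
  qed
  from bchoice[OF this] obtain C where C: "\<forall>is\<in>?L. C is \<ge> 0 \<and> (\<forall>\<psi> G W' \<delta> M x. hyp \<psi> G W' \<delta> M x \<longrightarrow>
      norm (iter_partial is (\<lambda>x. \<psi> (G x) - \<psi> (F x)) x) \<le> C is * M * \<delta>)" by (elim exE)
  have "jet_le k (\<lambda>x. \<psi> (G x) - \<psi> (F x)) x ((\<Sum>is\<in>?L. C is) * M * \<delta>)" if h: "hyp \<psi> G W' \<delta> M x" for \<psi> G W' \<delta> M x
    unfolding jet_le_def
  proof (intro allI impI)
    fix "is" :: "'n list" assume len: "length is \<le> k"
    have "\<forall>js. length js \<le> k \<longrightarrow> norm (iter_partial js G x - iter_partial js F x) \<le> \<delta>" and M: "M \<ge> 0"
      using h by (auto simp: hyp_def)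
    from this(1)[rule_format, of "[]"] have \<delta>: "0 \<le> \<delta>" by (auto intro: order_trans[OF norm_ge_zero])
    have "C is \<le> (\<Sum>is\<in>?L. C is)" using C len fin by (intro member_le_sum) auto
    then have "C is * M * \<delta> \<le> (\<Sum>is\<in>?L. C is) * M * \<delta>" using M \<delta> by (intro mult_right_mono)
    moreover have "norm (iter_partial is (\<lambda>x. \<psi> (G x) - \<psi> (F x)) x) \<le> C is * M * \<delta>" using C len h by blast
    ultimately show "norm (iter_partial is (\<lambda>x. \<psi> (G x) - \<psi> (F x)) x) \<le> (\<Sum>is\<in>?L. C is) * M * \<delta>" by linarith
  qed
  moreover have "(\<Sum>is\<in>?L. C is) \<ge> 0" using C by (intro sum_nonneg) auto
  ultimately show ?thesis unfolding hyp_def by blast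
qed

section \<open>Uniform boundedness, Green's identity and series\<close>

text \<open>
  The sort is not \<open>banach\<close> because \<open>bcontfun\<close>, to which the lemma will be applied, is not declared
  an instance of that class.
\<close>

lemma uniform_boundedness:
  fixes F :: "('a::{real_normed_vector, complete_space} \<Rightarrow> 'b::real_normed_vector) set"
  assumes lin: "\<And>f. f \<in> F \<Longrightarrow> bounded_linear f" and bdd: "\<And>x. \<exists>C. \<forall>f\<in>F. norm (f x) \<le> C"
  shows "\<exists>C\<ge>0. \<forall>f\<in>F. \<forall>x. norm (f x) \<le> C * norm x"
proof -
  define K where "K n = {x. \<forall>f\<in>F. norm (f x) \<le> real n}" for n :: nat
  have "closed (K n)" for n
  proof -
    have "K n = (\<Inter>f\<in>F. {x. norm (f x) \<le> real n})" by (auto simp: K_def)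
    moreover have "closed {x. norm (f x) \<le> real n}" if "f \<in> F" for f
      by (intro closed_Collect_le continuous_intros bounded_linear.continuous_on[OF lin[OF that]])
    ultimately show ?thesis by auto
  qed
  moreover have "(\<Union>n. K n) = UNIV"
  proof -
    have "\<exists>n. x \<in> K n" for x
    proof -
      obtain C where C: "\<forall>f\<in>F. norm (f x) \<le> C" using bdd by blast
      obtain n where "C \<le> real n" using real_arch_simple by blast
      then have "x \<in> K n" using C by (auto simp: K_def intro: order_trans)
      then show ?thesis by blast
    qed
    then show ?thesis by auto
  qed
  ultimately have "\<exists>n. interior (K n) \<noteq> {}"
    using Baire_category_alt[of "euclidean :: 'a topology" "range K"] completely_metrizable_space_euclidean
    by (fastforce simp: euclidean_interior_of)
  then obtain n a where "a \<in> interior (K n)" by blast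
  then obtain e where e: "e > 0" "ball a e \<subseteq> K n" by (meson interior_subset open_contains_ball open_interior order_trans)
  define C where "C = 4 * real n / e"
  have "norm (f x) \<le> C * norm x" if f: "f \<in> F" for f x
  proof (cases "x = 0")
    case True
    then show ?thesis using lin[OF f] by (simp add: linear_simps)
  next
    case False
    \<comment> \<open>Half the radius keeps the shifted point strictly inside the ball. Two points
      of \<open>K n\<close> give the bound 2n for the norm of t times f(x), and dividing by
      \<open>t\<close> yields the constant \<open>C\<close>.\<close>
    define t where "t = e / (2 * norm x)"
    have t: "t > 0" "t * norm x = e / 2" using e False by (auto simp: t_def)
    have "a + t *\<^sub>R x \<in> K n" "a \<in> K n" using e t by (auto simp: dist_norm intro!: subsetD[OF e(2)])
    then have "norm (f (a + t *\<^sub>R x)) \<le> real n" "norm (f a) \<le> real n" using f by (auto simp: K_def)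
    moreover have "f (a + t *\<^sub>R x) - f a = t *\<^sub>R f x"
      using lin[OF f] by (simp add: linear_simps bounded_linear.linear)
    ultimately have "norm (t *\<^sub>R f x) \<le> 2 * real n"
      using norm_triangle_ineq4[of "f (a + t *\<^sub>R x)" "f a"] by simp
    then have "t * norm (f x) \<le> 2 * real n" using t by simp
    then show ?thesis using t(1) e(1) False by (simp add: t_def C_def field_simps)
  qed
  then show ?thesis using e(1) by (intro exI[of _ C]) (auto simp: C_def)
qed

text \<open>A convergent sequence is bounded at each point, so uniform boundedness gives a common
  constant, which survives the limit. This leads from integral pairings to point values, and from
  there to derivatives.\<close>

lemma bounded_linear_pointwise_limit:
  fixes f :: "nat \<Rightarrow> 'a::{real_normed_vector, complete_space} \<Rightarrow> 'b::real_normed_vector"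
  assumes "\<And>n. bounded_linear (f n)" "\<And>x. (\<lambda>n. f n x) \<longlonglongrightarrow> g x"
  shows "bounded_linear g"
proof -
  have "\<exists>C. \<forall>h\<in>range f. norm (h x) \<le> C" for x
    using convergent_imp_bounded[OF assms(2)[of x]] by (auto simp: bounded_iff)
  then obtain C where C: "\<And>n x. norm (f n x) \<le> C * norm x"
    using uniform_boundedness[of "range f"] assms(1) by blast
  show ?thesis
  proof
    show "g (x + y) = g x + g y" for x y
      using tendsto_add[OF assms(2)[of x] assms(2)[of y]] assms(2)[of "x + y"] assms(1)
      by (simp add: linear_simps LIMSEQ_unique)
    show "g (r *\<^sub>R x) = r *\<^sub>R g x" for r x
      using tendsto_scaleR[OF tendsto_const assms(2)[of x], of r] assms(2)[of "r *\<^sub>R x"] assms(1)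
      by (simp add: linear_simps LIMSEQ_unique)
    have "norm (g x) \<le> norm x * C" for x
      using C by (intro LIMSEQ_le_const2[OF tendsto_norm[OF assms(2)]]) (auto simp: mult.commute)
    then show "\<exists>K. \<forall>x. norm (g x) \<le> norm x * K" by blast
  qed
qed

text \<open>Difference quotients along the fixed steps 1/(n + 1): a sequence is what dominated
  convergence and \<open>bounded_linear_pointwise_limit\<close> take as input.\<close>

lemma partial_deriv_tendsto:
  assumes "f differentiable (at (x::real^'n::finite))"
  shows "(\<lambda>n. real (Suc n) *\<^sub>R (f (x + inverse (real (Suc n)) *\<^sub>R axis i 1) - f x)) \<longlonglongrightarrow> partial_deriv i f x"
proof -
  let ?h = "\<lambda>n. inverse (real (Suc n)) *\<^sub>R axis i (1::real)"
  let ?D = "frechet_derivative f (at x)"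
  have D: "(f has_derivative ?D) (at x)" using assms frechet_derivative_works by blast
  then have lin: "linear ?D" using has_derivative_linear by blast
  have "?h \<longlonglongrightarrow> 0 *\<^sub>R axis i (1::real)" by (intro tendsto_scaleR LIMSEQ_inverse_real_of_nat tendsto_const)
  then have h: "filterlim ?h (at 0) sequentially"
    unfolding filterlim_at by (auto simp: axis_eq_0_iff)
  have "((\<lambda>h. norm (f (x + h) - f x - ?D h) / norm h) \<longlongrightarrow> 0) (at 0)"
    using D by (simp add: has_derivative_at)
  then have "(\<lambda>n. norm (f (x + ?h n) - f x - ?D (?h n)) / norm (?h n)) \<longlonglongrightarrow> 0"
    using filterlim_compose[OF _ h] by blast
  moreover have "norm (f (x + ?h n) - f x - ?D (?h n)) / norm (?h n) =
      norm (real (Suc n) *\<^sub>R (f (x + ?h n) - f x) - partial_deriv i f x)" for n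
  proof -
    have "real (Suc n) *\<^sub>R (f (x + ?h n) - f x) - partial_deriv i f x =
        real (Suc n) *\<^sub>R (f (x + ?h n) - f x - ?D (?h n))"
      using lin by (simp add: linear_cmul partial_deriv_def scaleR_diff_right)
    also have "norm \<dots> = norm (f (x + ?h n) - f x - ?D (?h n)) / norm (?h n)"
      by (simp add: norm_axis_1 divide_inverse)
    finally show ?thesis by simp
  qed
  ultimately have "(\<lambda>n. norm (real (Suc n) *\<^sub>R (f (x + ?h n) - f x) - partial_deriv i f x)) \<longlonglongrightarrow> 0"
    by (simp only:)
  then show ?thesis by (rule LIM_zero_cancel[OF tendsto_norm_zero_cancel])
qed

section \<open>Integration by parts for compactly supported functions\<close>

lemma smooth_on_UNIV_compact_support:
  fixes F :: "real^'n::finite \<Rightarrow> 'b::real_normed_vector"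
  assumes "smooth_on V F" "compact C" "C \<subseteq> V" "\<And>x. x \<notin> C \<Longrightarrow> F x = 0"
  shows "smooth_on UNIV F"
proof (rule smooth_on_subset)
  have "open (- C)" using compact_imp_closed[OF assms(2)] by auto
  then have "smooth_on (- C) F" using smooth_on_cong[of "- C" F "\<lambda>x. 0"] assms(4) by auto
  then show "smooth_on (V \<union> - C) F" using assms(1) by (auto simp: smooth_on_def)
qed (use assms(3) in auto)

lemma integrable_compact_support:
  fixes f :: "real^'n::finite \<Rightarrow> 'b::{banach,second_countable_topology}"
  assumes "compact C" "continuous_on C f" "\<And>x. x \<notin> C \<Longrightarrow> f x = 0"
  shows "integrable lborel f"
proof -
  have "(\<lambda>x. indicator C x *\<^sub>R f x) = f" using assms(3) by (auto simp: indicator_def)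
  then show ?thesis using borel_integrable_compact[OF assms(1,2)] by simp
qed

text \<open>Translation invariance of Lebesgue measure makes every difference quotient integrate to
  0. The quotients are uniformly bounded with a common bounded support, so dominated convergence
  carries this over to the derivative.\<close>

lemma integral_partial_deriv_eq_0:
  fixes F :: "real^'n::finite \<Rightarrow> 'b::{banach,second_countable_topology}"
  assumes F: "smooth_on UNIV F" and C: "compact C" and supp: "\<And>x. x \<notin> C \<Longrightarrow> F x = 0"
  shows "(\<integral>x. partial_deriv i F x \<partial>lborel) = 0"
proof -
  let ?h = "\<lambda>n. inverse (real (Suc n)) *\<^sub>R axis i (1::real)"
  define q where "q n x = real (Suc n) *\<^sub>R (F (x + ?h n) - F x)" for n x
  have contF: "continuous_on A F" for A using smooth_on_continuous[OF F] continuous_on_subset by blast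
  have intF: "integrable lborel F" by (rule integrable_compact_support[OF C contF supp])
  have shift: "integrable lborel (\<lambda>x. F (x + c))" "(\<integral>x. F (x + c) \<partial>lborel) = (\<integral>x. F x \<partial>lborel)" for c
  proof -
    have m: "F \<in> borel_measurable borel" by (rule borel_measurable_continuous_onI[OF contF])
    have "integrable (distr lborel borel ((+) c)) F" using intF by (simp add: lborel_distr_plus)
    then show "integrable lborel (\<lambda>x. F (x + c))"
      using integrable_distr[of "(+) c" lborel borel F] by (simp add: add.commute)
    have "(\<integral>x. F x \<partial>lborel) = (\<integral>x. F x \<partial>distr lborel borel ((+) c))" by (simp add: lborel_distr_plus)
    also have "\<dots> = (\<integral>x. F (x + c) \<partial>lborel)" using m by (subst integral_distr) (auto simp: add.commute)
    finally show "(\<integral>x. F (x + c) \<partial>lborel) = (\<integral>x. F x \<partial>lborel)" by simp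
  qed
  have q0: "(\<integral>x. q n x \<partial>lborel) = 0" for n
    unfolding q_def using shift intF by simp
  have "\<exists>M\<ge>0. \<forall>x j. norm (partial_deriv j F x) \<le> M"
  proof -
    have "\<exists>M\<ge>0. \<forall>x. norm (partial_deriv j F x) \<le> M" for j
    proof -
      have "compact (partial_deriv j F ` C)"
        using smooth_on_continuous[OF smooth_on_partial[OF F]] C compact_continuous_image continuous_on_subset
        by (metis subset_UNIV)
      then obtain M where M: "M > 0" "\<And>x. x \<in> C \<Longrightarrow> norm (partial_deriv j F x) \<le> M"
        using compact_imp_bounded bounded_pos by (metis imageI)
      have "partial_deriv j F x = 0" if "x \<notin> C" for x
        by (rule partial_deriv_eq_0[of "- C"]) (use that supp compact_imp_closed[OF C] in auto)
      then show ?thesis using M by (metis less_eq_real_def norm_zero)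
    qed
    then obtain M where M: "\<And>j. M j \<ge> 0" "\<And>j x. norm (partial_deriv j F x) \<le> M j" by metis
    have "M j \<le> (\<Sum>j\<in>UNIV. M j)" for j using M(1) by (intro member_le_sum) auto
    then show ?thesis using M by (intro exI[of _ "\<Sum>j\<in>UNIV. M j"]) (auto intro: sum_nonneg order_trans[OF M(2)])
  qed
  then obtain M where M: "M \<ge> 0" "\<And>x j. norm (partial_deriv j F x) \<le> M" by blast
  obtain R where R: "\<And>x. x \<in> C \<Longrightarrow> norm x \<le> R" using compact_imp_bounded[OF C] by (auto simp: bounded_iff)
  let ?B = "real CARD('n) * M"
  \<comment> \<open>The shifts have length at most 1, so all quotients vanish outside the ball of
    radius R + 1.\<close>
  have B: "norm (q n x) \<le> indicator (cball 0 (R + 1)) x *\<^sub>R ?B" for n x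
  proof (cases "norm x \<le> R + 1")
    case True
    have "norm (F (x + ?h n) - F x) \<le> ?B * norm (?h n)"
      using smooth_on_lipschitz[of UNIV F M "x + ?h n" x] M smooth_on_differentiable[OF F] by simp
    then have "norm (q n x) \<le> real (Suc n) * (?B * norm (?h n))"
      unfolding q_def norm_scaleR abs_of_nat by (rule mult_left_mono) simp
    also have "\<dots> = ?B" by simp
    finally show ?thesis using True by simp
  next
    case False
    have "norm x \<le> norm (x + ?h n) + norm (?h n)" using norm_triangle_ineq4[of "x + ?h n" "?h n"] by simp
    moreover have "norm (?h n) \<le> 1" by (simp add: norm_axis_1 field_simps)
    ultimately have "x \<notin> C" "x + ?h n \<notin> C" using False R by force+
    then have "q n x = 0" using supp by (simp add: q_def)
    then show ?thesis by (simp add: M(1))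
  qed
  have "(\<lambda>n. \<integral>x. q n x \<partial>lborel) \<longlonglongrightarrow> (\<integral>x. partial_deriv i F x \<partial>lborel)"
  proof (rule integral_dominated_convergence[where w = "\<lambda>x. indicator (cball 0 (R + 1)) x *\<^sub>R ?B"])
    show "partial_deriv i F \<in> borel_measurable lborel"
      using borel_measurable_continuous_onI[OF smooth_on_continuous[OF smooth_on_partial[OF F]]] by simp
    show "q n \<in> borel_measurable lborel" for n
    proof -
      have "continuous_on UNIV (q n)" unfolding q_def
        by (intro continuous_intros contF continuous_on_compose2[OF contF[of UNIV]]) auto
      then show ?thesis using borel_measurable_continuous_onI by (simp add: measurable_lborel1)
    qed
    show "integrable lborel (\<lambda>x. indicator (cball 0 (R + 1)) x *\<^sub>R ?B)"
      by (rule borel_integrable_compact) auto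
    show "AE x in lborel. (\<lambda>n. q n x) \<longlonglongrightarrow> partial_deriv i F x"
      unfolding q_def using partial_deriv_tendsto[OF smooth_on_differentiable[OF F]] by auto
    show "AE x in lborel. norm (q n x) \<le> indicator (cball 0 (R + 1)) x *\<^sub>R ?B" for n using B by auto
  qed
  then show ?thesis using q0 by (simp add: LIMSEQ_const_iff)
qed

text \<open>The divergence of \<open>a\<close> applied to the gradient of \<open>h\<close>. With
  \<open>metric_coeff\<close> for \<open>a\<close> it is the Laplacian times the Riemannian
  density.\<close>

definition div_form :: "('n::finite \<Rightarrow> 'n \<Rightarrow> real^'n \<Rightarrow> real) \<Rightarrow> (real^'n \<Rightarrow> complex) \<Rightarrow> real^'n \<Rightarrow> complex" where
  "div_form a h x = (\<Sum>i\<in>UNIV. partial_deriv i (\<lambda>w. \<Sum>j\<in>UNIV. a i j w *\<^sub>R partial_deriv j h w) x)"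

lemma smooth_on_div_form:
  assumes "open V" "\<And>i j. smooth_on V (a i j)" "smooth_on V h"
  shows "smooth_on V (div_form a h)"
  unfolding div_form_def[abs_def]
  by (intro smooth_on_sum smooth_on_partial smooth_on_scaleR assms)

lemma div_form_eq_0:
  assumes "open W" "x \<in> W" "\<And>y. y \<in> W \<Longrightarrow> h y = 0"
  shows "div_form a h x = 0"
proof -
  have "(\<Sum>j\<in>UNIV. a i j w *\<^sub>R partial_deriv j h w) = 0" if "w \<in> W" for w i
    using partial_deriv_eq_0[OF assms(1) that assms(3)] by simp
  then show ?thesis unfolding div_form_def by (intro sum.neutral ballI) (rule partial_deriv_eq_0[OF assms(1,2)])
qed

text \<open>The field with components \<open>F i\<close> = p_i e - h q_i, where p and q are the
  fluxes of \<open>h\<close> and \<open>e\<close>, has as divergence the difference of the two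
  integrands: the first-order cross terms cancel because \<open>a\<close> is symmetric. Compact
  support of \<open>h\<close> alone makes the field vanish off \<open>C\<close>, so the divergence
  integrates to 0.\<close>

lemma green_identity:
  assumes V: "open V" and C: "compact C" "C \<subseteq> V" and h: "smooth_on V h" "\<And>x. x \<notin> C \<Longrightarrow> h x = 0"
    and e: "smooth_on V e" and a: "\<And>i j. smooth_on V (a i j)" "\<And>i j x. x \<in> V \<Longrightarrow> a i j x = a j i x"
  shows "(\<integral>x. div_form a h x * e x \<partial>lborel) = (\<integral>x. h x * div_form a e x \<partial>lborel)"
proof -
  define p where "p i x = (\<Sum>j\<in>UNIV. a i j x *\<^sub>R partial_deriv j h x)" for i x
  define q where "q i x = (\<Sum>j\<in>UNIV. a i j x *\<^sub>R partial_deriv j e x)" for i x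
  define F where "F i x = p i x * e x - h x * q i x" for i x
  have opC: "open (- C)" using compact_imp_closed[OF C(1)] by auto
  have sp: "smooth_on V (p i)" and sq: "smooth_on V (q i)" for i
    unfolding p_def[abs_def] q_def[abs_def] by (intro smooth_on_sum smooth_on_partial smooth_on_scaleR a V h e)+
  have sF: "smooth_on V (F i)" for i
    unfolding F_def[abs_def] by (intro smooth_on_diff smooth_on_mult sp sq V h e)
  have p0: "p i x = 0" if "x \<notin> C" for i x
    unfolding p_def using partial_deriv_eq_0[OF opC, of x h] h(2) that by simp
  have F0: "F i x = 0" if "x \<notin> C" for i x using p0 h(2) that by (simp add: F_def)
  have dF0: "partial_deriv i (F j) x = 0" if "x \<notin> C" for i j x
    using partial_deriv_eq_0[OF opC, of x "F j"] F0 that by simp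
  have FU: "smooth_on UNIV (F i)" for i by (rule smooth_on_UNIV_compact_support[OF sF C F0])
  have cont: "continuous_on C g" if "smooth_on V g" for g :: "real^'a \<Rightarrow> complex"
    using smooth_on_continuous[OF that] C(2) continuous_on_subset by blast
  have main: "(\<Sum>i\<in>UNIV. partial_deriv i (F i) x) = div_form a h x * e x - h x * div_form a e x" for x
  proof (cases "x \<in> C")
    case True
    then have x: "x \<in> V" using C by blast
    note d = smooth_on_differentiable[OF _ x]
    have "partial_deriv i (F i) x = (partial_deriv i (p i) x * e x - h x * partial_deriv i (q i) x)
        + (p i x * partial_deriv i e x - partial_deriv i h x * q i x)" for i
    proof -
      have 1: "(\<lambda>x. p i x * e x) differentiable (at x)" "(\<lambda>x. h x * q i x) differentiable (at x)"
        by (rule d, intro smooth_on_mult sp sq V h e)+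
      have "partial_deriv i (F i) x = partial_deriv i (\<lambda>x. p i x * e x) x + partial_deriv i (\<lambda>x. - (h x * q i x)) x"
        using partial_deriv_add[OF 1(1), of "\<lambda>x. - (h x * q i x)" i] 1(2) by (simp add: F_def[abs_def])
      also have "partial_deriv i (\<lambda>x. - (h x * q i x)) x = - partial_deriv i (\<lambda>x. h x * q i x) x"
        by (rule partial_deriv_linear[OF bounded_linear_minus[OF bounded_linear_ident] 1(2)])
      finally show ?thesis
        using partial_deriv_bilinear[OF bounded_bilinear_mult d[OF sp] d[OF e], of i i]
          partial_deriv_bilinear[OF bounded_bilinear_mult d[OF h(1)] d[OF sq], of i i]
        by (simp add: algebra_simps)
    qed
    then have "(\<Sum>i\<in>UNIV. partial_deriv i (F i) x) = div_form a h x * e x - h x * div_form a e x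
        + ((\<Sum>i\<in>UNIV. p i x * partial_deriv i e x) - (\<Sum>i\<in>UNIV. partial_deriv i h x * q i x))"
      by (simp add: sum.distrib sum_subtractf div_form_def p_def[abs_def] q_def[abs_def] sum_distrib_left sum_distrib_right)
    moreover have "(\<Sum>i\<in>UNIV. p i x * partial_deriv i e x) = (\<Sum>i\<in>UNIV. partial_deriv i h x * q i x)"
    proof -
      have "(\<Sum>i\<in>UNIV. p i x * partial_deriv i e x) = (\<Sum>i\<in>UNIV. \<Sum>j\<in>UNIV. a i j x *\<^sub>R (partial_deriv j h x * partial_deriv i e x))"
        by (simp add: p_def sum_distrib_right)
      also have "\<dots> = (\<Sum>j\<in>UNIV. \<Sum>i\<in>UNIV. a j i x *\<^sub>R (partial_deriv j h x * partial_deriv i e x))"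
        by (subst sum.swap) (use a(2)[OF x] in simp)
      also have "\<dots> = (\<Sum>i\<in>UNIV. partial_deriv i h x * q i x)"
        by (simp add: q_def sum_distrib_left)
      finally show ?thesis .
    qed
    ultimately show ?thesis by simp
  next
    case False
    then have "div_form a h x = 0" using div_form_eq_0[OF opC, of x h a] h(2) by simp
    then show ?thesis using False dF0 h(2) by simp
  qed
  have "0 = (\<Sum>i\<in>UNIV. \<integral>x. partial_deriv i (F i) x \<partial>lborel)"
    using integral_partial_deriv_eq_0[OF FU C(1) F0] by simp
  also have "\<dots> = (\<integral>x. (\<Sum>i\<in>UNIV. partial_deriv i (F i) x) \<partial>lborel)"
  proof (rule Bochner_Integration.integral_sum[symmetric])
    show "integrable lborel (partial_deriv i (F i))" for i
      by (rule integrable_compact_support[OF C(1) cont[OF smooth_on_partial[OF sF]] dF0])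
  qed
  also have "\<dots> = (\<integral>x. div_form a h x * e x \<partial>lborel) - (\<integral>x. h x * div_form a e x \<partial>lborel)"
    unfolding main
  proof (rule Bochner_Integration.integral_diff)
    show "integrable lborel (\<lambda>x. div_form a h x * e x)"
      using div_form_eq_0[OF opC _, of _ h a] h(2)
      by (intro integrable_compact_support[OF C(1)] cont smooth_on_mult smooth_on_div_form V a h e) auto
    show "integrable lborel (\<lambda>x. h x * div_form a e x)"
      using h(2) by (intro integrable_compact_support[OF C(1)] cont smooth_on_mult smooth_on_div_form V a h e) auto
  qed
  finally show ?thesis by simp
qed

section \<open>Termwise differentiation of series\<close>

lemma partial_deriv_suminf:
  fixes g :: "nat \<Rightarrow> real^'n::finite \<Rightarrow> 'b::banach"
  assumes W: "open W" "convex W" "x \<in> W"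
    and d: "\<And>n x. x \<in> W \<Longrightarrow> g n differentiable (at x)"
    and g: "\<And>n x. x \<in> W \<Longrightarrow> norm (g n x) \<le> M n" "summable M"
    and g': "\<And>n x i. x \<in> W \<Longrightarrow> norm (partial_deriv i (g n) x) \<le> N n" "summable N"
  shows "(\<lambda>x. \<Sum>n. g n x) differentiable (at x)"
    "partial_deriv i (\<lambda>x. \<Sum>n. g n x) x = (\<Sum>n. partial_deriv i (g n) x)"
proof -
  define D where "D x v = (\<Sum>i\<in>UNIV. (v $ i) *\<^sub>R (\<Sum>n. partial_deriv i (g n) x))" for x v
  have sg': "summable (\<lambda>n. partial_deriv i (g n) x)" if "x \<in> W" for x i
    by (rule summable_comparison_test'[OF g'(2)]) (rule g'(1)[OF that])
  have sg: "summable (\<lambda>n. g n x)" if "x \<in> W" for x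
    by (rule summable_comparison_test'[OF g(2)]) (rule g(1)[OF that])
  have "\<exists>G. \<forall>x\<in>W. (\<lambda>n. g n x) sums (G x) \<and> (G has_derivative D x) (at x within W)"
  proof (rule has_derivative_series[where f = g and g' = D and x = x and l = "\<Sum>n. g n x"
        and f' = "\<lambda>n x v. \<Sum>i\<in>UNIV. (v $ i) *\<^sub>R partial_deriv i (g n) x"])
    show "convex W" "x \<in> W" "(\<lambda>n. g n x) sums (\<Sum>n. g n x)" using W summable_sums[OF sg[OF W(3)]] by auto
    show "(g n has_derivative (\<lambda>v. \<Sum>i\<in>UNIV. (v $ i) *\<^sub>R partial_deriv i (g n) x)) (at x within W)" if "x \<in> W" for n x
      using has_derivative_at_withinI[OF has_derivative_partial[OF d[OF that]]] .
    fix e :: real assume e: "e > 0"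
    \<comment> \<open>The derivative is a sum of \<open>CARD('n)\<close> coordinate contributions,
      and each of them receives an equal share of the error.\<close>
    define e' where "e' = e / real CARD('n)"
    have e': "e' > 0" using e by (simp add: e'_def)
    obtain n0 where n0: "\<And>n. n \<ge> n0 \<Longrightarrow> norm (\<Sum>k. N (k + n)) < e'"
      using suminf_exist_split[OF e' g'(2)] by blast
    show "\<forall>\<^sub>F n in sequentially. \<forall>x\<in>W. \<forall>h. norm ((\<Sum>k<n. \<Sum>i\<in>UNIV. (h $ i) *\<^sub>R partial_deriv i (g k) x) - D x h) \<le> e * norm h"
      unfolding eventually_sequentially
    proof (intro exI[of _ n0] allI impI ballI)
      fix n x h assume n: "n0 \<le> n" and x: "x \<in> W"
      have tail: "norm ((\<Sum>k<n. partial_deriv i (g k) x) - (\<Sum>k. partial_deriv i (g k) x)) \<le> e'" for i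
      proof -
        have s: "summable (\<lambda>k. N (k + n))" using g'(2) by (simp add: summable_iff_shift)
        have "(\<Sum>k. partial_deriv i (g k) x) - (\<Sum>k<n. partial_deriv i (g k) x) = (\<Sum>k. partial_deriv i (g (k + n)) x)"
          using suminf_minus_initial_segment[OF sg'[OF x], of i n] by simp
        then have "norm ((\<Sum>k<n. partial_deriv i (g k) x) - (\<Sum>k. partial_deriv i (g k) x)) = norm (\<Sum>k. partial_deriv i (g (k + n)) x)"
          by (metis norm_minus_commute)
        also have "\<dots> \<le> (\<Sum>k. N (k + n))"
          by (rule norm_suminf_le[OF _ s]) (use g'(1)[OF x] in auto)
        also have "\<dots> \<le> e'" using n0[OF n] by simp
        finally show ?thesis .
      qed
      have "(\<Sum>k<n. \<Sum>i\<in>UNIV. (h $ i) *\<^sub>R partial_deriv i (g k) x) - D x h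
          = (\<Sum>i\<in>UNIV. (h $ i) *\<^sub>R ((\<Sum>k<n. partial_deriv i (g k) x) - (\<Sum>k. partial_deriv i (g k) x)))"
        unfolding D_def by (subst sum.swap) (simp add: scaleR_diff_right sum_subtractf scaleR_sum_right)
      also have "norm \<dots> \<le> (\<Sum>i\<in>(UNIV::'n set). norm h * e')"
        using tail component_le_norm_cart[of h] by (intro sum_norm_le) (auto intro!: mult_mono)
      also have "\<dots> = e * norm h" by (simp add: e'_def)
      finally show "norm ((\<Sum>k<n. \<Sum>i\<in>UNIV. (h $ i) *\<^sub>R partial_deriv i (g k) x) - D x h) \<le> e * norm h" .
    qed
  qed
  then obtain G where G: "\<And>x. x \<in> W \<Longrightarrow> (\<lambda>n. g n x) sums (G x)" "\<And>x. x \<in> W \<Longrightarrow> (G has_derivative D x) (at x within W)"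
    by blast
  have "(G has_derivative D x) (at x)" using G(2)[OF W(3)] at_within_open[OF W(3,1)] by simp
  then have "((\<lambda>x. \<Sum>n. g n x) has_derivative D x) (at x)"
    by (rule has_derivative_transform_within_open[OF _ W(1,3)]) (use G(1) sums_unique in blast)
  moreover have "D x (axis i 1) = (\<Sum>j\<in>UNIV. if j = i then \<Sum>n. partial_deriv j (g n) x else 0)"
    unfolding D_def by (rule sum.cong) (auto simp: axis_def)
  ultimately show "(\<lambda>x. \<Sum>n. g n x) differentiable (at x)"
    "partial_deriv i (\<lambda>x. \<Sum>n. g n x) x = (\<Sum>n. partial_deriv i (g n) x)"
    using partial_deriv_eqI[of "\<lambda>x. \<Sum>n. g n x" "D x" x i] by (auto simp: differentiable_def)
qed

text \<open>The termwise rule is iterated: the majorant for jets of order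
  \<open>Suc (length is)\<close> justifies differentiating the series of derivatives of order
  \<open>length is\<close>.\<close>

lemma smooth_on_suminf:
  fixes g :: "nat \<Rightarrow> real^'n::finite \<Rightarrow> 'b::banach"
  assumes W: "open W" "convex W" and g: "\<And>n. smooth_on W (g n)"
    and M: "\<And>k n x. x \<in> W \<Longrightarrow> jet_le k (g n) x (M k n)" "\<And>k. summable (M k)"
  shows "smooth_on W (\<lambda>x. \<Sum>n. g n x)"
proof -
  have b: "norm (iter_partial is (g n) x) \<le> M (length is) n"
    and b': "norm (partial_deriv i (iter_partial is (g n)) x) \<le> M (Suc (length is)) n" if "x \<in> W" for n x i "is"
    using jet_leD[OF M(1)[OF that], of "is"] jet_leD[OF M(1)[OF that], of "i # is"] by auto
  have ps: "(\<lambda>x. \<Sum>n. iter_partial is (g n) x) differentiable (at x)"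
    "partial_deriv i (\<lambda>x. \<Sum>n. iter_partial is (g n) x) x = (\<Sum>n. partial_deriv i (iter_partial is (g n)) x)"
    if "x \<in> W" for "is" x i
    by (rule partial_deriv_suminf[OF W that, where M = "M (length is)" and N = "M (Suc (length is))"],
        use smooth_on_differentiable[OF smooth_on_iter_partial[OF g]] b b' M(2) in auto)+
  have eq: "iter_partial is (\<lambda>x. \<Sum>n. g n x) x = (\<Sum>n. iter_partial is (g n) x)" if "x \<in> W" for "is" x
    using that
  proof (induction "is" arbitrary: x)
    case (Cons i "is")
    have "iter_partial (i # is) (\<lambda>x. \<Sum>n. g n x) x = partial_deriv i (\<lambda>x. \<Sum>n. iter_partial is (g n) x) x"
      using partial_deriv_cong[OF W(1) Cons.prems, of "iter_partial is (\<lambda>x. \<Sum>n. g n x)"] Cons.IH by simp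
    then show ?case using ps(2)[OF Cons.prems] by simp
  qed simp
  show ?thesis unfolding smooth_on_def
  proof (intro allI ballI)
    fix "is" z assume z: "z \<in> W"
    show "iter_partial is (\<lambda>x. \<Sum>n. g n x) differentiable (at z)"
      using differentiable_cong_open[OF W(1) z eq] ps(1)[OF z] by simp
  qed
qed

section \<open>Closed manifolds\<close>

abbreviation chart_img :: "('m, 'n::finite) chart \<Rightarrow> (real^'n) set" where
  "chart_img c \<equiv> chart_map c ` chart_dom c"

definition chart_bump :: "('m, 'n::finite) chart \<Rightarrow> real^'n \<Rightarrow> real \<Rightarrow> 'm \<Rightarrow> complex" where
  "chart_bump c z r p = (if p \<in> chart_dom c then of_real (ball_bump z r (chart_map c p)) else 0)"

text \<open>The open balls cover the manifold while their closures still lie in the chart images: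
  compactness of the closed balls gives uniform bounds and closed supports.\<close>

definition ball_cover :: "('m, 'n::finite) chart set \<Rightarrow> (('m, 'n) chart \<times> (real^'n) \<times> real) set \<Rightarrow> bool" where
  "ball_cover A F \<longleftrightarrow> finite F \<and> (\<forall>(c, z, r)\<in>F. c \<in> A \<and> r > 0 \<and> cball z r \<subseteq> chart_img c) \<and>
     (\<forall>p. \<exists>(c, z, r)\<in>F. p \<in> chart_dom c \<and> chart_map c p \<in> ball z r)"

locale closed_manifold =
  fixes A :: "('m::{t2_space, second_countable_topology}, 'n::finite) chart set"
  assumes closed_oriented_manifold: "closed_oriented_manifold A"
begin

lemma compact_UNIV: "compact (UNIV :: 'm set)"
  using closed_oriented_manifold by (simp add: closed_oriented_manifold_def)

lemma chart_at: "\<exists>c\<in>A. p \<in> chart_dom c"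
  using closed_oriented_manifold unfolding closed_oriented_manifold_def oriented_atlas_def by blast

lemma open_chart_dom: "c \<in> A \<Longrightarrow> open (chart_dom c)"
  and open_chart_img: "c \<in> A \<Longrightarrow> open (chart_img c)"
  and chart_homeomorphism: "c \<in> A \<Longrightarrow> homeomorphism (chart_dom c) (chart_img c) (chart_map c) (chart_inv c)"
  and smooth_on_transition: "c \<in> A \<Longrightarrow> d \<in> A \<Longrightarrow> smooth_on (chart_map c ` (chart_dom c \<inter> chart_dom d)) (transition c d)"
  using closed_oriented_manifold unfolding closed_oriented_manifold_def oriented_atlas_def by blast+

lemma chart_inv_map: "c \<in> A \<Longrightarrow> p \<in> chart_dom c \<Longrightarrow> chart_inv c (chart_map c p) = p"
  and chart_map_inv: "c \<in> A \<Longrightarrow> x \<in> chart_img c \<Longrightarrow> chart_map c (chart_inv c x) = x"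
  and chart_inv_dom: "c \<in> A \<Longrightarrow> x \<in> chart_img c \<Longrightarrow> chart_inv c x \<in> chart_dom c"
  using chart_homeomorphism[of c] unfolding homeomorphism_def by auto

lemma continuous_chart_map: "c \<in> A \<Longrightarrow> continuous_on (chart_dom c) (chart_map c)"
  and continuous_chart_inv: "c \<in> A \<Longrightarrow> continuous_on (chart_img c) (chart_inv c)"
  using chart_homeomorphism[of c] unfolding homeomorphism_def by auto

lemma open_map_vimage: "c \<in> A \<Longrightarrow> open W \<Longrightarrow> open (chart_dom c \<inter> chart_map c -` W)"
  using continuous_open_preimage[OF continuous_chart_map open_chart_dom] by blast

lemma open_inv_vimage: "c \<in> A \<Longrightarrow> open X \<Longrightarrow> open (chart_img c \<inter> chart_inv c -` X)"
  using continuous_open_preimage[OF continuous_chart_inv open_chart_img] by blast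

lemma chart_map_image: "c \<in> A \<Longrightarrow> chart_map c ` (chart_dom c \<inter> X) = chart_img c \<inter> chart_inv c -` X"
proof (intro equalityI subsetI)
  fix x assume "c \<in> A" "x \<in> chart_img c \<inter> chart_inv c -` X"
  then show "x \<in> chart_map c ` (chart_dom c \<inter> X)"
    using chart_map_inv chart_inv_dom by (intro image_eqI[of _ _ "chart_inv c x"]) auto
qed (auto simp: chart_inv_map)

lemma compact_chart_inv: "c \<in> A \<Longrightarrow> compact K \<Longrightarrow> K \<subseteq> chart_img c \<Longrightarrow> compact (chart_inv c ` K)"
  using compact_continuous_image continuous_on_subset[OF continuous_chart_inv] by blast

lemma smooth_functionsD: "f \<in> smooth_functions A \<Longrightarrow> c \<in> A \<Longrightarrow> smooth_on (chart_img c) (f \<circ> chart_inv c)"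
  by (simp add: smooth_functions_def)

lemma continuous_smooth_function:
  assumes "f \<in> smooth_functions A"
  shows "continuous_on UNIV f"
proof -
  have "continuous_on (\<Union>c\<in>A. chart_dom c) f"
  proof (rule continuous_on_open_UN)
    fix c assume c: "c \<in> A"
    show "open (chart_dom c)" by (rule open_chart_dom[OF c])
    have "continuous_on (chart_dom c) (\<lambda>p. (f \<circ> chart_inv c) (chart_map c p))"
      using smooth_on_continuous[OF smooth_functionsD[OF assms c]] continuous_chart_map[OF c]
      by (rule continuous_on_compose2) auto
    then show "continuous_on (chart_dom c) f"
      by (rule continuous_on_eq) (simp add: chart_inv_map[OF c])
  qed
  moreover have "(\<Union>c\<in>A. chart_dom c) = UNIV" using chart_at by blast
  ultimately show ?thesis by simp
qed

text \<open>Near each point a single chart suffices, since the smooth transition maps carry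
  smoothness to all other charts.\<close>

lemma smooth_functionsI:
  assumes "\<And>p. \<exists>c\<in>A. p \<in> chart_dom c \<and> (\<exists>W. open W \<and> chart_map c p \<in> W \<and> smooth_on W (f \<circ> chart_inv c))"
  shows "f \<in> smooth_functions A"
  unfolding smooth_functions_def
proof (intro CollectI ballI smooth_on_locally)
  fix d x assume d: "d \<in> A" and x: "x \<in> chart_img d"
  obtain c W where c: "c \<in> A" "chart_inv d x \<in> chart_dom c" and W: "open W" "chart_map c (chart_inv d x) \<in> W"
    "smooth_on W (f \<circ> chart_inv c)" using assms by blast
  define W' where "W' = chart_img d \<inter> chart_inv d -` (chart_dom c \<inter> chart_map c -` W)"
  have W': "open W'" "x \<in> W'"
    using open_inv_vimage[OF d open_map_vimage[OF c(1) W(1)]] x c W by (auto simp: W'_def)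
  have sub: "W' \<subseteq> chart_map d ` (chart_dom d \<inter> chart_dom c)"
    unfolding chart_map_image[OF d] by (auto simp: W'_def)
  have "smooth_on W' (\<lambda>y. (f \<circ> chart_inv c) (transition d c y))"
    by (rule smooth_on_compose[OF W'(1) W(3) smooth_on_subset[OF smooth_on_transition[OF d c(1)] sub]])
      (auto simp: W'_def transition_def)
  moreover have "(f \<circ> chart_inv d) y = (f \<circ> chart_inv c) (transition d c y)" if "y \<in> W'" for y
    using that by (simp add: W'_def transition_def chart_inv_map[OF c(1)])
  ultimately show "\<exists>W g. open W \<and> x \<in> W \<and> smooth_on W g \<and> (\<forall>y\<in>W. (f \<circ> chart_inv d) y = g y)"
    using W' by blast
qed

lemma smooth_on_local_rep:
  "g \<in> smooth_maps A \<Longrightarrow> c \<in> A \<Longrightarrow> d \<in> A \<Longrightarrow>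
    smooth_on (chart_img c \<inter> chart_inv c -` (g -` chart_dom d)) (local_rep c d g)"
  unfolding smooth_maps_def using chart_map_image[of c "g -` chart_dom d"] by (metis (mono_tags, lifting) mem_Collect_eq)

lemma open_local_rep_domain:
  assumes "g \<in> smooth_maps A" "c \<in> A" "d \<in> A"
  shows "open (chart_img c \<inter> chart_inv c -` (g -` chart_dom d))"
proof -
  have "continuous_on UNIV g" using assms(1) by (simp add: smooth_maps_def)
  then have "open (g -` chart_dom d)" using open_chart_dom[OF assms(3)] by (rule open_vimage[rotated])
  then show ?thesis by (rule open_inv_vimage[OF assms(2)])
qed

lemma local_rep_eq:
  "d \<in> A \<Longrightarrow> y \<in> chart_img c \<inter> chart_inv c -` (g -` chart_dom d) \<Longrightarrow>
    ((f \<circ> g) \<circ> chart_inv c) y = (f \<circ> chart_inv d) (local_rep c d g y)"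
  "d \<in> A \<Longrightarrow> y \<in> chart_img c \<inter> chart_inv c -` (g -` chart_dom d) \<Longrightarrow> local_rep c d g y \<in> chart_img d"
  by (auto simp: local_rep_def chart_inv_map)

lemma smooth_functions_compose:
  assumes f: "f \<in> smooth_functions A" and g: "g \<in> smooth_maps A"
  shows "f \<circ> g \<in> smooth_functions A"
proof (rule smooth_functionsI)
  fix p
  obtain c d where c: "c \<in> A" "p \<in> chart_dom c" and d: "d \<in> A" "g p \<in> chart_dom d" using chart_at by metis
  let ?W = "chart_img c \<inter> chart_inv c -` (g -` chart_dom d)"
  have W: "open ?W" by (rule open_local_rep_domain[OF g c(1) d(1)])
  have "smooth_on ?W (\<lambda>y. (f \<circ> chart_inv d) (local_rep c d g y))"
    by (rule smooth_on_compose[OF W smooth_functionsD[OF f d(1)] smooth_on_local_rep[OF g c(1) d(1)]])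
      (use local_rep_eq(2)[OF d(1)] in blast)
  then have "smooth_on ?W ((f \<circ> g) \<circ> chart_inv c)"
    using smooth_on_cong[OF W, of "(f \<circ> g) \<circ> chart_inv c" "\<lambda>y. (f \<circ> chart_inv d) (local_rep c d g y)"]
      local_rep_eq(1)[OF d(1)] by blast
  moreover have "chart_map c p \<in> ?W" using c d by (auto simp: chart_inv_map)
  ultimately show "\<exists>c\<in>A. p \<in> chart_dom c \<and> (\<exists>W. open W \<and> chart_map c p \<in> W \<and> smooth_on W ((f \<circ> g) \<circ> chart_inv c))"
    using W c by blast
qed

lemma smooth_functions_const: "(\<lambda>p. a) \<in> smooth_functions A"
  by (simp add: smooth_functions_def comp_def)

lemma smooth_functions_add:
  "f \<in> smooth_functions A \<Longrightarrow> g \<in> smooth_functions A \<Longrightarrow> (\<lambda>p. f p + g p) \<in> smooth_functions A"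
  and smooth_functions_diff:
  "f \<in> smooth_functions A \<Longrightarrow> g \<in> smooth_functions A \<Longrightarrow> (\<lambda>p. f p - g p) \<in> smooth_functions A"
  and smooth_functions_mult:
  "f \<in> smooth_functions A \<Longrightarrow> g \<in> smooth_functions A \<Longrightarrow> (\<lambda>p. f p * g p) \<in> smooth_functions A"
  and smooth_functions_cnj: "f \<in> smooth_functions A \<Longrightarrow> (\<lambda>p. cnj (f p)) \<in> smooth_functions A"
  and smooth_functions_inverse:
  "f \<in> smooth_functions A \<Longrightarrow> (\<And>p. f p \<noteq> 0) \<Longrightarrow> (\<lambda>p. inverse (f p)) \<in> smooth_functions A"
  using open_chart_img
  by (auto simp: smooth_functions_def comp_def intro!: smooth_on_add smooth_on_diff smooth_on_mult smooth_on_cnj smooth_on_inverse)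

lemma smooth_functions_cmult: "f \<in> smooth_functions A \<Longrightarrow> (\<lambda>p. a * f p) \<in> smooth_functions A"
  by (intro smooth_functions_mult smooth_functions_const)

lemma smooth_functions_sum:
  "(\<And>i. i \<in> I \<Longrightarrow> f i \<in> smooth_functions A) \<Longrightarrow> (\<lambda>p. \<Sum>i\<in>I. f i p) \<in> smooth_functions A"
  by (induction I rule: infinite_finite_induct) (auto intro: smooth_functions_const smooth_functions_add)

text \<open>The extension by zero is smooth because the closed coordinate ball corresponds to a
  compact, hence closed, subset of the manifold: a point outside the chart has a neighbourhood on
  which the function vanishes.\<close>

lemma smooth_chart_bump:
  assumes c: "c \<in> A" and r: "r > 0" "cball z r \<subseteq> chart_img c"
  shows "chart_bump c z r \<in> smooth_functions A"
proof (rule smooth_functionsI)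
  fix p
  show "\<exists>d\<in>A. p \<in> chart_dom d \<and> (\<exists>W. open W \<and> chart_map d p \<in> W \<and> smooth_on W (chart_bump c z r \<circ> chart_inv d))"
  proof (cases "p \<in> chart_dom c")
    case True
    have "smooth_on (chart_img c) (\<lambda>x. complex_of_real (ball_bump z r x))"
      using smooth_on_of_real[OF open_chart_img[OF c] smooth_on_subset[OF smooth_on_ball_bump]] by blast
    then have "smooth_on (chart_img c) (chart_bump c z r \<circ> chart_inv c)"
      using smooth_on_cong[OF open_chart_img[OF c], of "chart_bump c z r \<circ> chart_inv c" "\<lambda>x. complex_of_real (ball_bump z r x)"]
        chart_inv_dom[OF c] chart_map_inv[OF c] by (simp add: chart_bump_def)
    then show ?thesis using c True open_chart_img[OF c] by blast
  next
    case False
    obtain d where d: "d \<in> A" "p \<in> chart_dom d" using chart_at by blast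
    let ?K = "chart_inv c ` cball z r"
    let ?W = "chart_img d \<inter> chart_inv d -` (- ?K)"
    have "closed ?K" using compact_imp_closed[OF compact_chart_inv[OF c compact_cball r(2)]] .
    then have W: "open ?W" using open_inv_vimage[OF d(1)] by blast
    have "p \<notin> ?K" using False chart_inv_dom[OF c] r(2) by blast
    then have p: "chart_map d p \<in> ?W" using d by (auto simp: chart_inv_map)
    have "(chart_bump c z r \<circ> chart_inv d) y = 0" if "y \<in> ?W" for y
    proof -
      have "chart_map c (chart_inv d y) \<notin> ball z r" if "chart_inv d y \<in> chart_dom c"
        using \<open>y \<in> ?W\<close> chart_inv_map[OF c that] by (metis ComplD IntD2 ball_subset_cball imageI subsetD vimageD)
      then show ?thesis using ball_bump_eq_0[OF r(1)] by (auto simp: chart_bump_def)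
    qed
    then have "smooth_on ?W (chart_bump c z r \<circ> chart_inv d)"
      using smooth_on_cong[OF W, of "chart_bump c z r \<circ> chart_inv d" "\<lambda>x. 0"] by auto
    then show ?thesis using d p W by blast
  qed
qed

lemma ex_chart_ball:
  assumes "open X" "p \<in> X" "c \<in> A" "p \<in> chart_dom c"
  shows "\<exists>r>0. cball (chart_map c p) r \<subseteq> chart_img c \<inter> chart_inv c -` X"
proof -
  have "chart_map c p \<in> chart_img c \<inter> chart_inv c -` X" using assms by (auto simp: chart_inv_map)
  then show ?thesis using open_inv_vimage[OF assms(3,1)] open_contains_cball by blast
qed

lemma ex_ball_cover: "\<exists>F. ball_cover A F"
proof -
  have "\<exists>c r. c \<in> A \<and> p \<in> chart_dom c \<and> r > 0 \<and> cball (chart_map c p) r \<subseteq> chart_img c" for p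
    using chart_at[of p] ex_chart_ball[OF open_UNIV UNIV_I] by (metis Int_subset_iff)
  then obtain c r where cr: "\<And>p. c p \<in> A" "\<And>p. p \<in> chart_dom (c p)" "\<And>p. r p > 0"
    "\<And>p. cball (chart_map (c p) p) (r p) \<subseteq> chart_img (c p)" by metis
  let ?U = "\<lambda>p. chart_dom (c p) \<inter> chart_map (c p) -` ball (chart_map (c p) p) (r p)"
  obtain T where T: "finite T" "UNIV \<subseteq> (\<Union>p\<in>T. ?U p)"
  proof (rule compactE_image[OF compact_UNIV, of UNIV ?U])
    show "open (?U p)" for p by (rule open_map_vimage[OF cr(1) open_ball])
    show "UNIV \<subseteq> (\<Union>p. ?U p)" using cr by auto
  qed auto
  show ?thesis
  proof (intro exI[of _ "(\<lambda>p. (c p, chart_map (c p) p, r p)) ` T"], unfold ball_cover_def, intro conjI allI)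
    show "finite ((\<lambda>p. (c p, chart_map (c p) p, r p)) ` T)" using T by simp
    show "\<forall>(c, z, r)\<in>(\<lambda>p. (c p, chart_map (c p) p, r p)) ` T. c \<in> A \<and> 0 < r \<and> cball z r \<subseteq> chart_img c"
      using cr by auto
    fix q
    obtain p where "p \<in> T" "q \<in> ?U p" using T(2) by blast
    then show "\<exists>(c, z, r)\<in>(\<lambda>p. (c p, chart_map (c p) p, r p)) ` T. q \<in> chart_dom c \<and> chart_map c q \<in> ball z r"
      by auto
  qed
qed

text \<open>The bumps of the cover are divided by their sum, which vanishes nowhere: all bumps are
  nonnegative, and each point lies in some open ball of the cover.\<close>

lemma ex_partition:
  assumes "ball_cover A F"
  shows "\<exists>\<rho>. (\<forall>l\<in>F. \<rho> l \<in> smooth_functions A) \<and> (\<forall>p. (\<Sum>l\<in>F. \<rho> l p) = 1) \<and>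
    (\<forall>c z r p. (c, z, r) \<in> F \<longrightarrow> \<not> (p \<in> chart_dom c \<and> chart_map c p \<in> cball z r) \<longrightarrow> \<rho> (c, z, r) p = 0)"
proof -
  note F = assms[unfolded ball_cover_def]
  define b :: "('m, 'n) chart \<times> (real^'n) \<times> real \<Rightarrow> 'm \<Rightarrow> complex"
    where "b = (\<lambda>(c, z, r). chart_bump c z r)"
  define B where "B p = (\<Sum>l\<in>F. b l p)" for p
  have b: "b l \<in> smooth_functions A" if "l \<in> F" for l
    using F that smooth_chart_bump by (auto simp: b_def)
  have B: "B \<in> smooth_functions A" unfolding B_def[abs_def] by (rule smooth_functions_sum[OF b])
  have "B p \<noteq> 0" for p
  proof -
    \<comment> \<open>The positivity argument is carried out on the real values behind the
      complex-valued bumps.\<close>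
    define b' :: "('m, 'n) chart \<times> (real^'n) \<times> real \<Rightarrow> real"
      where "b' = (\<lambda>(c, z, r). if p \<in> chart_dom c then ball_bump z r (chart_map c p) else 0)"
    have bb: "b l p = of_real (b' l)" for l
      by (cases l) (auto simp: b_def b'_def chart_bump_def)
    have nn: "b' l \<ge> 0" for l by (cases l) (auto simp: b'_def ball_bump_nonneg)
    have "\<exists>(c, z, r)\<in>F. p \<in> chart_dom c \<and> chart_map c p \<in> ball z r" using F by blast
    then obtain c z r where crz: "(c, z, r) \<in> F" "p \<in> chart_dom c" "chart_map c p \<in> ball z r" by auto
    then have "r > 0" using F by auto
    then have "b' (c, z, r) > 0" using crz by (simp add: b'_def ball_bump_pos_iff del: mem_ball)
    then obtain l where l: "l \<in> F" "b' l > 0" using crz(1) by blast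
    have "b' l \<le> (\<Sum>l\<in>F. b' l)" using F l nn by (intro member_le_sum) auto
    then have "(\<Sum>l\<in>F. b' l) \<noteq> 0" using l by linarith
    then show ?thesis by (simp add: B_def bb flip: of_real_sum)
  qed
  then have iB: "(\<lambda>p. inverse (B p)) \<in> smooth_functions A" and B0: "\<And>p. B p \<noteq> 0"
    using smooth_functions_inverse[OF B] by auto
  show ?thesis
  proof (intro exI[of _ "\<lambda>l p. inverse (B p) * b l p"] conjI ballI allI impI)
    show "(\<lambda>p. inverse (B p) * b l p) \<in> smooth_functions A" if "l \<in> F" for l
      by (rule smooth_functions_mult[OF iB b[OF that]])
    show "(\<Sum>l\<in>F. inverse (B p) * b l p) = 1" for p
      using B0[of p] by (simp add: B_def flip: sum_distrib_left)
    fix c z r p assume l: "(c, z, r) \<in> F" and p: "\<not> (p \<in> chart_dom c \<and> chart_map c p \<in> cball z r)"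
    have r: "r > 0" using F l by auto
    show "inverse (B p) * b (c, z, r) p = 0"
      using p ball_bump_eq_0[OF r, of "chart_map c p" z] by (auto simp: b_def chart_bump_def)
  qed
qed

end

section \<open>Jet bounds over a finite cover\<close>

lemma ball_coverD:
  assumes "ball_cover A F" "(c, z, r) \<in> F"
  shows "c \<in> A" "r > 0" "cball z r \<subseteq> chart_img c"
  using assms unfolding ball_cover_def by auto

lemma ball_coverE:
  assumes "ball_cover A F"
  obtains c z r where "(c, z, r) \<in> F" "p \<in> chart_dom c" "chart_map c p \<in> ball z r"
proof -
  have "\<exists>(c, z, r)\<in>F. p \<in> chart_dom c \<and> chart_map c p \<in> ball z r"
    using assms unfolding ball_cover_def by blast
  then show thesis using that by auto
qed

text \<open>The bound by \<open>M\<close> on a C^k norm of \<open>h\<close>, computed in the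
  finitely many coordinate balls of the cover.\<close>

definition cover_jet_le ::
    "(('m, 'n::finite) chart \<times> (real^'n) \<times> real) set \<Rightarrow> nat \<Rightarrow> ('m \<Rightarrow> complex) \<Rightarrow> real \<Rightarrow> bool" where
  "cover_jet_le F k h M \<longleftrightarrow> (\<forall>(c, z, r)\<in>F. \<forall>x\<in>cball z r. jet_le k (h \<circ> chart_inv c) x M)"

lemma cover_jet_leD: "cover_jet_le F k h M \<Longrightarrow> (c, z, r) \<in> F \<Longrightarrow> x \<in> cball z r \<Longrightarrow> jet_le k (h \<circ> chart_inv c) x M"
  unfolding cover_jet_le_def by fast

lemma cover_jet_leI: "(\<And>c z r x. (c, z, r) \<in> F \<Longrightarrow> x \<in> cball z r \<Longrightarrow> jet_le k (h \<circ> chart_inv c) x M) \<Longrightarrow> cover_jet_le F k h M"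
  unfolding cover_jet_le_def by fast

lemma cover_jet_le_mono: "cover_jet_le F k h M \<Longrightarrow> l \<le> k \<Longrightarrow> M \<le> N \<Longrightarrow> cover_jet_le F l h N"
  by (rule cover_jet_leI, rule jet_le_mono[OF cover_jet_leD], assumption+)

context closed_manifold
begin

lemma cover_jet_le_norm:
  assumes F: "ball_cover A F" and j: "cover_jet_le F k h M"
  shows "cmod (h p) \<le> M"
proof -
  obtain c z r where c: "(c, z, r) \<in> F" "p \<in> chart_dom c" "chart_map c p \<in> ball z r" using ball_coverE[OF F] .
  then have "cmod ((h \<circ> chart_inv c) (chart_map c p)) \<le> M"
    using jet_le_norm[OF cover_jet_leD[OF j c(1)]] ball_subset_cball by blast
  then show ?thesis using chart_inv_map[OF ball_coverD(1)[OF F c(1)] c(2)] by simp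
qed

lemma ex_cover_jet_bound:
  assumes F: "ball_cover A F" and h: "h \<in> smooth_functions A"
  shows "\<exists>M\<ge>0. cover_jet_le F k h M"
proof -
  have "\<exists>M\<ge>0. \<forall>c z r x. l = (c, z, r) \<longrightarrow> x \<in> cball z r \<longrightarrow> jet_le k (h \<circ> chart_inv c) x M" if "l \<in> F" for l
  proof -
    obtain c z r where l: "l = (c, z, r)" by (cases l)
    note cD = ball_coverD[OF F that[unfolded l]]
    obtain M where "M \<ge> 0" "\<forall>x\<in>cball z r. jet_le k (h \<circ> chart_inv c) x M"
      using smooth_on_jet_bound[OF smooth_functionsD[OF h cD(1)] compact_cball cD(3)] by blast
    then show ?thesis using l by auto
  qed
  then obtain M where M: "\<And>l. l \<in> F \<Longrightarrow> M l \<ge> 0"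
    "\<And>l c z r x. l \<in> F \<Longrightarrow> l = (c, z, r) \<Longrightarrow> x \<in> cball z r \<Longrightarrow> jet_le k (h \<circ> chart_inv c) x (M l)"
    by metis
  have fin: "finite F" using F by (simp add: ball_cover_def)
  have "cover_jet_le F k h (\<Sum>l\<in>F. M l)"
  proof (rule cover_jet_leI)
    fix c z r x assume l: "(c, z, r) \<in> F" and x: "x \<in> cball z r"
    have "M (c, z, r) \<le> (\<Sum>l\<in>F. M l)" by (rule member_le_sum[OF l _ fin]) (use M(1) in auto)
    then show "jet_le k (h \<circ> chart_inv c) x (\<Sum>l\<in>F. M l)"
      using jet_le_mono[OF M(2)[OF l refl x] order_refl] by blast
  qed
  moreover have "(\<Sum>l\<in>F. M l) \<ge> 0" using M(1) by (rule sum_nonneg)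
  ultimately show ?thesis by blast
qed

end

section \<open>The measure and the Laplacian in a chart\<close>

lemma smooth_on_det:
  assumes "open V" "\<And>i j. smooth_on V (\<lambda>x. (M x :: real^'k::finite^'k) $ i $ j)"
  shows "smooth_on V (\<lambda>x. det (M x))"
  unfolding det_def by (intro smooth_on_sum smooth_on_mult smooth_on_const smooth_on_prod assms)

lemma matrix_inv_mult:
  fixes M :: "real^'k::finite^'k"
  assumes "det M \<noteq> 0"
  shows "M ** matrix_inv M = mat 1" "matrix_inv M ** M = mat 1"
proof -
  have "\<exists>N. M ** N = mat 1 \<and> N ** M = mat 1"
    using assms invertible_det_nz unfolding invertible_def by blast
  then have "M ** matrix_inv M = mat 1 \<and> matrix_inv M ** M = mat 1"
    unfolding matrix_inv_def by (rule someI_ex)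
  then show "M ** matrix_inv M = mat 1" "matrix_inv M ** M = mat 1" by auto
qed

text \<open>Cramer's rule: the entries of the inverse are quotients of polynomials in the entries of
  \<open>M\<close>, so they depend smoothly on a smooth family of invertible matrices.\<close>

lemma matrix_inv_component:
  fixes M :: "real^'k::finite^'k"
  assumes "det M \<noteq> 0"
  shows "matrix_inv M $ i $ j = det (\<chi> k l. if l = i then axis j 1 $ k else M $ k $ l) / det M"
proof -
  have "M *v (matrix_inv M *v axis j 1) = axis j 1"
    by (simp add: matrix_vector_mul_assoc matrix_inv_mult[OF assms])
  then have "matrix_inv M *v axis j 1 = (\<chi> i. det (\<chi> k l. if l = i then axis j 1 $ k else M $ k $ l) / det M)"
    using cramer[OF assms] by blast
  moreover have "(matrix_inv M *v axis j 1) $ i = matrix_inv M $ i $ j"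
    by (simp add: matrix_vector_mult_basis column_def)
  ultimately show ?thesis by simp
qed

lemma matrix_inv_symmetric:
  fixes M :: "real^'k::finite^'k"
  assumes "det M \<noteq> 0" "transpose M = M"
  shows "matrix_inv M $ i $ j = matrix_inv M $ j $ i"
proof -
  note inv = matrix_inv_mult[OF assms(1)]
  have "transpose (matrix_inv M) ** M = mat 1"
    using inv(1) assms(2) by (metis matrix_transpose_mul transpose_mat)
  then have "transpose (matrix_inv M) = matrix_inv M"
    using inv(1) by (metis matrix_mul_assoc matrix_mul_lid matrix_mul_rid)
  then have "transpose (matrix_inv M) $ i $ j = matrix_inv M $ i $ j" by simp
  then show ?thesis by (simp add: transpose_def)
qed

definition pull :: "('m, 'n::finite) chart \<Rightarrow> (real^'n \<Rightarrow> complex) \<Rightarrow> 'm \<Rightarrow> complex" where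
  "pull c h p = (if p \<in> chart_dom c then h (chart_map c p) else 0)"

text \<open>The coefficients sqrt(g) g^ij of the Laplace-Beltrami operator in divergence
  form.\<close>

definition metric_coeff :: "(('m, 'n::finite) chart \<Rightarrow> 'm \<Rightarrow> real^'n^'n) \<Rightarrow> ('m, 'n) chart \<Rightarrow> 'n \<Rightarrow> 'n \<Rightarrow> real^'n \<Rightarrow> real" where
  "metric_coeff G c i j w = sqrt (det (G c (chart_inv c w))) * matrix_inv (G c (chart_inv c w)) $ i $ j"

lemma laplacian_eq_div_form:
  "laplacian G c f p = (1 / sqrt (det (G c p))) *\<^sub>R div_form (metric_coeff G c) (f \<circ> chart_inv c) (chart_map c p)"
  by (simp add: laplacian_def div_form_def metric_coeff_def)

lemma div_form_cnj:
  assumes "open V" "smooth_on V h" "\<And>i j. smooth_on V (a i j)" "x \<in> V"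
  shows "div_form a (\<lambda>x. cnj (h x)) x = cnj (div_form a h x)"
proof -
  have *: "(\<Sum>j\<in>UNIV. a i j w *\<^sub>R partial_deriv j (\<lambda>x. cnj (h x)) w) = cnj (\<Sum>j\<in>UNIV. a i j w *\<^sub>R partial_deriv j h w)"
    if "w \<in> V" for w i
    using partial_deriv_linear[OF bounded_linear_cnj smooth_on_differentiable[OF assms(2) that]] by simp
  have "partial_deriv i (\<lambda>w. \<Sum>j\<in>UNIV. a i j w *\<^sub>R partial_deriv j (\<lambda>x. cnj (h x)) w) x =
      cnj (partial_deriv i (\<lambda>w. \<Sum>j\<in>UNIV. a i j w *\<^sub>R partial_deriv j h w) x)" for i
  proof -
    have "partial_deriv i (\<lambda>w. \<Sum>j\<in>UNIV. a i j w *\<^sub>R partial_deriv j (\<lambda>x. cnj (h x)) w) x =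
        partial_deriv i (\<lambda>w. cnj (\<Sum>j\<in>UNIV. a i j w *\<^sub>R partial_deriv j h w)) x"
      by (rule partial_deriv_cong[OF assms(1,4) *])
    also have "\<dots> = cnj (partial_deriv i (\<lambda>w. \<Sum>j\<in>UNIV. a i j w *\<^sub>R partial_deriv j h w) x)"
      by (intro partial_deriv_linear bounded_linear_cnj smooth_on_differentiable[OF _ assms(4)]
          smooth_on_sum smooth_on_scaleR smooth_on_partial assms)
    finally show ?thesis .
  qed
  then show ?thesis by (simp add: div_form_def)
qed

locale riemannian_setup = closed_manifold A
  for A :: "('m::{t2_space, second_countable_topology}, 'n::finite) chart set" +
  fixes \<omega> :: "('m, 'n) chart \<Rightarrow> 'm \<Rightarrow> real"
    and \<mu> :: "'m measure"
    and G :: "('m, 'n) chart \<Rightarrow> 'm \<Rightarrow> real^'n^'n"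
    and ev :: "nat \<Rightarrow> real"
    and \<phi> :: "nat \<Rightarrow> 'm \<Rightarrow> complex"
  assumes volume_form: "volume_form A \<omega>"
    and measure_of_volume_form: "measure_of_volume_form A \<omega> \<mu>"
    and prob: "prob_space \<mu>"
    and riemannian_metric: "riemannian_metric A G"
    and metric_induces: "metric_induces A G \<omega>"
    and laplace_eigenbasis: "laplace_eigenbasis A G \<mu> ev \<phi>"
begin

section \<open>Integration in charts\<close>

lemma smooth_density: "c \<in> A \<Longrightarrow> smooth_on (chart_img c) (\<lambda>x. \<omega> c (chart_inv c x))"
  and density_pos: "c \<in> A \<Longrightarrow> p \<in> chart_dom c \<Longrightarrow> \<omega> c p > 0"
  using volume_form unfolding volume_form_def comp_def by blast+

lemma density_eq: "c \<in> A \<Longrightarrow> p \<in> chart_dom c \<Longrightarrow> \<omega> c p = sqrt (det (G c p))"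
  using metric_induces unfolding metric_induces_def by blast

lemma sets_mu [measurable_cong]: "sets \<mu> = sets borel" and space_mu: "space \<mu> = UNIV"
proof -
  show s: "sets \<mu> = sets borel" using measure_of_volume_form by (simp add: measure_of_volume_form_def)
  show "space \<mu> = UNIV" using sets_eq_imp_space_eq[OF s] by simp
qed

lemma measurable_continuous: "continuous_on UNIV f \<Longrightarrow> f \<in> borel_measurable \<mu>"
  using borel_measurable_continuous_onI measurable_cong_sets[OF sets_mu refl] by blast

lemma bounded_continuous: "continuous_on UNIV (f :: 'm \<Rightarrow> 'b::real_normed_vector) \<Longrightarrow> \<exists>B>0. \<forall>p. norm (f p) \<le> B"
proof -
  assume "continuous_on UNIV f"
  then have "bounded (range f)" using compact_UNIV compact_continuous_image compact_imp_bounded by blast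
  then show ?thesis by (auto simp: bounded_pos)
qed

lemma integrable_continuous:
  fixes f :: "'m \<Rightarrow> 'b::{banach, second_countable_topology}"
  assumes "continuous_on UNIV f"
  shows "integrable \<mu> f"
proof -
  interpret prob_space \<mu> by (rule prob)
  obtain B where "\<And>p. norm (f p) \<le> B" using bounded_continuous[OF assms] by blast
  then show ?thesis by (intro integrable_const_bound[of _ B] measurable_continuous assms) auto
qed

lemma integrable_smooth: "f \<in> smooth_functions A \<Longrightarrow> integrable \<mu> f"
  by (rule integrable_continuous[OF continuous_smooth_function])

text \<open>The Lebesgue density of \<mu> in the chart; the value 0 off the chart image lets chart
  integrals run over all of Euclidean space.\<close>

definition density_on where
  "density_on c x = (if x \<in> chart_img c then \<omega> c (chart_inv c x) else 0)"

lemma density_on_nonneg: "c \<in> A \<Longrightarrow> density_on c x \<ge> 0"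
  using density_pos[of c "chart_inv c x"] chart_inv_dom[of c x] by (auto simp: density_on_def intro: less_imp_le)

lemma density_on_pos: "c \<in> A \<Longrightarrow> x \<in> chart_img c \<Longrightarrow> density_on c x > 0"
  using density_pos[of c "chart_inv c x"] chart_inv_dom[of c x] by (auto simp: density_on_def intro: less_imp_le)

lemma density_on_nz: "c \<in> A \<Longrightarrow> x \<in> chart_img c \<Longrightarrow> density_on c x \<noteq> 0"
  by (rule less_imp_neq[OF density_on_pos, symmetric])

lemma smooth_density_on: "c \<in> A \<Longrightarrow> smooth_on (chart_img c) (density_on c)"
  using smooth_density smooth_on_cong[OF open_chart_img, of c "density_on c" "\<lambda>x. \<omega> c (chart_inv c x)"]
  by (simp add: density_on_def)

lemma measurable_density_on: "c \<in> A \<Longrightarrow> density_on c \<in> borel_measurable borel"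
proof -
  assume c: "c \<in> A"
  have "(\<lambda>x. indicator (chart_img c) x *\<^sub>R density_on c x) \<in> borel_measurable borel"
    by (rule borel_measurable_continuous_on_indicator[OF borel_open[OF open_chart_img[OF c]]
          smooth_on_continuous[OF smooth_density_on[OF c]]])
  moreover have "(\<lambda>x. indicator (chart_img c) x *\<^sub>R density_on c x) = density_on c"
    by (auto simp: density_on_def indicator_def)
  ultimately show ?thesis by simp
qed

text \<open>The restriction of \<mu> to the chart domain is the image, under the inverse chart, of
  Lebesgue measure with this density: the two agree on Borel sets by the defining property of \<mu>.
  The integral formula follows by transport.\<close>

lemma integral_chart:
  fixes f :: "'m \<Rightarrow> 'b::{banach, second_countable_topology}"
  assumes c: "c \<in> A" and f: "f \<in> borel_measurable borel" "\<And>p. p \<notin> chart_dom c \<Longrightarrow> f p = 0"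
  shows "(\<integral>p. f p \<partial>\<mu>) = (\<integral>x. density_on c x *\<^sub>R f (chart_inv c x) \<partial>lborel)"
proof -
  \<comment> \<open>A total Borel version of the inverse chart. Its value off the chart image is
    immaterial because the density is 0 there.\<close>
  define T where "T x = (if x \<in> chart_img c then chart_inv c x else undefined)" for x
  have img: "chart_img c \<in> sets borel" and dom: "chart_dom c \<in> sets borel"
    using open_chart_img[OF c] open_chart_dom[OF c] by auto
  have T: "T \<in> borel_measurable borel"
    unfolding T_def by (intro borel_measurable_continuous_on_if img continuous_chart_inv[OF c] continuous_on_const)
  let ?g = "\<lambda>x. ennreal (density_on c x)"
  have g: "?g \<in> borel_measurable lborel" using measurable_density_on[OF c] by simp
  have eq: "density \<mu> (\<lambda>p. ennreal (indicator (chart_dom c) p)) = distr (density lborel ?g) borel T"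
  proof (rule measure_eqI)
    show "sets (density \<mu> (\<lambda>p. ennreal (indicator (chart_dom c) p))) = sets (distr (density lborel ?g) borel T)"
      by (simp add: sets_mu)
    fix B assume "B \<in> sets (density \<mu> (\<lambda>p. ennreal (indicator (chart_dom c) p)))"
    then have B: "B \<in> sets borel" by (simp add: sets_mu)
    have "emeasure (density \<mu> (\<lambda>p. ennreal (indicator (chart_dom c) p))) B = (\<integral>\<^sup>+p. ennreal (indicator (chart_dom c) p) * indicator B p \<partial>\<mu>)"
      using B dom by (subst emeasure_density) (auto simp: sets_mu)
    also have "\<dots> = (\<integral>\<^sup>+p. indicator (chart_dom c \<inter> B) p \<partial>\<mu>)"
      by (intro nn_integral_cong) (auto simp: indicator_def)
    also have "\<dots> = emeasure \<mu> (chart_dom c \<inter> B)" using B dom by (simp add: sets_mu)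
    also have "\<dots> = (\<integral>\<^sup>+x\<in>chart_map c ` (chart_dom c \<inter> B). ennreal (\<omega> c (chart_inv c x)) \<partial>lborel)"
      using measure_of_volume_form c B dom unfolding measure_of_volume_form_def by blast
    also have "\<dots> = (\<integral>\<^sup>+x. ?g x * indicator (T -` B) x \<partial>lborel)"
      unfolding chart_map_image[OF c] by (intro nn_integral_cong) (auto simp: indicator_def density_on_def T_def)
    also have "\<dots> = emeasure (density lborel ?g) (T -` B)"
      using measurable_sets[OF T B] g by (subst emeasure_density) auto
    also have "\<dots> = emeasure (distr (density lborel ?g) borel T) B"
      using T B by (subst emeasure_distr) auto
    finally show "emeasure (density \<mu> (\<lambda>p. ennreal (indicator (chart_dom c) p))) B = emeasure (distr (density lborel ?g) borel T) B" .
  qed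
  have "(\<integral>p. f p \<partial>\<mu>) = (\<integral>p. indicator (chart_dom c) p *\<^sub>R f p \<partial>\<mu>)"
    using f(2) by (intro Bochner_Integration.integral_cong) (auto simp: indicator_def)
  also have "\<dots> = (\<integral>p. f p \<partial>density \<mu> (\<lambda>p. ennreal (indicator (chart_dom c) p)))"
    using f(1) dom by (subst integral_density) (auto simp: measurable_cong_sets[OF sets_mu refl])
  also have "\<dots> = (\<integral>x. f (T x) \<partial>density lborel ?g)"
    unfolding eq using T f(1) by (subst integral_distr) auto
  also have "\<dots> = (\<integral>x. density_on c x *\<^sub>R f (T x) \<partial>lborel)"
    using T f(1) measurable_density_on[OF c] density_on_nonneg[OF c]
    by (subst integral_density) (auto intro: measurable_compose[OF T f(1)])
  also have "\<dots> = (\<integral>x. density_on c x *\<^sub>R f (chart_inv c x) \<partial>lborel)"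
    by (intro Bochner_Integration.integral_cong) (auto simp: T_def density_on_def)
  finally show ?thesis .
qed

lemma measurable_pull:
  assumes "c \<in> A" "continuous_on (chart_img c) h"
  shows "pull c h \<in> borel_measurable borel"
proof -
  have "continuous_on (chart_dom c) (\<lambda>p. h (chart_map c p))"
    by (rule continuous_on_compose2[OF assms(2) continuous_chart_map[OF assms(1)]]) auto
  then have "(\<lambda>p. if p \<in> chart_dom c then h (chart_map c p) else 0) \<in> borel_measurable borel"
    by (intro borel_measurable_continuous_on_if borel_open open_chart_dom assms continuous_on_const)
  then show ?thesis by (simp add: pull_def[abs_def])
qed

lemma integral_mult_pull:
  assumes c: "c \<in> A" and e: "continuous_on UNIV e" and h: "continuous_on (chart_img c) h" "\<And>x. x \<notin> chart_img c \<Longrightarrow> h x = 0"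
  shows "(\<integral>p. e p * pull c h p \<partial>\<mu>) = (\<integral>x. density_on c x *\<^sub>R (e (chart_inv c x) * h x) \<partial>lborel)"
proof -
  have "(\<integral>p. e p * pull c h p \<partial>\<mu>) = (\<integral>x. density_on c x *\<^sub>R (e (chart_inv c x) * pull c h (chart_inv c x)) \<partial>lborel)"
    by (rule integral_chart[OF c, of "\<lambda>p. e p * pull c h p"])
       (intro borel_measurable_times borel_measurable_continuous_onI[OF e] measurable_pull[OF c h(1)], simp add: pull_def)
  also have "\<dots> = (\<integral>x. density_on c x *\<^sub>R (e (chart_inv c x) * h x) \<partial>lborel)"
  proof (rule Bochner_Integration.integral_cong[OF refl])
    fix x
    show "density_on c x *\<^sub>R (e (chart_inv c x) * pull c h (chart_inv c x)) = density_on c x *\<^sub>R (e (chart_inv c x) * h x)"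
      using chart_inv_dom[OF c, of x] chart_map_inv[OF c, of x] h(2)[of x] by (auto simp: pull_def density_on_def)
  qed
  finally show ?thesis .
qed

text \<open>The integrand is positive on an open ball, which has positive Lebesgue measure. The
  positive mass is what allows bumps to be normalized into an approximate identity.\<close>

lemma integral_chart_bump_pos:
  assumes c: "c \<in> A" and r: "r > 0" "cball z r \<subseteq> chart_img c"
  shows "\<exists>t>0. (\<integral>p. chart_bump c z r p \<partial>\<mu>) = of_real t"
proof -
  define b where "b p = (if p \<in> chart_dom c then ball_bump z r (chart_map c p) else 0)" for p
  have bump: "chart_bump c z r p = of_real (b p)" for p by (simp add: b_def chart_bump_def)
  have b_re: "b p = Re (chart_bump c z r p)" for p by (simp add: bump)
  have cb: "continuous_on UNIV b"
    unfolding b_re[abs_def] by (intro continuous_intros continuous_smooth_function smooth_chart_bump c r)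
  define q where "q x = density_on c x * ball_bump z r x" for x
  have q: "(\<integral>p. b p \<partial>\<mu>) = (\<integral>x. q x \<partial>lborel)"
  proof -
    have "(\<integral>p. b p \<partial>\<mu>) = (\<integral>x. density_on c x *\<^sub>R b (chart_inv c x) \<partial>lborel)"
      by (rule integral_chart[OF c borel_measurable_continuous_onI[OF cb]]) (simp add: b_def)
    also have "\<dots> = (\<integral>x. q x \<partial>lborel)"
      using chart_inv_dom[OF c] chart_map_inv[OF c]
      by (intro Bochner_Integration.integral_cong) (auto simp: q_def density_on_def b_def)
    finally show ?thesis .
  qed
  have nn: "q x \<ge> 0" for x unfolding q_def by (intro mult_nonneg_nonneg density_on_nonneg[OF c] ball_bump_nonneg)
  have "continuous_on (cball z r) q" unfolding q_def
    by (intro continuous_intros continuous_on_subset[OF smooth_on_continuous[OF smooth_density_on[OF c]] r(2)]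
        continuous_on_subset[OF smooth_on_continuous[OF smooth_on_ball_bump]]) auto
  moreover have "q x = 0" if "x \<notin> cball z r" for x using that ball_bump_eq_0[OF r(1), of x z] by (simp add: q_def)
  ultimately have int: "integrable lborel q" using integrable_compact_support[OF compact_cball] by blast
  have "(\<integral>x. q x \<partial>lborel) \<noteq> 0"
  proof
    assume "(\<integral>x. q x \<partial>lborel) = 0"
    then have "AE x in lborel. q x = 0" using integral_nonneg_eq_0_iff_AE[OF int] nn by auto
    moreover have "q x > 0" if "x \<in> ball z r" for x
    proof -
      have "x \<in> chart_img c" using that r(2) ball_subset_cball by blast
      then show ?thesis unfolding q_def
        by (rule mult_pos_pos[OF density_on_pos[OF c]]) (use that ball_bump_pos_iff[OF r(1)] in blast)
    qed
    ultimately have "AE x in lborel. x \<notin> ball z r" by (auto elim!: eventually_mono simp del: mem_ball) force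
    then have "emeasure lborel (ball z r) = 0"
      using AE_iff_measurable[of "ball z r" lborel "\<lambda>x. x \<notin> ball z r"] by (auto simp del: mem_ball)
    then show False using content_ball_pos[OF r(1), of z] by (simp add: measure_def)
  qed
  moreover have "(\<integral>x. q x \<partial>lborel) \<ge> 0" by (rule Bochner_Integration.integral_nonneg[OF nn])
  ultimately have "(\<integral>p. b p \<partial>\<mu>) > 0" using q by linarith
  moreover have "(\<integral>p. chart_bump c z r p \<partial>\<mu>) = of_real (\<integral>p. b p \<partial>\<mu>)" unfolding bump by (rule integral_complex_of_real)
  ultimately show ?thesis by blast
qed

lemma metric_det_pos: "c \<in> A \<Longrightarrow> p \<in> chart_dom c \<Longrightarrow> det (G c p) > 0"
  using density_pos[of c p] density_eq[of c p] by simp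

text \<open>The factor sqrt(det G) is smooth because it equals the density of the volume form, and
  the entries of the inverse metric are smooth by Cramer's rule.\<close>

lemma smooth_metric_coeff:
  assumes c: "c \<in> A"
  shows "smooth_on (chart_img c) (metric_coeff G c i j)"
proof -
  note V = open_chart_img[OF c]
  have G: "smooth_on (chart_img c) (\<lambda>x. G c (chart_inv c x) $ k $ l)" for k l
    using riemannian_metric c unfolding riemannian_metric_def by blast
  have cof: "smooth_on (chart_img c) (\<lambda>x. (\<chi> k l. if l = i then axis j 1 $ k else G c (chart_inv c x) $ k $ l) $ k $ l)" for k l
    using G by (cases "l = i") auto
  have "smooth_on (chart_img c) (\<lambda>x. \<omega> c (chart_inv c x) *
      (det (\<chi> k l. if l = i then axis j 1 $ k else G c (chart_inv c x) $ k $ l) * inverse (det (G c (chart_inv c x)))))"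
    by (intro smooth_on_mult smooth_on_inverse smooth_density smooth_on_det V c G cof
        less_imp_neq[OF metric_det_pos[OF c chart_inv_dom[OF c]], symmetric])
  moreover have "metric_coeff G c i j x = \<omega> c (chart_inv c x) *
      (det (\<chi> k l. if l = i then axis j 1 $ k else G c (chart_inv c x) $ k $ l) * inverse (det (G c (chart_inv c x))))"
    if "x \<in> chart_img c" for x
    using metric_det_pos[OF c chart_inv_dom[OF c that]] density_eq[OF c chart_inv_dom[OF c that]]
    by (simp add: metric_coeff_def matrix_inv_component divide_inverse)
  ultimately show ?thesis by (subst smooth_on_cong[OF V]) auto
qed

lemma metric_coeff_sym:
  assumes c: "c \<in> A" "x \<in> chart_img c"
  shows "metric_coeff G c i j x = metric_coeff G c j i x"
proof -
  have "transpose (G c (chart_inv c x)) = G c (chart_inv c x)"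
    using riemannian_metric c chart_inv_dom[OF c] unfolding riemannian_metric_def by blast
  moreover have "det (G c (chart_inv c x)) \<noteq> 0" using metric_det_pos[OF c(1) chart_inv_dom[OF c]] by simp
  ultimately show ?thesis unfolding metric_coeff_def by (subst matrix_inv_symmetric) auto
qed

text \<open>The operator 1 - \<Delta> in coordinates. It multiplies \<phi>_i by 1 + ev_i^2, which is
  never 0 and is comparable to (1 + ev_i)^2.\<close>

definition helmholtz :: "('m, 'n) chart \<Rightarrow> (real^'n \<Rightarrow> complex) \<Rightarrow> real^'n \<Rightarrow> complex" where
  "helmholtz c h x = h x - inverse (density_on c x) *\<^sub>R div_form (metric_coeff G c) h x"

lemma smooth_inverse_density: "c \<in> A \<Longrightarrow> smooth_on (chart_img c) (\<lambda>x. inverse (density_on c x))"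
  by (intro smooth_on_inverse open_chart_img smooth_density_on density_on_nz)

lemma order_le_helmholtz:
  assumes c: "c \<in> A" and K: "compact K" "K \<subseteq> chart_img c"
  shows "order_le (chart_img c) K 2 (helmholtz c)"
proof -
  note V = open_chart_img[OF c]
  note o = order_le_bilinear[OF V K bounded_bilinear_scaleR]
  let ?P = "\<lambda>i j h x. partial_deriv i (\<lambda>w. metric_coeff G c i j w *\<^sub>R partial_deriv j h w) x"
  have flux: "order_le (chart_img c) K 1 (\<lambda>h w. \<Sum>j\<in>UNIV. metric_coeff G c i j w *\<^sub>R partial_deriv j h w)" for i
    using order_le_compose[OF o[OF smooth_metric_coeff[OF c]] order_le_partial]
    by (intro order_le_sum[OF V K(2)]) simp
  have "order_le (chart_img c) K 2 (\<lambda>h. partial_deriv i (\<lambda>w. \<Sum>j\<in>UNIV. metric_coeff G c i j w *\<^sub>R partial_deriv j h w))" for i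
    using order_le_compose[OF order_le_partial flux] by (simp add: numeral_2_eq_2)
  then have "order_le (chart_img c) K 2 (div_form (metric_coeff G c))"
    unfolding div_form_def[abs_def] by (intro order_le_sum[OF V K(2)]) simp
  then have "order_le (chart_img c) K 2 (\<lambda>h x. (- inverse (density_on c x)) *\<^sub>R div_form (metric_coeff G c) h x)"
    using order_le_compose[OF o[OF smooth_on_minus[OF V smooth_inverse_density[OF c]]]] by fastforce
  moreover have "order_le (chart_img c) K 2 (\<lambda>h :: real^'n \<Rightarrow> complex. h)"
    unfolding order_le_def by (auto intro!: exI[of _ 1] intro: jet_le_mono)
  ultimately have "order_le (chart_img c) K 2 (\<lambda>h x. h x + (- inverse (density_on c x)) *\<^sub>R div_form (metric_coeff G c) h x)"
    using order_le_add[OF V K(2)] by blast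
  then show ?thesis by (simp add: helmholtz_def[abs_def])
qed

lemma smooth_helmholtz_pow:
  assumes c: "c \<in> A" and h: "smooth_on (chart_img c) h"
  shows "smooth_on (chart_img c) ((helmholtz c ^^ m) h)"
  \<comment> \<open>With the empty compact set, only the smoothness part of \<open>order_le\<close>
    is of interest.\<close>
  using order_le_smooth[OF order_le_funpow[OF order_le_helmholtz[OF c, of "{}"]] h] by simp

lemma helmholtz_supp:
  assumes "closed C" "\<And>x. x \<notin> C \<Longrightarrow> h x = 0" "x \<notin> C"
  shows "helmholtz c h x = 0"
  using div_form_eq_0[of "- C" x h "metric_coeff G c"] assms by (auto simp: helmholtz_def)

lemma helmholtz_pow_supp:
  assumes "closed C" "\<And>x. x \<notin> C \<Longrightarrow> h x = 0" "x \<notin> C"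
  shows "(helmholtz c ^^ m) h x = 0"
  using assms(3) by (induction m arbitrary: x) (auto intro: helmholtz_supp[OF assms(1)] assms(2))

text \<open>The equation \<Delta>e = \<kappa> e multiplied by the density, which is the form that
  meets Green's identity. It is used for the basis, for its conjugates and for the constant
  1.\<close>

definition eigenfunction :: "('m \<Rightarrow> complex) \<Rightarrow> real \<Rightarrow> bool" where
  "eigenfunction e \<kappa> \<longleftrightarrow> e \<in> smooth_functions A \<and>
     (\<forall>c\<in>A. \<forall>x\<in>chart_img c. div_form (metric_coeff G c) (e \<circ> chart_inv c) x = of_real (\<kappa> * density_on c x) * e (chart_inv c x))"

text \<open>Self-adjointness of 1 - \<Delta>, tested on a function supported in one chart: Green's
  identity moves the operator onto \<open>e\<close>, where it acts by the factor 1 -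
  \<kappa>.\<close>

lemma integral_helmholtz:
  assumes e: "eigenfunction e \<kappa>" and c: "c \<in> A" and C: "compact C" "C \<subseteq> chart_img c"
    and h: "smooth_on (chart_img c) h" "\<And>x. x \<notin> C \<Longrightarrow> h x = 0"
  shows "(\<integral>p. e p * pull c (helmholtz c h) p \<partial>\<mu>) = of_real (1 - \<kappa>) * (\<integral>p. e p * pull c h p \<partial>\<mu>)"
proof -
  note V = open_chart_img[OF c]
  let ?a = "metric_coeff G c" and ?e = "\<lambda>x. e (chart_inv c x)" and ?w = "density_on c"
  have es: "e \<in> smooth_functions A" using e by (simp add: eigenfunction_def)
  have ec: "continuous_on UNIV e" by (rule continuous_smooth_function[OF es])
  have e': "smooth_on (chart_img c) ?e" using smooth_functionsD[OF es c] by (simp add: comp_def)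
  have eig: "div_form ?a ?e x = of_real (\<kappa> * ?w x) * ?e x" if "x \<in> chart_img c" for x
    using e c that unfolding eigenfunction_def comp_def by blast
  have cont: "continuous_on C g" if "smooth_on (chart_img c) g" for g :: "real^'n \<Rightarrow> complex"
    using smooth_on_continuous[OF that] C(2) continuous_on_subset by blast
  have cl: "closed C" using C(1) by (rule compact_imp_closed)
  have D: "smooth_on (chart_img c) (helmholtz c h)" "\<And>x. x \<notin> C \<Longrightarrow> helmholtz c h x = 0"
    using smooth_helmholtz_pow[OF c h(1), of 1] helmholtz_supp[OF cl h(2)] by auto
  have dv: "smooth_on (chart_img c) (div_form ?a h)" "\<And>x. x \<notin> C \<Longrightarrow> div_form ?a h x = 0"
    using smooth_on_div_form[OF V smooth_metric_coeff[OF c] h(1)] div_form_eq_0[of "- C" _ h ?a] h(2) cl by auto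
  have p: "(\<integral>p. e p * pull c g p \<partial>\<mu>) = (\<integral>x. ?w x *\<^sub>R (?e x * g x) \<partial>lborel)"
    if "smooth_on (chart_img c) g" "\<And>x. x \<notin> C \<Longrightarrow> g x = 0" for g
    using that C(2) by (intro integral_mult_pull[OF c ec smooth_on_continuous]) auto
  have int: "integrable lborel (\<lambda>x. ?w x *\<^sub>R (?e x * h x))" "integrable lborel (\<lambda>x. div_form ?a h x * ?e x)"
    using dv h(2)
    by (intro integrable_compact_support[OF C(1)] cont smooth_on_scaleR smooth_on_mult V smooth_density_on c e' h dv; simp)+
  have "(\<integral>p. e p * pull c (helmholtz c h) p \<partial>\<mu>) = (\<integral>x. ?w x *\<^sub>R (?e x * helmholtz c h x) \<partial>lborel)" by (rule p[OF D])
  also have "\<dots> = (\<integral>x. ?w x *\<^sub>R (?e x * h x) - div_form ?a h x * ?e x \<partial>lborel)"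
  proof (rule Bochner_Integration.integral_cong[OF refl])
    fix x
    show "?w x *\<^sub>R (?e x * helmholtz c h x) = ?w x *\<^sub>R (?e x * h x) - div_form ?a h x * ?e x"
    proof (cases "x \<in> C")
      case True
      then have "?w x \<noteq> 0" using density_on_nz[OF c] C(2) by blast
      then show ?thesis by (simp add: helmholtz_def algebra_simps)
    next
      case False then show ?thesis using D h(2) dv by simp
    qed
  qed
  also have "\<dots> = (\<integral>x. ?w x *\<^sub>R (?e x * h x) \<partial>lborel) - (\<integral>x. div_form ?a h x * ?e x \<partial>lborel)"
    by (rule Bochner_Integration.integral_diff[OF int])
  also have "(\<integral>x. div_form ?a h x * ?e x \<partial>lborel) = (\<integral>x. h x * div_form ?a ?e x \<partial>lborel)"
    by (rule green_identity[OF V C h e' smooth_metric_coeff[OF c] metric_coeff_sym[OF c]])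
  also have "\<dots> = (\<integral>x. of_real \<kappa> * (?w x *\<^sub>R (?e x * h x)) \<partial>lborel)"
  proof (rule Bochner_Integration.integral_cong[OF refl])
    fix x
    show "h x * div_form ?a ?e x = of_real \<kappa> * (?w x *\<^sub>R (?e x * h x))"
      using eig[of x] h(2)[of x] C(2) by (cases "x \<in> C") (auto simp: scaleR_conv_of_real)
  qed
  also have "\<dots> = of_real \<kappa> * (\<integral>x. ?w x *\<^sub>R (?e x * h x) \<partial>lborel)"
    by (rule integral_mult_right_zero)
  finally show ?thesis using p[OF h] by (simp add: algebra_simps)
qed

lemma integral_helmholtz_pow:
  assumes e: "eigenfunction e \<kappa>" and c: "c \<in> A" and C: "compact C" "C \<subseteq> chart_img c"
    and h: "smooth_on (chart_img c) h" "\<And>x. x \<notin> C \<Longrightarrow> h x = 0"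
  shows "(\<integral>p. e p * pull c ((helmholtz c ^^ m) h) p \<partial>\<mu>) = of_real (1 - \<kappa>) ^ m * (\<integral>p. e p * pull c h p \<partial>\<mu>)"
proof (induction m)
  case (Suc m)
  have "(\<integral>p. e p * pull c (helmholtz c ((helmholtz c ^^ m) h)) p \<partial>\<mu>) =
      of_real (1 - \<kappa>) * (\<integral>p. e p * pull c ((helmholtz c ^^ m) h) p \<partial>\<mu>)"
    by (rule integral_helmholtz[OF e c C smooth_helmholtz_pow[OF c h(1)] helmholtz_pow_supp[OF compact_imp_closed[OF C(1)] h(2)]])
  then show ?case using Suc by simp
qed simp

section \<open>The eigenbasis and its conjugates\<close>

lemma basis_smooth: "\<phi> i \<in> smooth_functions A"
  and basis_orthonormal: "(\<integral>p. \<phi> i p * cnj (\<phi> j p) \<partial>\<mu>) = (if i = j then 1 else 0)"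
  using laplace_eigenbasis unfolding laplace_eigenbasis_def by blast+

lemma ev_nonneg: "ev i \<ge> 0" and ev_pos: "i \<ge> 1 \<Longrightarrow> ev i > 0"
proof -
  have e: "ev 0 = 0" "0 < ev 1" "\<And>i. i \<ge> 1 \<Longrightarrow> ev i \<le> ev (Suc i)"
    using laplace_eigenbasis unfolding laplace_eigenbasis_def by blast+
  show pos: "ev i > 0" if "i \<ge> 1" for i
    using that by (induction i rule: nat_induct_at_least) (use e in \<open>auto intro: less_le_trans\<close>)
  show "ev i \<ge> 0" using e(1) pos[of i] by (cases "i = 0") auto
qed

lemma eigenfunction_basis: "eigenfunction (\<phi> i) (- (ev i)\<^sup>2)"
  unfolding eigenfunction_def
proof (intro conjI ballI basis_smooth)
  fix c x assume c: "c \<in> A" "x \<in> chart_img c"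
  let ?p = "chart_inv c x"
  have p: "?p \<in> chart_dom c" "chart_map c ?p = x" using c chart_inv_dom chart_map_inv by auto
  have "laplacian G c (\<phi> i) ?p = - of_real ((ev i)\<^sup>2) * \<phi> i ?p"
    using laplace_eigenbasis c p unfolding laplace_eigenbasis_def by blast
  then have "(1 / density_on c x) *\<^sub>R div_form (metric_coeff G c) (\<phi> i \<circ> chart_inv c) x = - of_real ((ev i)\<^sup>2) * \<phi> i ?p"
    using c p density_eq[OF c(1) p(1)] by (simp add: laplacian_eq_div_form density_on_def)
  then show "div_form (metric_coeff G c) (\<phi> i \<circ> chart_inv c) x = of_real (- (ev i)\<^sup>2 * density_on c x) * \<phi> i ?p"
    using density_on_pos[OF c] by (simp add: scaleR_conv_of_real field_simps)
qed

text \<open>The coefficients of the Laplacian, the density and \<kappa> are real, so conjugation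
  commutes with the equation.\<close>

lemma eigenfunction_cnj:
  assumes "eigenfunction e \<kappa>"
  shows "eigenfunction (\<lambda>p. cnj (e p)) \<kappa>"
  unfolding eigenfunction_def
proof (intro conjI ballI)
  have e: "e \<in> smooth_functions A" using assms by (simp add: eigenfunction_def)
  then show "(\<lambda>p. cnj (e p)) \<in> smooth_functions A" by (rule smooth_functions_cnj)
  fix c x assume c: "c \<in> A" "x \<in> chart_img c"
  have "div_form (metric_coeff G c) ((\<lambda>p. cnj (e p)) \<circ> chart_inv c) x = cnj (div_form (metric_coeff G c) (e \<circ> chart_inv c) x)"
    using div_form_cnj[OF open_chart_img[OF c(1)] smooth_functionsD[OF e c(1)] smooth_metric_coeff[OF c(1)] c(2)]
    by (simp add: comp_def)
  also have "\<dots> = of_real (\<kappa> * density_on c x) * cnj (e (chart_inv c x))"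
    using assms c unfolding eigenfunction_def by (metis complex_cnj_complex_of_real complex_cnj_mult)
  finally show "div_form (metric_coeff G c) ((\<lambda>p. cnj (e p)) \<circ> chart_inv c) x = of_real (\<kappa> * density_on c x) * cnj (e (chart_inv c x))" .
qed

lemma eigenfunction_one: "eigenfunction (\<lambda>p. 1) 0"
  unfolding eigenfunction_def using smooth_functions_const by (simp add: comp_def div_form_def)

end

section \<open>Sobolev bounds\<close>

context riemannian_setup
begin

lemma integrable_bounded:
  fixes f :: "'m \<Rightarrow> complex"
  assumes "f \<in> borel_measurable borel" "\<And>p. cmod (f p) \<le> B"
  shows "integrable \<mu> f"
proof -
  interpret prob_space \<mu> by (rule prob)
  show ?thesis using assms(1)
    by (intro integrable_const_bound[of _ B] AE_I2 assms(2)) (simp add: measurable_cong_sets[OF sets_mu refl])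
qed

lemma integrable_smooth_mult:
  assumes "f \<in> borel_measurable borel" "\<And>p. cmod (f p) \<le> B" "e \<in> smooth_functions A"
  shows "integrable \<mu> (\<lambda>p. e p * f p)"
proof -
  obtain D where D: "D > 0" "\<And>p. cmod (e p) \<le> D"
    using bounded_continuous[OF continuous_smooth_function[OF assms(3)]] by blast
  show ?thesis
  proof (rule integrable_bounded[where B = "D * B"])
    show "(\<lambda>p. e p * f p) \<in> borel_measurable borel"
      using assms(1) borel_measurable_continuous_onI[OF continuous_smooth_function[OF assms(3)]] by simp
    show "cmod (e p * f p) \<le> D * B" for p
      unfolding norm_mult using D assms(2) by (intro mult_mono) (auto intro: less_imp_le)
  qed
qed

lemma basis_orthonormal':
  "(\<integral>p. cnj (\<phi> i p) * \<phi> j p \<partial>\<mu>) = (if i = j then 1 else 0)"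
  "(\<integral>p. \<phi> j p * cnj (\<phi> i p) \<partial>\<mu>) = (if i = j then 1 else 0)"
  using basis_orthonormal[of j i] by (auto simp: mult.commute)

text \<open>Bessel's inequality for the conjugated basis, which is orthonormal too: subtracting the
  projection \<open>s\<close> leaves a nonnegative squared norm. The pairing has no conjugate
  because distributions pair bilinearly with test functions. As \<mu> is a probability, B^2 bounds
  the squared L^2 norm of \<open>v\<close>.\<close>

lemma bessel:
  assumes v: "v \<in> borel_measurable borel" "\<And>p. cmod (v p) \<le> B"
  shows "(\<Sum>i<N. (cmod (\<integral>p. \<phi> i p * v p \<partial>\<mu>))\<^sup>2) \<le> B\<^sup>2"
proof -
  interpret prob_space \<mu> by (rule prob)
  define b where "b i = (\<integral>p. \<phi> i p * v p \<partial>\<mu>)" for i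
  define s where "s p = (\<Sum>i<N. b i * cnj (\<phi> i p))" for p
  have ss: "s \<in> smooth_functions A" unfolding s_def
    by (intro smooth_functions_sum smooth_functions_cmult smooth_functions_cnj basis_smooth)
  have cv: "(\<lambda>p. cnj (v p)) \<in> borel_measurable borel"
    by (rule measurable_compose[OF v(1) borel_measurable_continuous_onI]) (intro continuous_intros)
  have iv: "integrable \<mu> (\<lambda>p. e p * v p)" and icv: "integrable \<mu> (\<lambda>p. e p * cnj (v p))" if "e \<in> smooth_functions A" for e
    using integrable_smooth_mult[OF v that] integrable_smooth_mult[OF cv _ that, of B] v(2) by auto
  have B: "B \<ge> 0" using v(2) norm_ge_zero order_trans by blast
  have ivv: "integrable \<mu> (\<lambda>p. v p * cnj (v p))"
  proof (rule integrable_bounded[where B = "B * B"])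
    show "cmod (v p * cnj (v p)) \<le> B * B" for p
      unfolding norm_mult using v(2) B by (intro mult_mono) auto
  qed (use v cv in simp)
  have sv: "(\<integral>p. cnj (s p) * v p \<partial>\<mu>) = (\<Sum>i<N. of_real ((cmod (b i))\<^sup>2))"
  proof -
    have "(\<integral>p. cnj (s p) * v p \<partial>\<mu>) = (\<integral>p. (\<Sum>i<N. cnj (b i) * (\<phi> i p * v p)) \<partial>\<mu>)"
      by (simp add: s_def sum_distrib_right mult.assoc)
    also have "\<dots> = (\<Sum>i<N. cnj (b i) * b i)"
      by (subst Bochner_Integration.integral_sum) (use iv[OF basis_smooth] in \<open>auto simp: b_def\<close>)
    finally show ?thesis by (simp only: complex_norm_square mult.commute[of "cnj _"])
  qed
  have sv': "(\<integral>p. s p * cnj (v p) \<partial>\<mu>) = (\<Sum>i<N. of_real ((cmod (b i))\<^sup>2))"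
  proof -
    have "(\<integral>p. s p * cnj (v p) \<partial>\<mu>) = cnj (\<integral>p. cnj (s p) * v p \<partial>\<mu>)"
      using Bochner_Integration.integral_cnj[of \<mu> "\<lambda>p. cnj (s p) * v p"] by simp
    then show ?thesis by (simp add: sv)
  qed
  have sss: "(\<integral>p. s p * cnj (s p) \<partial>\<mu>) = (\<Sum>i<N. of_real ((cmod (b i))\<^sup>2))"
  proof -
    have int: "integrable \<mu> (\<lambda>p. b i * cnj (b j) * (cnj (\<phi> i p) * \<phi> j p))" for i j
      by (intro integrable_smooth smooth_functions_cmult smooth_functions_mult smooth_functions_cnj basis_smooth)
    have "(\<integral>p. s p * cnj (s p) \<partial>\<mu>) = (\<integral>p. (\<Sum>i<N. \<Sum>j<N. b i * cnj (b j) * (cnj (\<phi> i p) * \<phi> j p)) \<partial>\<mu>)"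
      by (simp add: s_def sum_product mult_ac)
    also have "\<dots> = (\<Sum>i<N. (\<integral>p. (\<Sum>j<N. b i * cnj (b j) * (cnj (\<phi> i p) * \<phi> j p)) \<partial>\<mu>))"
      by (intro Bochner_Integration.integral_sum Bochner_Integration.integrable_sum int)
    also have "\<dots> = (\<Sum>i<N. \<Sum>j<N. (\<integral>p. b i * cnj (b j) * (cnj (\<phi> i p) * \<phi> j p) \<partial>\<mu>))"
      by (intro sum.cong refl Bochner_Integration.integral_sum int)
    also have "\<dots> = (\<Sum>i<N. \<Sum>j<N. if i = j then b i * cnj (b i) else 0)"
      by (intro sum.cong refl) (simp add: basis_orthonormal')
    also have "\<dots> = (\<Sum>i<N. b i * cnj (b i))" by simp
    finally show ?thesis by (simp only: complex_norm_square)
  qed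
  have iss: "integrable \<mu> (\<lambda>p. s p * cnj (s p))"
    by (intro integrable_smooth smooth_functions_mult smooth_functions_cnj ss)
  have "(\<integral>p. of_real ((cmod (v p - s p))\<^sup>2) \<partial>\<mu>) = (\<integral>p. v p * cnj (v p) - cnj (s p) * v p - s p * cnj (v p) + s p * cnj (s p) \<partial>\<mu>)"
    unfolding complex_norm_square by (simp add: algebra_simps)
  also have "\<dots> = (\<integral>p. v p * cnj (v p) \<partial>\<mu>) - (\<integral>p. cnj (s p) * v p \<partial>\<mu>) - (\<integral>p. s p * cnj (v p) \<partial>\<mu>) + (\<integral>p. s p * cnj (s p) \<partial>\<mu>)"
    using ivv iv[OF smooth_functions_cnj[OF ss]] icv[OF ss] iss by simp
  also have "\<dots> = (\<integral>p. of_real ((cmod (v p))\<^sup>2) \<partial>\<mu>) - (\<Sum>i<N. of_real ((cmod (b i))\<^sup>2))"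
    unfolding sv sv' sss complex_norm_square by simp
  finally have "complex_of_real (\<integral>p. (cmod (v p - s p))\<^sup>2 \<partial>\<mu>) = of_real ((\<integral>p. (cmod (v p))\<^sup>2 \<partial>\<mu>) - (\<Sum>i<N. (cmod (b i))\<^sup>2))"
    by (simp only: integral_complex_of_real of_real_diff of_real_sum)
  then have "(\<integral>p. (cmod (v p - s p))\<^sup>2 \<partial>\<mu>) = (\<integral>p. (cmod (v p))\<^sup>2 \<partial>\<mu>) - (\<Sum>i<N. (cmod (b i))\<^sup>2)"
    using of_real_eq_iff by blast
  moreover have "(\<integral>p. (cmod (v p - s p))\<^sup>2 \<partial>\<mu>) \<ge> 0" by simp
  moreover have "(\<integral>p. (cmod (v p))\<^sup>2 \<partial>\<mu>) \<le> B\<^sup>2"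
  proof -
    have "(\<integral>p. (cmod (v p))\<^sup>2 \<partial>\<mu>) \<le> (\<integral>p. B\<^sup>2 \<partial>\<mu>)"
      using v by (intro integral_mono') (auto intro: power_mono)
    then show ?thesis by (simp add: prob_space)
  qed
  ultimately show ?thesis by (simp add: b_def)
qed

text \<open>All partial sums of the expansion of \<open>v\<close> are 0, so completeness of the
  basis forces its L^2 norm to vanish.\<close>

lemma AE_zero_if_coefficients_zero:
  assumes v: "v \<in> borel_measurable borel" "\<And>p. cmod (v p) \<le> B"
    and z: "\<And>i. (\<integral>p. cnj (\<phi> i p) * v p \<partial>\<mu>) = 0"
  shows "AE p in \<mu>. v p = 0"
proof -
  interpret prob_space \<mu> by (rule prob)
  have vm: "v \<in> borel_measurable \<mu>" using v(1) by (simp add: measurable_cong_sets[OF sets_mu refl])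
  have int: "integrable \<mu> (\<lambda>p. (cmod (v p))\<^sup>2)"
    using vm v(2) by (intro integrable_const_bound[of _ "B\<^sup>2"]) (auto intro!: power_mono AE_I2)
  then have "(\<lambda>N. \<integral>p. (cmod (v p - (\<Sum>i<N. (\<integral>q. v q * cnj (\<phi> i q) \<partial>\<mu>) * \<phi> i p)))\<^sup>2 \<partial>\<mu>) \<longlonglongrightarrow> 0"
    using laplace_eigenbasis vm unfolding laplace_eigenbasis_def by blast
  moreover have "(\<integral>q. v q * cnj (\<phi> i q) \<partial>\<mu>) = 0" for i using z[of i] by (simp add: mult.commute)
  ultimately have "(\<integral>p. (cmod (v p))\<^sup>2 \<partial>\<mu>) = 0" by (simp add: LIMSEQ_const_iff)
  then have "AE p in \<mu>. (cmod (v p))\<^sup>2 = 0" using integral_nonneg_eq_0_iff_AE[OF int] by auto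
  then show ?thesis by simp
qed

text \<open>The product of the cut-off and \<open>h\<close> in coordinates. Keeping the
  zero-extended cut-off as a factor of its own makes multiplication by it an operator of order 0 on
  the chart image.\<close>

definition localize :: "('m, 'n) chart \<Rightarrow> ('m \<Rightarrow> complex) \<Rightarrow> ('m \<Rightarrow> complex) \<Rightarrow> real^'n \<Rightarrow> complex" where
  "localize c \<rho> h x = (if x \<in> chart_img c then \<rho> (chart_inv c x) else 0) * h (chart_inv c x)"

lemma pull_localize:
  assumes "c \<in> A" "\<And>p. p \<notin> chart_dom c \<Longrightarrow> \<rho> p = 0"
  shows "pull c (localize c \<rho> h) p = \<rho> p * h p"
  using assms by (auto simp: pull_def localize_def chart_inv_map)

lemma localize_supp:
  assumes "c \<in> A" "\<And>p. \<not> (p \<in> chart_dom c \<and> chart_map c p \<in> C) \<Longrightarrow> \<rho> p = 0" "x \<notin> C"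
  shows "localize c \<rho> h x = 0"
  using assms by (auto simp: localize_def chart_map_inv)

lemma smooth_localized:
  assumes "c \<in> A" "\<rho> \<in> smooth_functions A"
  shows "smooth_on (chart_img c) (\<lambda>x. if x \<in> chart_img c then \<rho> (chart_inv c x) else 0)"
proof -
  have "smooth_on (chart_img c) (\<rho> \<circ> chart_inv c) \<longleftrightarrow>
      smooth_on (chart_img c) (\<lambda>x. if x \<in> chart_img c then \<rho> (chart_inv c x) else 0)"
    by (rule smooth_on_cong[OF open_chart_img[OF assms(1)]]) simp
  then show ?thesis using smooth_functionsD[OF assms(2,1)] by blast
qed

lemma smooth_localize:
  assumes "c \<in> A" "\<rho> \<in> smooth_functions A" "h \<in> smooth_functions A"
  shows "smooth_on (chart_img c) (localize c \<rho> h)"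
  unfolding localize_def[abs_def]
  using smooth_on_mult[OF open_chart_img[OF assms(1)] smooth_localized[OF assms(1,2)] smooth_functionsD[OF assms(3,1)]]
  by (simp add: comp_def)

lemma pull_measurable_bounded:
  assumes c: "c \<in> A" and C: "compact C" "C \<subseteq> chart_img c" and h: "smooth_on (chart_img c) h" "\<And>x. x \<notin> C \<Longrightarrow> h x = 0"
  shows "pull c h \<in> borel_measurable borel" "\<exists>B. \<forall>p. cmod (pull c h p) \<le> B"
proof -
  show "pull c h \<in> borel_measurable borel" by (rule measurable_pull[OF c smooth_on_continuous[OF h(1)]])
  have "compact (h ` C)"
    using smooth_on_continuous[OF h(1)] C compact_continuous_image continuous_on_subset by blast
  then obtain B where B: "B > 0" "\<And>x. x \<in> C \<Longrightarrow> cmod (h x) \<le> B"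
    using compact_imp_bounded bounded_pos by (metis imageI)
  have "cmod (pull c h p) \<le> B" for p
    using B h(2) by (cases "chart_map c p \<in> C") (auto simp: pull_def)
  then show "\<exists>B. \<forall>p. cmod (pull c h p) \<le> B" by blast
qed

text \<open>
  This is the divergence theorem for \<open>\<Delta>\<phi>\<^sub>i\<close> on all of \<open>M\<close>. Chart invariance of the Laplacian is avoided:
  the sum over the charts \<open>l\<close> of the local Laplacians of \<open>\<rho>\<^sub>l \<phi>\<^sub>i\<close> has the same coefficients as
  \<open>\<Delta>\<phi>\<^sub>i\<close>, so the two agree by completeness of the basis.
\<close>

lemma basis_mean_zero:
  assumes "i \<ge> 1"
  shows "(\<integral>p. \<phi> i p \<partial>\<mu>) = 0"
proof -
  interpret prob_space \<mu> by (rule prob)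
  obtain F where F: "ball_cover A F" using ex_ball_cover by blast
  obtain \<rho> where \<rho>: "\<And>l. l \<in> F \<Longrightarrow> \<rho> l \<in> smooth_functions A" "\<And>p. (\<Sum>l\<in>F. \<rho> l p) = 1"
    "\<And>c z r p. (c, z, r) \<in> F \<Longrightarrow> \<not> (p \<in> chart_dom c \<and> chart_map c p \<in> cball z r) \<Longrightarrow> \<rho> (c, z, r) p = 0"
    using ex_partition[OF F] by blast
  define v where "v l p = (case l of (c, z, r) \<Rightarrow> pull c (helmholtz c (localize c (\<rho> l) (\<phi> i))) p)" for l p
  have fin: "finite F" using F by (simp add: ball_cover_def)
  have loc: "v l \<in> borel_measurable borel \<and> (\<exists>B. \<forall>p. cmod (v l p) \<le> B) \<and>
     (\<forall>e \<kappa>. eigenfunction e \<kappa> \<longrightarrow> (\<integral>p. e p * v l p \<partial>\<mu>) = of_real (1 - \<kappa>) * (\<integral>p. e p * (\<rho> l p * \<phi> i p) \<partial>\<mu>))"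
    if l: "l \<in> F" for l
  proof -
    obtain c z r where lq: "l = (c, z, r)" by (cases l)
    have c: "c \<in> A" "cball z r \<subseteq> chart_img c" using F l lq unfolding ball_cover_def by auto
    have sup: "\<And>p. \<not> (p \<in> chart_dom c \<and> chart_map c p \<in> cball z r) \<Longrightarrow> \<rho> l p = 0" using \<rho>(3) l lq by auto
    let ?h = "localize c (\<rho> l) (\<phi> i)"
    have h: "smooth_on (chart_img c) ?h" "\<And>x. x \<notin> cball z r \<Longrightarrow> ?h x = 0"
      using smooth_localize[OF c(1) \<rho>(1)[OF l] basis_smooth] localize_supp[OF c(1), of "cball z r" "\<rho> l", OF sup] by auto
    have D: "smooth_on (chart_img c) (helmholtz c ?h)" "\<And>x. x \<notin> cball z r \<Longrightarrow> helmholtz c ?h x = 0"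
      using smooth_helmholtz_pow[OF c(1) h(1), of 1] helmholtz_supp[OF closed_cball h(2)] by auto
    have v: "v l = pull c (helmholtz c ?h)" by (auto simp: v_def lq)
    have p: "pull c ?h p = \<rho> l p * \<phi> i p" for p by (rule pull_localize[OF c(1)]) (use sup in blast)
    show ?thesis unfolding v
      using pull_measurable_bounded[OF c(1) compact_cball c(2) D] integral_helmholtz[OF _ c(1) compact_cball c(2) h]
      by (simp add: p)
  qed
  have int: "integrable \<mu> (\<lambda>p. e p * v l p)" if "e \<in> smooth_functions A" "l \<in> F" for e l
    using loc[OF that(2)] integrable_smooth_mult[OF _ _ that(1), of "v l"] by blast
  have total: "(\<integral>p. e p * (\<Sum>l\<in>F. v l p) \<partial>\<mu>) = of_real (1 - \<kappa>) * (\<integral>p. e p * \<phi> i p \<partial>\<mu>)" if e: "eigenfunction e \<kappa>" for e \<kappa>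
  proof -
    have es: "e \<in> smooth_functions A" using e by (simp add: eigenfunction_def)
    have "(\<integral>p. e p * (\<Sum>l\<in>F. v l p) \<partial>\<mu>) = (\<Sum>l\<in>F. (\<integral>p. e p * v l p \<partial>\<mu>))"
      unfolding sum_distrib_left by (rule Bochner_Integration.integral_sum[OF int[OF es]])
    also have "\<dots> = (\<Sum>l\<in>F. of_real (1 - \<kappa>) * (\<integral>p. e p * (\<rho> l p * \<phi> i p) \<partial>\<mu>))"
      using loc e by (intro sum.cong) auto
    also have "\<dots> = of_real (1 - \<kappa>) * (\<integral>p. (\<Sum>l\<in>F. e p * (\<rho> l p * \<phi> i p)) \<partial>\<mu>)"
      using \<rho>(1)
      by (subst Bochner_Integration.integral_sum)
        (auto simp: sum_distrib_left intro!: integrable_smooth smooth_functions_mult es basis_smooth)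
    also have "(\<lambda>p. (\<Sum>l\<in>F. e p * (\<rho> l p * \<phi> i p))) = (\<lambda>p. e p * \<phi> i p)"
      using \<rho>(2) by (simp flip: sum_distrib_left sum_distrib_right)
    finally show ?thesis .
  qed
  let ?k = "of_real (1 + (ev i)\<^sup>2) :: complex"
  \<comment> \<open>The defect between (1 - \<Delta>)\<phi>_i as assembled from the charts and its
    expected value.\<close>
  define w where "w p = (\<Sum>l\<in>F. v l p) - ?k * \<phi> i p" for p
  have vm: "(\<lambda>p. \<Sum>l\<in>F. v l p) \<in> borel_measurable borel" using loc by (intro borel_measurable_sum) auto
  obtain Bv where Bv: "\<And>l p. l \<in> F \<Longrightarrow> cmod (v l p) \<le> Bv l" using loc by metis
  have vb: "cmod (\<Sum>l\<in>F. v l p) \<le> (\<Sum>l\<in>F. Bv l)" for p by (rule sum_norm_le[OF Bv])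
  obtain B1 where B1: "\<And>p. cmod (\<phi> i p) \<le> B1"
    using bounded_continuous[OF continuous_smooth_function[OF basis_smooth]] by blast
  have wm: "w \<in> borel_measurable borel" unfolding w_def
    using vm borel_measurable_continuous_onI[OF continuous_smooth_function[OF basis_smooth[of i]]] by simp
  have wb: "cmod (w p) \<le> (\<Sum>l\<in>F. Bv l) + cmod ?k * B1" for p
  proof -
    have "cmod (w p) \<le> cmod (\<Sum>l\<in>F. v l p) + cmod (?k * \<phi> i p)" unfolding w_def by (rule norm_triangle_ineq4)
    also have "cmod (?k * \<phi> i p) \<le> cmod ?k * B1" unfolding norm_mult by (rule mult_left_mono[OF B1]) simp
    finally show ?thesis using vb[of p] by linarith
  qed
  have ew: "(\<integral>p. e p * w p \<partial>\<mu>) = of_real (1 - \<kappa>) * (\<integral>p. e p * \<phi> i p \<partial>\<mu>) - ?k * (\<integral>p. e p * \<phi> i p \<partial>\<mu>)"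
    if e: "eigenfunction e \<kappa>" for e \<kappa>
  proof -
    have es: "e \<in> smooth_functions A" using e by (simp add: eigenfunction_def)
    have "(\<integral>p. e p * w p \<partial>\<mu>) = (\<integral>p. e p * (\<Sum>l\<in>F. v l p) - ?k * (e p * \<phi> i p) \<partial>\<mu>)"
      by (simp add: w_def algebra_simps)
    also have "\<dots> = (\<integral>p. e p * (\<Sum>l\<in>F. v l p) \<partial>\<mu>) - (\<integral>p. ?k * (e p * \<phi> i p) \<partial>\<mu>)"
      by (intro Bochner_Integration.integral_diff integrable_smooth_mult[OF vm vb es] integrable_smooth
          smooth_functions_cmult smooth_functions_mult es basis_smooth)
    finally show ?thesis unfolding total[OF e] by simp
  qed
  \<comment> \<open>For k = i both terms carry the factor 1 + ev_i^2 and cancel; for other k both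
    vanish by orthogonality.\<close>
  have "(\<integral>p. cnj (\<phi> k p) * w p \<partial>\<mu>) = 0" for k
    using ew[OF eigenfunction_cnj[OF eigenfunction_basis[of k]]] by (simp add: basis_orthonormal')
  then have "AE p in \<mu>. w p = 0" by (rule AE_zero_if_coefficients_zero[OF wm wb])
  then have "(\<integral>p. 1 * w p \<partial>\<mu>) = 0" using integral_eq_zero_AE by simp
  \<comment> \<open>The constant 1 is an eigenfunction for 0, so testing the vanishing defect with
    it leaves (1 - \<open>?k\<close>) times the mean of \<phi>_i.\<close>
  then have "(1 - ?k) * (\<integral>p. \<phi> i p \<partial>\<mu>) = 0" using ew[OF eigenfunction_one] by (simp add: algebra_simps)
  moreover have "1 - ?k \<noteq> 0" using ev_pos[OF assms] by simp
  ultimately show ?thesis by simp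
qed

text \<open>Applying (1 - \<Delta>)^m to the localized function multiplies its i-th coefficient by
  (1 + ev_i^2)^m, and the result is bounded by the 2m-jet of \<open>h\<close>. Bessel's inequality
  for this bounded function is the claim, up to comparing the weights.\<close>

lemma sobolev_estimate_chart:
  assumes c: "c \<in> A" "cball z r \<subseteq> chart_img c"
    and \<rho>: "\<rho> \<in> smooth_functions A" "\<And>p. \<not> (p \<in> chart_dom c \<and> chart_map c p \<in> cball z r) \<Longrightarrow> \<rho> p = 0"
  shows "\<exists>C\<ge>0. \<forall>h M N. h \<in> smooth_functions A \<longrightarrow> M \<ge> 0 \<longrightarrow> (\<forall>x\<in>cball z r. jet_le (m * 2) (h \<circ> chart_inv c) x M) \<longrightarrow>
    (\<Sum>i<N. (1 + ev i) ^ (2 * m) * (cmod (\<integral>p. \<phi> i p * (\<rho> p * h p) \<partial>\<mu>))\<^sup>2) \<le> (C * M)\<^sup>2"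
proof -
  note V = open_chart_img[OF c(1)]
  let ?\<rho> = "\<lambda>x. if x \<in> chart_img c then \<rho> (chart_inv c x) else 0"
  have "order_le (chart_img c) (cball z r) (m * 2 + 0) (\<lambda>g. (helmholtz c ^^ m) (\<lambda>x. ?\<rho> x * g x))"
    by (rule order_le_compose[OF order_le_funpow[OF order_le_helmholtz[OF c(1) compact_cball c(2)]]
          order_le_bilinear[OF V compact_cball c(2) bounded_bilinear_mult smooth_localized[OF c(1) \<rho>(1)]]])
  then have "order_le (chart_img c) (cball z r) (m * 2) (\<lambda>g. (helmholtz c ^^ m) (\<lambda>x. ?\<rho> x * g x))"
    by simp
  then obtain C where C: "C \<ge> 0" "\<And>g x M. smooth_on (chart_img c) g \<Longrightarrow> x \<in> cball z r \<Longrightarrow> jet_le (m * 2) g x M \<Longrightarrow>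
      cmod ((helmholtz c ^^ m) (\<lambda>x. ?\<rho> x * g x) x) \<le> C * M"
    by (rule order_le_sup_bound) blast
  show ?thesis
  proof (intro exI[of _ "sqrt (2 ^ m) * C"] conjI allI impI)
    fix h M N assume hs: "h \<in> smooth_functions A" and M: "M \<ge> 0" and jet: "\<forall>x\<in>cball z r. jet_le (m * 2) (h \<circ> chart_inv c) x M"
    let ?g = "localize c \<rho> h"
    have g: "smooth_on (chart_img c) ?g" "\<And>x. x \<notin> cball z r \<Longrightarrow> ?g x = 0"
      using smooth_localize[OF c(1) \<rho>(1) hs] localize_supp[OF c(1), of "cball z r" \<rho>, OF \<rho>(2)] by auto
    define v where "v = pull c ((helmholtz c ^^ m) ?g)"
    have D: "smooth_on (chart_img c) ((helmholtz c ^^ m) ?g)" "\<And>x. x \<notin> cball z r \<Longrightarrow> (helmholtz c ^^ m) ?g x = 0"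
      using smooth_helmholtz_pow[OF c(1) g(1)] helmholtz_pow_supp[OF closed_cball g(2)] by auto
    have geq: "?g = (\<lambda>x. ?\<rho> x * (h \<circ> chart_inv c) x)" by (auto simp: localize_def)
    have vb: "cmod (v p) \<le> C * M" for p
    proof (cases "p \<in> chart_dom c \<and> chart_map c p \<in> cball z r")
      case True
      then show ?thesis
        using C(2)[OF smooth_functionsD[OF hs c(1)], of "chart_map c p" M] jet
        unfolding v_def pull_def geq by simp
    next
      case False
      then have "v p = 0" using D(2)[of "chart_map c p"] by (auto simp: v_def pull_def)
      then show ?thesis using C(1) M by simp
    qed
    have vm: "v \<in> borel_measurable borel" unfolding v_def by (rule pull_measurable_bounded(1)[OF c(1) compact_cball c(2) D])
    have coeff: "(\<integral>p. \<phi> i p * v p \<partial>\<mu>) = of_real ((1 + (ev i)\<^sup>2) ^ m) * (\<integral>p. \<phi> i p * (\<rho> p * h p) \<partial>\<mu>)" for i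
      using integral_helmholtz_pow[OF eigenfunction_basis[of i] c(1) compact_cball c(2) g, of m] pull_localize[OF c(1), of \<rho> h] \<rho>(2)
      by (simp add: v_def)
    have "(1 + ev i) ^ (2 * m) * (cmod (\<integral>p. \<phi> i p * (\<rho> p * h p) \<partial>\<mu>))\<^sup>2 \<le> 2 ^ m * (cmod (\<integral>p. \<phi> i p * v p \<partial>\<mu>))\<^sup>2" for i
    proof -
      let ?E = "1 + (ev i)\<^sup>2"
      \<comment> \<open>This comparison is the source of the constant 2^m. It bounds the weight by
        2^m \<open>?E\<close>^m, and \<open>?E\<close> \<ge> 1 raises that to 2^m
        \<open>?E\<close>^(2m), the square of the factor produced by (1 - \<Delta>)^m.\<close>
      have "(1 + ev i)\<^sup>2 \<le> 2 * ?E"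
        using sum_squares_bound[of 1 "ev i"] by (simp add: power2_eq_square algebra_simps)
      then have "((1 + ev i)\<^sup>2) ^ m \<le> (2 * ?E) ^ m" by (rule power_mono) simp
      also have "\<dots> = 2 ^ m * (?E ^ m * 1)" by (simp only: power_mult_distrib mult_1_right)
      also have "\<dots> \<le> 2 ^ m * (?E ^ m * ?E ^ m)" by (intro mult_left_mono one_le_power) auto
      finally have "(1 + ev i) ^ (2 * m) \<le> 2 ^ m * (?E ^ m)\<^sup>2" by (simp add: power_mult power2_eq_square)
      then have "(1 + ev i) ^ (2 * m) * (cmod (\<integral>p. \<phi> i p * (\<rho> p * h p) \<partial>\<mu>))\<^sup>2 \<le>
          2 ^ m * (?E ^ m)\<^sup>2 * (cmod (\<integral>p. \<phi> i p * (\<rho> p * h p) \<partial>\<mu>))\<^sup>2"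
        by (rule mult_right_mono) simp
      also have "\<dots> = 2 ^ m * (cmod (\<integral>p. \<phi> i p * v p \<partial>\<mu>))\<^sup>2"
      proof -
        have "cmod (of_real (?E ^ m)) = ?E ^ m" unfolding norm_of_real by simp
        then show ?thesis unfolding coeff norm_mult by (simp add: power_mult_distrib)
      qed
      finally show ?thesis .
    qed
    then have "(\<Sum>i<N. (1 + ev i) ^ (2 * m) * (cmod (\<integral>p. \<phi> i p * (\<rho> p * h p) \<partial>\<mu>))\<^sup>2) \<le>
        2 ^ m * (\<Sum>i<N. (cmod (\<integral>p. \<phi> i p * v p \<partial>\<mu>))\<^sup>2)"
      unfolding sum_distrib_left by (rule sum_mono)
    also have "\<dots> \<le> 2 ^ m * (C * M)\<^sup>2" by (intro mult_left_mono bessel[OF vm vb]) simp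
    also have "\<dots> = (sqrt (2 ^ m) * C * M)\<^sup>2" by (simp add: power_mult_distrib)
    finally show "(\<Sum>i<N. (1 + ev i) ^ (2 * m) * (cmod (\<integral>p. \<phi> i p * (\<rho> p * h p) \<partial>\<mu>))\<^sup>2) \<le> (sqrt (2 ^ m) * C * M)\<^sup>2" .
  qed (use C(1) in simp)
qed

lemma distribution_sum:
  assumes u: "distribution A u"
  shows "finite I \<Longrightarrow> (\<And>i. i \<in> I \<Longrightarrow> f i \<in> smooth_functions A) \<Longrightarrow> u (\<lambda>p. \<Sum>i\<in>I. f i p) = (\<Sum>i\<in>I. u (f i))"
proof (induction I rule: finite_induct)
  case empty
  have "\<forall>a. \<forall>\<psi>\<in>smooth_functions A. u (\<lambda>p. a * \<psi> p) = a * u \<psi>"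
    using u unfolding distribution_def by blast
  from bspec[OF spec[OF this, of 0] smooth_functions_const[of 1]] show ?case by simp
next
  case (insert x I)
  have add: "\<forall>\<psi>\<in>smooth_functions A. \<forall>\<psi>'\<in>smooth_functions A. u (\<lambda>p. \<psi> p + \<psi>' p) = u \<psi> + u \<psi>'"
    using u unfolding distribution_def by blast
  have "f x \<in> smooth_functions A" "(\<lambda>p. \<Sum>i\<in>I. f i p) \<in> smooth_functions A"
    using insert.prems by (auto intro: smooth_functions_sum)
  from bspec[OF bspec[OF add this(1)] this(2)]
  have "u (\<lambda>p. f x p + (\<Sum>i\<in>I. f i p)) = u (f x) + u (\<lambda>p. \<Sum>i\<in>I. f i p)" .
  then show ?case using insert by simp
qed

text \<open>A partition of unity splits \<open>h\<close> into localized pieces. For each piece,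
  Cauchy-Schwarz separates the coefficients of \<open>u\<close>, square summable with weight
  exponent -2\<sigma>, from those of the piece, controlled with exponent 2m \<ge> 2\<sigma>.\<close>

lemma sobolev_distribution_bound:
  assumes u: "u \<in> sobolev_dot A \<mu> ev \<phi> (- \<sigma>)" and m: "\<sigma> \<le> real m" and F: "ball_cover A F"
  shows "\<exists>C\<ge>0. \<forall>h M. h \<in> smooth_functions A \<longrightarrow> M \<ge> 0 \<longrightarrow>
     (\<forall>(c, z, r)\<in>F. \<forall>x\<in>cball z r. jet_le (m * 2) (h \<circ> chart_inv c) x M) \<longrightarrow> cmod (u h) \<le> C * M"
proof -
  obtain a where a: "has_expansion A \<mu> \<phi> u a" "summable (\<lambda>i. (1 + ev i) powr (2 * - \<sigma>) * (cmod (a i))\<^sup>2)"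
    and du: "distribution A u" using u unfolding sobolev_dot_def by blast
  obtain \<rho> where \<rho>: "\<And>l. l \<in> F \<Longrightarrow> \<rho> l \<in> smooth_functions A" "\<And>p. (\<Sum>l\<in>F. \<rho> l p) = 1"
    "\<And>c z r p. (c, z, r) \<in> F \<Longrightarrow> \<not> (p \<in> chart_dom c \<and> chart_map c p \<in> cball z r) \<Longrightarrow> \<rho> (c, z, r) p = 0"
    using ex_partition[OF F] by blast
  have fin: "finite F" using F by (simp add: ball_cover_def)
  define S where "S = (\<Sum>i. (1 + ev i) powr (2 * - \<sigma>) * (cmod (a i))\<^sup>2)"
  have S: "S \<ge> 0" unfolding S_def by (rule suminf_nonneg[OF a(2)]) simp
  have "\<exists>C\<ge>0. \<forall>h M. h \<in> smooth_functions A \<longrightarrow> M \<ge> 0 \<longrightarrow>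
     (\<forall>(c, z, r)\<in>F. \<forall>x\<in>cball z r. jet_le (m * 2) (h \<circ> chart_inv c) x M) \<longrightarrow> cmod (u (\<lambda>p. \<rho> l p * h p)) \<le> C * M"
    if l: "l \<in> F" for l
  proof -
    obtain c z r where lq: "l = (c, z, r)" by (cases l)
    have c: "c \<in> A" "cball z r \<subseteq> chart_img c" using F l lq unfolding ball_cover_def by auto
    have sup: "\<And>p. \<not> (p \<in> chart_dom c \<and> chart_map c p \<in> cball z r) \<Longrightarrow> \<rho> l p = 0" using \<rho>(3) l lq by auto
    obtain C where C: "C \<ge> 0" "\<And>h M N. h \<in> smooth_functions A \<Longrightarrow> M \<ge> 0 \<Longrightarrow> (\<forall>x\<in>cball z r. jet_le (m * 2) (h \<circ> chart_inv c) x M) \<Longrightarrow>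
      (\<Sum>i<N. (1 + ev i) ^ (2 * m) * (cmod (\<integral>p. \<phi> i p * (\<rho> l p * h p) \<partial>\<mu>))\<^sup>2) \<le> (C * M)\<^sup>2"
      using sobolev_estimate_chart[OF c \<rho>(1)[OF l] sup, of m] by blast
    show ?thesis
    proof (intro exI[of _ "sqrt S * C"] conjI allI impI)
      fix h M assume hs: "h \<in> smooth_functions A" and M: "M \<ge> 0"
        and jet: "\<forall>(c, z, r)\<in>F. \<forall>x\<in>cball z r. jet_le (m * 2) (h \<circ> chart_inv c) x M"
      have jet': "\<forall>x\<in>cball z r. jet_le (m * 2) (h \<circ> chart_inv c) x M" using jet l lq by auto
      let ?b = "\<lambda>i. \<integral>p. \<phi> i p * (\<rho> l p * h p) \<partial>\<mu>"
      have sums: "(\<lambda>i. a i * ?b i) sums u (\<lambda>p. \<rho> l p * h p)"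
        using bspec[OF a(1)[unfolded has_expansion_def] smooth_functions_mult[OF \<rho>(1)[OF l] hs]] .
      have part: "cmod (\<Sum>i<N. a i * ?b i) \<le> sqrt S * C * M" for N
      proof -
        \<comment> \<open>The weights with exponents -\<sigma> and \<sigma> cancel in the product,
          so Cauchy-Schwarz can be applied to the weighted factors.\<close>
        let ?x = "\<lambda>i. (1 + ev i) powr (- \<sigma>) * cmod (a i)" and ?y = "\<lambda>i. (1 + ev i) powr \<sigma> * cmod (?b i)"
        have pos: "1 + ev i > 0" for i using ev_nonneg[of i] by simp
        have "cmod (\<Sum>i<N. a i * ?b i) \<le> (\<Sum>i<N. cmod (a i) * cmod (?b i))"
          by (rule sum_norm_le) (simp add: norm_mult)
        also have "\<dots> = (\<Sum>i<N. ?x i * ?y i)"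
        proof (intro sum.cong refl)
          fix i
          have "(1 + ev i) powr (- \<sigma>) * (1 + ev i) powr \<sigma> = 1"
            using pos[of i] by (simp flip: powr_add)
          then show "cmod (a i) * cmod (?b i) = ?x i * ?y i" by (simp add: algebra_simps)
        qed
        finally have le: "cmod (\<Sum>i<N. a i * ?b i) \<le> (\<Sum>i<N. ?x i * ?y i)" .
        have "(\<Sum>i<N. ?x i * ?y i)\<^sup>2 \<le> (\<Sum>i<N. (?x i)\<^sup>2) * (\<Sum>i<N. (?y i)\<^sup>2)"
          by (rule Cauchy_Schwarz_ineq_sum)
        also have "\<dots> \<le> S * (C * M)\<^sup>2"
        proof (rule mult_mono[OF _ _ S])
          have "(\<Sum>i<N. (?x i)\<^sup>2) = (\<Sum>i<N. (1 + ev i) powr (2 * - \<sigma>) * (cmod (a i))\<^sup>2)"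
            by (intro sum.cong refl) (simp add: power_mult_distrib power2_eq_square flip: powr_add)
          also have "\<dots> \<le> S" unfolding S_def by (rule sum_le_suminf[OF a(2)]) auto
          finally show "(\<Sum>i<N. (?x i)\<^sup>2) \<le> S" .
          have "(?y i)\<^sup>2 \<le> (1 + ev i) ^ (2 * m) * (cmod (?b i))\<^sup>2" for i
          proof -
            have "((1 + ev i) powr \<sigma>)\<^sup>2 = (1 + ev i) powr (2 * \<sigma>)"
              by (simp add: power2_eq_square flip: powr_add)
            also have "\<dots> \<le> (1 + ev i) powr real (2 * m)"
              using m ev_nonneg[of i] by (intro powr_mono) auto
            also have "\<dots> = (1 + ev i) ^ (2 * m)" by (rule powr_realpow[OF pos])
            finally show ?thesis unfolding power_mult_distrib by (rule mult_right_mono) simp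
          qed
          then have "(\<Sum>i<N. (?y i)\<^sup>2) \<le> (\<Sum>i<N. (1 + ev i) ^ (2 * m) * (cmod (?b i))\<^sup>2)" by (rule sum_mono)
          also have "\<dots> \<le> (C * M)\<^sup>2" by (rule C(2)[OF hs M jet'])
          finally show "(\<Sum>i<N. (?y i)\<^sup>2) \<le> (C * M)\<^sup>2" .
        qed (simp add: sum_nonneg)
        also have "\<dots> = (sqrt S * C * M)\<^sup>2" using S by (simp add: power_mult_distrib)
        finally have "(\<Sum>i<N. ?x i * ?y i) \<le> sqrt S * C * M"
          by (rule power2_le_imp_le) (use S C(1) M in simp)
        then show ?thesis using le by linarith
      qed
      have "(\<lambda>N. cmod (\<Sum>i<N. a i * ?b i)) \<longlonglongrightarrow> cmod (u (\<lambda>p. \<rho> l p * h p))"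
        using sums unfolding sums_def by (rule tendsto_norm)
      then show "cmod (u (\<lambda>p. \<rho> l p * h p)) \<le> sqrt S * C * M"
        by (rule LIMSEQ_le_const2) (use part in auto)
    qed (use S C(1) in simp)
  qed
  then have "\<forall>l\<in>F. \<exists>C. C \<ge> 0 \<and> (\<forall>h M. h \<in> smooth_functions A \<longrightarrow> M \<ge> 0 \<longrightarrow>
     (\<forall>(c, z, r)\<in>F. \<forall>x\<in>cball z r. jet_le (m * 2) (h \<circ> chart_inv c) x M) \<longrightarrow> cmod (u (\<lambda>p. \<rho> l p * h p)) \<le> C * M)"
    by blast
  from bchoice[OF this] obtain C where C: "\<forall>l\<in>F. C l \<ge> 0 \<and> (\<forall>h M. h \<in> smooth_functions A \<longrightarrow> M \<ge> 0 \<longrightarrow>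
     (\<forall>(c, z, r)\<in>F. \<forall>x\<in>cball z r. jet_le (m * 2) (h \<circ> chart_inv c) x M) \<longrightarrow> cmod (u (\<lambda>p. \<rho> l p * h p)) \<le> C l * M)"
    by (elim exE)
  show ?thesis
  proof (intro exI[of _ "\<Sum>l\<in>F. C l"] conjI allI impI)
    fix h M assume h: "h \<in> smooth_functions A" "M \<ge> 0" "\<forall>(c, z, r)\<in>F. \<forall>x\<in>cball z r. jet_le (m * 2) (h \<circ> chart_inv c) x M"
    have "u h = u (\<lambda>p. \<Sum>l\<in>F. \<rho> l p * h p)" using \<rho>(2) by (simp flip: sum_distrib_right)
    also have "\<dots> = (\<Sum>l\<in>F. u (\<lambda>p. \<rho> l p * h p))"
      by (rule distribution_sum[OF du fin]) (intro smooth_functions_mult \<rho>(1) h(1))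
    also have "cmod \<dots> \<le> (\<Sum>l\<in>F. C l * M)" by (rule sum_norm_le) (use C h in blast)
    finally show "cmod (u h) \<le> (\<Sum>l\<in>F. C l) * M" by (simp add: sum_distrib_right)
  qed (use C in \<open>simp add: sum_nonneg\<close>)
qed

end

section \<open>The cohomological equation\<close>

context riemannian_setup
begin

lemma zero_mean_smooth: "\<psi> \<in> zero_mean_functions A \<mu> \<Longrightarrow> \<psi> \<in> smooth_functions A"
  and zero_mean_integral: "\<psi> \<in> zero_mean_functions A \<mu> \<Longrightarrow> (\<integral>p. \<psi> p \<partial>\<mu>) = 0"
  by (auto simp: zero_mean_functions_def)

lemma zero_mean_add: "f \<in> zero_mean_functions A \<mu> \<Longrightarrow> g \<in> zero_mean_functions A \<mu> \<Longrightarrow> (\<lambda>p. f p + g p) \<in> zero_mean_functions A \<mu>"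
  and zero_mean_cmult: "f \<in> zero_mean_functions A \<mu> \<Longrightarrow> (\<lambda>p. a * f p) \<in> zero_mean_functions A \<mu>"
  by (auto simp: zero_mean_functions_def smooth_functions_add smooth_functions_cmult integrable_smooth)

lemma Diff_mu_smooth: "f \<in> Diff_mu A \<mu> \<Longrightarrow> f \<in> smooth_maps A"
  by (simp add: Diff_mu_def)

lemma integral_Diff_mu:
  assumes f: "f \<in> Diff_mu A \<mu>" and g: "continuous_on UNIV (g :: 'm \<Rightarrow> complex)"
  shows "(\<integral>p. g (f p) \<partial>\<mu>) = (\<integral>p. g p \<partial>\<mu>)"
proof -
  have "continuous_on UNIV f" using f by (simp add: Diff_mu_def smooth_maps_def)
  then have fm: "f \<in> \<mu> \<rightarrow>\<^sub>M \<mu>"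
    using borel_measurable_continuous_onI measurable_cong_sets[OF sets_mu sets_mu] by blast
  have "(\<integral>p. g p \<partial>\<mu>) = (\<integral>p. g p \<partial>distr \<mu> \<mu> f)" using f by (simp add: Diff_mu_def)
  also have "\<dots> = (\<integral>p. g (f p) \<partial>\<mu>)" by (rule integral_distr[OF fm measurable_continuous[OF g]])
  finally show ?thesis by simp
qed

text \<open>
  The adjoint of \<open>\<psi> \<mapsto> \<psi> \<circ> f - \<psi>\<close> is the same operator for \<open>f\<^sup>-\<^sup>1\<close>, so solvability of
  the cohomological equation for \<open>\<eta>\<close> turns integration of \<open>\<psi>\<close> against \<open>\<eta>\<close> into integration of
  \<open>\<psi> \<circ> f - \<psi>\<close> against a fixed function.
\<close>

lemma CR_dual:
  assumes f: "f \<in> CR A \<mu>" and \<eta>: "\<eta> \<in> smooth_functions A"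
  shows "\<exists>\<xi>. continuous_on UNIV \<xi> \<and> (\<forall>\<psi>\<in>zero_mean_functions A \<mu>.
    (\<integral>p. \<psi> p * \<eta> p \<partial>\<mu>) = (\<integral>p. (\<psi> (f p) - \<psi> p) * \<xi> p \<partial>\<mu>))"
proof -
  interpret prob_space \<mu> by (rule prob)
  have fD: "f \<in> Diff_mu A \<mu>" and cob: "Cob A \<mu> f = zero_mean_functions A \<mu>" using f by (auto simp: CR_def)
  have fs: "f \<in> smooth_maps A" using Diff_mu_smooth[OF fD] .
  \<comment> \<open>Only zero-mean right-hand sides are solvable, so the mean of \<eta> is removed;
    the correction disappears at the end because \<psi> has zero mean.\<close>
  define t where "t = (\<integral>p. \<eta> p \<partial>\<mu>)"
  have "(\<lambda>p. \<eta> p - t) \<in> zero_mean_functions A \<mu>"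
    using \<eta> by (simp add: zero_mean_functions_def smooth_functions_diff smooth_functions_const t_def integrable_smooth prob_space)
  then have "(\<lambda>p. \<eta> p - t) \<in> Cob A \<mu> f" using cob by simp
  then obtain \<xi> where \<xi>: "\<xi> \<in> zero_mean_functions A \<mu>" "\<And>p. \<xi> (f p) - \<xi> p = \<eta> p - t"
    unfolding Cob_def by blast
  have sf: "(\<lambda>p. g (f p)) \<in> smooth_functions A" if "g \<in> smooth_functions A" for g
    using smooth_functions_compose[OF that fs] by (simp add: comp_def)
  show ?thesis
  \<comment> \<open>Invariance of \<mu> turns the integral of (\<psi>\<xi>) o f into that of
    \<psi>\<xi>. With this witness the right-hand side becomes the integral of \<psi> times \<xi> o
    f - \<xi>.\<close>
  proof (intro exI[of _ "\<lambda>p. - \<xi> (f p)"] conjI ballI)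
    show "continuous_on UNIV (\<lambda>p. - \<xi> (f p))"
      by (intro continuous_intros continuous_smooth_function sf zero_mean_smooth[OF \<xi>(1)])
    fix \<psi> assume \<psi>: "\<psi> \<in> zero_mean_functions A \<mu>"
    note s = zero_mean_smooth[OF \<psi>] zero_mean_smooth[OF \<xi>(1)]
    have int: "integrable \<mu> (\<lambda>p. \<psi> (f p) * \<xi> (f p))" "integrable \<mu> (\<lambda>p. \<psi> p * \<xi> (f p))" "integrable \<mu> (\<lambda>p. \<psi> p * \<xi> p)"
      "integrable \<mu> (\<lambda>p. \<psi> p * \<eta> p)" "integrable \<mu> (\<lambda>p. t * \<psi> p)"
      by (intro integrable_smooth smooth_functions_mult smooth_functions_const sf s \<eta>)+
    have "(\<integral>p. (\<psi> (f p) - \<psi> p) * - \<xi> (f p) \<partial>\<mu>) = (\<integral>p. \<psi> p * \<xi> (f p) - \<psi> (f p) * \<xi> (f p) \<partial>\<mu>)"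
      by (simp add: algebra_simps)
    also have "\<dots> = (\<integral>p. \<psi> p * \<xi> (f p) \<partial>\<mu>) - (\<integral>p. \<psi> p * \<xi> p \<partial>\<mu>)"
      using integral_Diff_mu[OF fD continuous_smooth_function[OF smooth_functions_mult[OF s]]] int by simp
    also have "\<dots> = (\<integral>p. \<psi> p * (\<xi> (f p) - \<xi> p) \<partial>\<mu>)"
      using int by (simp add: right_diff_distrib)
    also have "\<dots> = (\<integral>p. \<psi> p * \<eta> p - t * \<psi> p \<partial>\<mu>)" unfolding \<xi>(2) by (simp add: algebra_simps)
    also have "\<dots> = (\<integral>p. \<psi> p * \<eta> p \<partial>\<mu>)" using int zero_mean_integral[OF \<psi>] by simp
    finally show "(\<integral>p. \<psi> p * \<eta> p \<partial>\<mu>) = (\<integral>p. (\<psi> (f p) - \<psi> p) * - \<xi> (f p) \<partial>\<mu>)" by simp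
  qed
qed

text \<open>An approximate identity at \<open>p\<close>: bumps on shrinking coordinate balls, each
  divided by its mass. It converts statements about pairings with smooth functions into statements
  about point values.\<close>

lemma evaluation_as_limit:
  "\<exists>\<eta>. (\<forall>n. \<eta> n \<in> smooth_functions A) \<and>
     (\<forall>\<psi>\<in>smooth_functions A. (\<lambda>n. \<integral>q. \<psi> q * \<eta> n q \<partial>\<mu>) \<longlonglongrightarrow> \<psi> p)"
proof -
  obtain c where c: "c \<in> A" "p \<in> chart_dom c" using chart_at by blast
  let ?x = "chart_map c p"
  obtain r where r: "r > 0" "cball ?x r \<subseteq> chart_img c"
    using ex_chart_ball[OF open_UNIV UNIV_I c] by auto
  define s where "s n = r * inverse (real (Suc n))" for n
  have s: "s n > 0" "cball ?x (s n) \<subseteq> chart_img c" for n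
  proof -
    show "s n > 0" using r by (simp add: s_def)
    have "inverse (real (Suc n)) \<le> 1" by (simp add: field_simps)
    then have "s n \<le> r" using r mult_left_mono[of "inverse (real (Suc n))" 1 r] by (simp add: s_def)
    then show "cball ?x (s n) \<subseteq> chart_img c" using r(2) by (meson order_trans subset_cball)
  qed
  have s0: "s \<longlonglongrightarrow> 0" using tendsto_mult_right_zero[OF LIMSEQ_inverse_real_of_nat, of r] by (simp add: s_def[abs_def])
  let ?b = "\<lambda>n. chart_bump c ?x (s n)"
  have "\<exists>t. \<forall>n. t n > 0 \<and> (\<integral>q. ?b n q \<partial>\<mu>) = of_real (t n)"
    by (rule choice) (use integral_chart_bump_pos[OF c(1) s] in blast)
  then obtain t where t: "\<And>n. t n > 0" "\<And>n. (\<integral>q. ?b n q \<partial>\<mu>) = of_real (t n)" by blast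
  have bs: "?b n \<in> smooth_functions A" for n by (rule smooth_chart_bump[OF c(1) s])
  define \<eta> where "\<eta> n q = inverse (of_real (t n)) * ?b n q" for n q
  have \<eta>s: "\<eta> n \<in> smooth_functions A" for n unfolding \<eta>_def by (rule smooth_functions_cmult[OF bs])
  have \<eta>1: "(\<integral>q. \<eta> n q \<partial>\<mu>) = 1" for n
    using t(1)[of n] by (simp add: \<eta>_def t(2))
  \<comment> \<open>The bumps are nonnegative, so the L^1 norm equals the integral; this keeps the
    error bounded by the oscillation of the test function alone.\<close>
  have \<eta>n: "(\<integral>q. cmod (\<eta> n q) \<partial>\<mu>) = 1" for n
  proof -
    have "complex_of_real (cmod (\<eta> n q)) = \<eta> n q" for q
      using t(1)[of n] ball_bump_nonneg[of ?x "s n" "chart_map c q"]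
      by (simp add: \<eta>_def chart_bump_def norm_mult norm_inverse)
    then have "(\<integral>q. complex_of_real (cmod (\<eta> n q)) \<partial>\<mu>) = 1" using \<eta>1 by simp
    then show ?thesis by (simp only: integral_complex_of_real of_real_eq_1_iff)
  qed
  have "(\<lambda>n. \<integral>q. \<psi> q * \<eta> n q \<partial>\<mu>) \<longlonglongrightarrow> \<psi> p" if \<psi>: "\<psi> \<in> smooth_functions A" for \<psi>
  proof (rule LIMSEQ_I)
    fix \<epsilon> :: real assume \<epsilon>: "\<epsilon> > 0"
    have x: "?x \<in> chart_img c" using c by blast
    have "continuous (at ?x) (\<psi> \<circ> chart_inv c)"
      using smooth_on_continuous[OF smooth_functionsD[OF \<psi> c(1)]] open_chart_img[OF c(1)] x continuous_on_eq_continuous_at by blast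
    then obtain \<delta> where \<delta>: "\<delta> > 0" "\<And>y. dist y ?x < \<delta> \<Longrightarrow> dist ((\<psi> \<circ> chart_inv c) y) ((\<psi> \<circ> chart_inv c) ?x) < \<epsilon> / 2"
      using \<epsilon> half_gt_zero unfolding continuous_at_eps_delta by metis
    obtain n0 where n0: "\<And>n. n \<ge> n0 \<Longrightarrow> s n < \<delta>"
      using LIMSEQ_D[OF s0 \<delta>(1)] s(1) by (metis abs_of_pos diff_zero real_norm_def)
    show "\<exists>no. \<forall>n\<ge>no. norm ((\<integral>q. \<psi> q * \<eta> n q \<partial>\<mu>) - \<psi> p) < \<epsilon>"
    proof (intro exI[of _ n0] allI impI)
      fix n assume n: "n \<ge> n0"
      have pt: "cmod ((\<psi> q - \<psi> p) * \<eta> n q) \<le> \<epsilon> / 2 * cmod (\<eta> n q)" for q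
      proof (cases "q \<in> chart_dom c \<and> chart_map c q \<in> ball ?x (s n)")
        case True
        then have "dist (chart_map c q) ?x < \<delta>" using n0[OF n] by (simp add: dist_commute)
        from \<delta>(2)[OF this] have "cmod (\<psi> q - \<psi> p) < \<epsilon> / 2"
          using True c chart_inv_map[OF c(1)] by (simp add: dist_norm)
        then show ?thesis unfolding norm_mult by (intro mult_right_mono) auto
      next
        case False
        then have "\<eta> n q = 0" using ball_bump_eq_0[OF s(1)] by (auto simp: \<eta>_def chart_bump_def)
        then show ?thesis by simp
      qed
      have int: "integrable \<mu> (\<lambda>q. \<psi> q * \<eta> n q)" "integrable \<mu> (\<lambda>q. \<psi> p * \<eta> n q)" "integrable \<mu> (\<eta> n)"
        "integrable \<mu> (\<lambda>q. (\<psi> q - \<psi> p) * \<eta> n q)"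
        by (intro integrable_smooth smooth_functions_mult smooth_functions_diff smooth_functions_const \<psi> \<eta>s)+
      have "(\<integral>q. \<psi> q * \<eta> n q \<partial>\<mu>) - \<psi> p = (\<integral>q. \<psi> q * \<eta> n q \<partial>\<mu>) - (\<integral>q. \<psi> p * \<eta> n q \<partial>\<mu>)"
        using \<eta>1 by simp
      also have "\<dots> = (\<integral>q. (\<psi> q - \<psi> p) * \<eta> n q \<partial>\<mu>)"
        using int(1,2) by (simp add: left_diff_distrib)
      also have "cmod \<dots> \<le> (\<integral>q. cmod ((\<psi> q - \<psi> p) * \<eta> n q) \<partial>\<mu>)" by (rule integral_norm_bound)
      also have "\<dots> \<le> (\<integral>q. \<epsilon> / 2 * cmod (\<eta> n q) \<partial>\<mu>)"
        using int(3,4) pt by (intro integral_mono) auto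
      also have "\<dots> = \<epsilon> / 2" using \<eta>n by simp
      finally show "norm ((\<integral>q. \<psi> q * \<eta> n q \<partial>\<mu>) - \<psi> p) < \<epsilon>" using \<epsilon> by linarith
    qed
  qed
  then show ?thesis using \<eta>s by blast
qed

text \<open>By duality the pairing of a zero-mean solution with any smooth function depends only on
  the right-hand side, and pairings determine point values. Uniqueness is what makes the chosen
  solutions depend linearly on the right-hand side.\<close>

lemma CR_unique:
  assumes f: "f \<in> CR A \<mu>" and \<psi>: "\<psi> \<in> zero_mean_functions A \<mu>" "\<psi>' \<in> zero_mean_functions A \<mu>"
    and eq: "\<And>p. \<psi> (f p) - \<psi> p = \<psi>' (f p) - \<psi>' p"
  shows "\<psi> p = \<psi>' p"
proof -
  obtain \<eta> where \<eta>: "\<And>n. \<eta> n \<in> smooth_functions A"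
    "\<And>\<psi>. \<psi> \<in> smooth_functions A \<Longrightarrow> (\<lambda>n. \<integral>q. \<psi> q * \<eta> n q \<partial>\<mu>) \<longlonglongrightarrow> \<psi> p"
    using evaluation_as_limit[of p] by blast
  have "(\<integral>q. \<psi> q * \<eta> n q \<partial>\<mu>) = (\<integral>q. \<psi>' q * \<eta> n q \<partial>\<mu>)" for n
  proof -
    obtain \<xi> where "\<forall>\<psi>\<in>zero_mean_functions A \<mu>. (\<integral>p. \<psi> p * \<eta> n p \<partial>\<mu>) = (\<integral>p. (\<psi> (f p) - \<psi> p) * \<xi> p \<partial>\<mu>)"
      using CR_dual[OF f \<eta>(1)[of n]] by blast
    from bspec[OF this \<psi>(1)] bspec[OF this \<psi>(2)] show ?thesis using eq by simp
  qed
  then show ?thesis using \<eta>(2)[OF zero_mean_smooth[OF \<psi>(1)]] \<eta>(2)[OF zero_mean_smooth[OF \<psi>(2)]] LIMSEQ_unique by simp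
qed

end

text \<open>
  The weights make \<open>c \<mapsto> \<Sum>\<^sub>j c\<^sub>j e\<^sub>j\<close> map bounded sequences to smooth functions, so that the uniform
  boundedness principle can be applied on a Banach space instead of \<open>C\<^sup>\<infinity>(M)\<close>. They do not depend on
  the diffeomorphism.
\<close>

locale weighted_basis = riemannian_setup A \<omega> \<mu> G ev \<phi>
  for A :: "('m::{t2_space, second_countable_topology}, 'n::finite) chart set"
    and \<omega> \<mu> G ev \<phi> +
  fixes F :: "(('m, 'n) chart \<times> (real^'n) \<times> real) set"
    and w :: "nat \<Rightarrow> real" and N :: "nat \<Rightarrow> nat \<Rightarrow> real"
  assumes cover: "ball_cover A F"
    and w_pos: "w j > 0"
    and summable_N: "summable (N k)"
    and jet_weighted: "cover_jet_le F k (\<lambda>p. of_real (w j) * cnj (\<phi> (Suc j) p)) (N k j)"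

text \<open>A diagonal choice: the j-th weight tames the j-jet of the j-th function, hence its
  k-jets for all k \<le> j. For fixed k only finitely many j escape, so the bounds remain summable
  for every order.\<close>

lemma (in riemannian_setup) ex_weighted_basis:
  assumes F: "ball_cover A F"
  shows "\<exists>w N. weighted_basis A \<omega> \<mu> G ev \<phi> F w N"
proof -
  have sm: "(\<lambda>p. cnj (\<phi> (Suc j) p)) \<in> smooth_functions A" for j by (intro smooth_functions_cnj basis_smooth)
  define M where "M j k = (SOME M. M \<ge> 0 \<and> cover_jet_le F k (\<lambda>p. cnj (\<phi> (Suc j) p)) M)" for j k
  have "M j k \<ge> 0 \<and> cover_jet_le F k (\<lambda>p. cnj (\<phi> (Suc j) p)) (M j k)" for j k
    unfolding M_def by (rule someI_ex) (use ex_cover_jet_bound[OF F sm] in blast)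
  then have M: "\<And>j k. M j k \<ge> 0" "\<And>j k. cover_jet_le F k (\<lambda>p. cnj (\<phi> (Suc j) p)) (M j k)" by auto
  define w where "w j = (1 / 2) ^ j / (1 + M j j)" for j
  \<comment> \<open>For j < k the actual scaled bound is recorded; these finitely many terms do not
    affect summability.\<close>
  define N where "N k j = (if k \<le> j then (1 / 2) ^ j else w j * M j k)" for k j
  have w: "w j > 0" for j using M(1)[of j j] by (simp add: w_def add_pos_nonneg)
  have scale: "cover_jet_le F k (\<lambda>p. of_real (w j) * cnj (\<phi> (Suc j) p)) (w j * B)"
    if "cover_jet_le F k (\<lambda>p. cnj (\<phi> (Suc j) p)) B" for j k B
  proof (rule cover_jet_leI)
    fix c z r x assume l: "(c, z, r) \<in> F" and x: "x \<in> cball z r"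
    note cD = ball_coverD[OF F l]
    have xi: "x \<in> chart_img c" using cD(3) x by blast
    have "jet_le k (\<lambda>x. of_real (w j) * ((\<lambda>p. cnj (\<phi> (Suc j) p)) \<circ> chart_inv c) x) x (cmod (of_real (w j)) * B)"
      by (rule jet_le_cmult[OF open_chart_img[OF cD(1)] smooth_functionsD[OF sm cD(1)] xi cover_jet_leD[OF that l x]])
    then show "jet_le k ((\<lambda>p. of_real (w j) * cnj (\<phi> (Suc j) p)) \<circ> chart_inv c) x (w j * B)"
      using w[of j] by (simp add: comp_def)
  qed
  have "weighted_basis_axioms A \<phi> F w N"
  proof
    show "ball_cover A F" by (rule F)
    show "w j > 0" for j by (rule w)
    show "summable (N k)" for k
    proof -
      have "summable (\<lambda>j. (1 / 2 :: real) ^ j)" by (rule summable_geometric) simp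
      moreover have "\<forall>\<^sub>F j in sequentially. N k j = (1 / 2) ^ j"
        unfolding eventually_sequentially N_def by (intro exI[of _ k]) auto
      ultimately show ?thesis using summable_cong by blast
    qed
    show "cover_jet_le F k (\<lambda>p. of_real (w j) * cnj (\<phi> (Suc j) p)) (N k j)" for k j
    proof (cases "k \<le> j")
      case True
      have "M j j / (1 + M j j) \<le> 1" using M(1)[of j j] by (simp add: divide_simps)
      then have "(1 / 2) ^ j * (M j j / (1 + M j j)) \<le> (1 / 2) ^ j" by (rule mult_right_le_one_le[rotated 2]) (use M(1)[of j j] in auto)
      then have "w j * M j j \<le> (1 / 2) ^ j" by (simp add: w_def)
      then show ?thesis using cover_jet_le_mono[OF scale[OF M(2)[of j j]] True] True by (simp add: N_def)
    next
      case False
      then show ?thesis using scale[OF M(2)] by (simp add: N_def)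
    qed
  qed
  then show ?thesis unfolding weighted_basis_def using riemannian_setup_axioms by blast
qed

context weighted_basis
begin

text \<open>The shift to \<open>Suc j\<close> leaves only functions of zero mean, admissible as
  right-hand sides. The conjugate makes \<open>u\<close> of it a positive multiple of the
  coefficient of \<open>u\<close> at \<phi>_(j+1).\<close>

definition e :: "nat \<Rightarrow> 'm \<Rightarrow> complex" where
  "e j p = of_real (w j) * cnj (\<phi> (Suc j) p)"

lemma smooth_e: "e j \<in> smooth_functions A"
  unfolding e_def[abs_def] by (intro smooth_functions_cmult smooth_functions_cnj basis_smooth)

lemma jet_e: "cover_jet_le F k (e j) (N k j)"
  using jet_weighted[of k j] by (simp add: e_def[abs_def])

lemma norm_e_le: "cmod (e j p) \<le> N k j"
  by (rule cover_jet_le_norm[OF cover jet_e])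

lemma N_nonneg: "N k j \<ge> 0"
  using norm_e_le norm_ge_zero order_trans by blast

text \<open>
  A bounded sequence is the restriction to \<open>\<nat>\<close> of a bounded continuous function on \<open>\<real>\<close>: \<open>nat\<close> is not
  an instance of \<open>metric_space\<close>, which the completeness of \<open>bcontfun\<close> requires.
\<close>

definition comb :: "(real, real) bcontfun \<Rightarrow> 'm \<Rightarrow> complex" where
  "comb a p = (\<Sum>j. of_real (apply_bcontfun a (real j)) * e j p)"

lemma norm_comb_term: "cmod (of_real (apply_bcontfun a (real j)) * e j p) \<le> norm a * N 0 j"
  unfolding norm_mult using norm_bounded[of a "real j"] norm_e_le[of j p 0] by (intro mult_mono) auto

lemma summable_comb_bound: "summable (\<lambda>j. norm a * N k j)"
  by (rule summable_mult[OF summable_N])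

lemma summable_comb: "summable (\<lambda>j. of_real (apply_bcontfun a (real j)) * e j p)"
  by (rule summable_comparison_test'[OF summable_comb_bound[of a 0]]) (rule norm_comb_term)

lemma norm_comb: "cmod (comb a p) \<le> norm a * suminf (N 0)"
proof -
  have "cmod (comb a p) \<le> (\<Sum>j. norm a * N 0 j)"
    unfolding comb_def by (rule norm_suminf_le[OF norm_comb_term summable_comb_bound])
  then show ?thesis by (simp add: suminf_mult[OF summable_N])
qed

lemma comb_add: "comb (a + b) p = comb a p + comb b p"
  unfolding comb_def using suminf_add[OF summable_comb[of a p] summable_comb[of b p]]
  by (simp add: plus_bcontfun.rep_eq distrib_right)

lemma comb_scaleR: "comb (t *\<^sub>R a) p = of_real t * comb a p"
  unfolding comb_def using suminf_mult[OF summable_comb[of a p], of "of_real t"]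
  by (simp add: scaleR_bcontfun.rep_eq mult.assoc)

lemma smooth_comb: "comb a \<in> smooth_functions A"
proof (rule smooth_functionsI)
  fix p
  obtain c z r where l: "(c, z, r) \<in> F" "p \<in> chart_dom c" "chart_map c p \<in> ball z r" using ball_coverE[OF cover] .
  note c = ball_coverD[OF cover l(1)]
  have "smooth_on (ball z r) (\<lambda>x. \<Sum>j. of_real (apply_bcontfun a (real j)) * (e j \<circ> chart_inv c) x)"
  proof (rule smooth_on_suminf[where M = "\<lambda>k j. norm a * N k j"])
    have sub: "ball z r \<subseteq> chart_img c" using c(3) ball_subset_cball by blast
    have sj: "smooth_on (ball z r) (e j \<circ> chart_inv c)" for j
      by (rule smooth_on_subset[OF smooth_functionsD[OF smooth_e c(1)] sub])
    show "smooth_on (ball z r) (\<lambda>x. of_real (apply_bcontfun a (real j)) * (e j \<circ> chart_inv c) x)" for j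
      by (intro smooth_on_mult sj open_ball smooth_on_const)
    show "jet_le k (\<lambda>x. of_real (apply_bcontfun a (real j)) * (e j \<circ> chart_inv c) x) x (norm a * N k j)"
      if "x \<in> ball z r" for k j x
    proof -
      have "x \<in> cball z r" using that by simp
      from jet_le_cmult[OF open_ball sj that cover_jet_leD[OF jet_e l(1) this], where a = "of_real (apply_bcontfun a (real j))"]
      show ?thesis
        by (rule jet_le_mono[OF _ order_refl]) (use norm_bounded[of a "real j"] N_nonneg in \<open>auto intro: mult_right_mono\<close>)
    qed
    show "summable (\<lambda>j. norm a * N k j)" for k by (rule summable_comb_bound)
  qed auto
  then have "smooth_on (ball z r) (comb a \<circ> chart_inv c)" by (simp add: comb_def[abs_def] comp_def)
  then show "\<exists>c\<in>A. p \<in> chart_dom c \<and> (\<exists>W. open W \<and> chart_map c p \<in> W \<and> smooth_on W (comb a \<circ> chart_inv c))"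
    using c l by blast
qed

text \<open>Every term has zero mean. Sum and integral may be exchanged because the terms are
  dominated by a summable sequence of constants on a probability space.\<close>

lemma zero_mean_comb: "comb a \<in> zero_mean_functions A \<mu>"
proof -
  interpret prob_space \<mu> by (rule prob)
  have int: "integrable \<mu> (\<lambda>p. of_real (apply_bcontfun a (real j)) * e j p)" for j
    by (intro integrable_smooth smooth_functions_cmult smooth_e)
  have "(\<integral>p. comb a p \<partial>\<mu>) = (\<Sum>j. \<integral>p. of_real (apply_bcontfun a (real j)) * e j p \<partial>\<mu>)"
    unfolding comb_def
  proof (rule integral_suminf[OF int])
    show "AE p in \<mu>. summable (\<lambda>j. norm (of_real (apply_bcontfun a (real j)) * e j p))"
      by (intro AE_I2 summable_comparison_test'[OF summable_comb_bound[of a 0]]) (use norm_comb_term in simp)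
    show "summable (\<lambda>j. \<integral>p. norm (of_real (apply_bcontfun a (real j)) * e j p) \<partial>\<mu>)"
    proof (rule summable_comparison_test'[OF summable_comb_bound[of a 0]])
      fix j
      have "(\<integral>p. norm (of_real (apply_bcontfun a (real j)) * e j p) \<partial>\<mu>) \<le> (\<integral>p. norm a * N 0 j \<partial>\<mu>)"
        using int norm_comb_term by (intro integral_mono) auto
      then show "norm (\<integral>p. norm (of_real (apply_bcontfun a (real j)) * e j p) \<partial>\<mu>) \<le> norm a * N 0 j"
        by (simp add: prob_space)
    qed
  qed
  also have "\<dots> = 0" using basis_mean_zero by (simp add: e_def)
  finally show ?thesis using smooth_comb by (simp add: zero_mean_functions_def)
qed

text \<open>For rigid \<open>f\<close> the choice is the only possible one by
  \<open>CR_unique\<close>; hence the result is linear in \<open>a\<close>.\<close>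

definition solution :: "('m \<Rightarrow> 'm) \<Rightarrow> (real, real) bcontfun \<Rightarrow> 'm \<Rightarrow> complex" where
  "solution f a = (SOME \<psi>. \<psi> \<in> zero_mean_functions A \<mu> \<and> (\<forall>p. \<psi> (f p) - \<psi> p = comb a p))"

section \<open>Boundedness of the solution operator\<close>

context
  fixes f assumes f: "f \<in> CR A \<mu>"
begin

lemma solution: "solution f a \<in> zero_mean_functions A \<mu>" "solution f a (f p) - solution f a p = comb a p"
proof -
  have "comb a \<in> Cob A \<mu> f" using f zero_mean_comb by (auto simp: CR_def)
  then have "\<exists>\<psi>. \<psi> \<in> zero_mean_functions A \<mu> \<and> (\<forall>p. \<psi> (f p) - \<psi> p = comb a p)" by (auto simp: Cob_def)
  then have "solution f a \<in> zero_mean_functions A \<mu> \<and> (\<forall>p. solution f a (f p) - solution f a p = comb a p)"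
    unfolding solution_def by (rule someI_ex)
  then show "solution f a \<in> zero_mean_functions A \<mu>" "solution f a (f p) - solution f a p = comb a p" by auto
qed

lemma solution_add: "solution f (a + b) p = solution f a p + solution f b p"
proof (rule CR_unique[OF f solution(1) zero_mean_add[OF solution(1) solution(1)]])
  fix p
  have "solution f (a + b) (f p) - solution f (a + b) p =
      (solution f a (f p) - solution f a p) + (solution f b (f p) - solution f b p)"
    by (simp only: solution(2) comb_add)
  then show "solution f (a + b) (f p) - solution f (a + b) p =
      solution f a (f p) + solution f b (f p) - (solution f a p + solution f b p)"
    by (simp add: algebra_simps)
qed

lemma solution_scaleR: "solution f (t *\<^sub>R a) p = of_real t * solution f a p"
  by (rule CR_unique[OF f solution(1) zero_mean_cmult[OF solution(1)]])
    (simp add: solution(2) comb_scaleR flip: right_diff_distrib)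

text \<open>By \<open>CR_dual\<close> the pairing with \<eta> equals the integral of
  \<open>comb a\<close> against a fixed bounded function \<xi>, and \<open>comb a\<close> is bounded
  by a multiple of the norm of \<open>a\<close>.\<close>

lemma bounded_linear_pairing:
  assumes "\<eta> \<in> smooth_functions A"
  shows "bounded_linear (\<lambda>a. \<integral>p. solution f a p * \<eta> p \<partial>\<mu>)"
proof -
  interpret prob_space \<mu> by (rule prob)
  have int: "integrable \<mu> (\<lambda>p. solution f a p * \<eta> p)" for a
    by (intro integrable_smooth smooth_functions_mult assms zero_mean_smooth[OF solution(1)])
  obtain \<xi> where \<xi>: "continuous_on UNIV \<xi>" "\<And>\<psi>. \<psi> \<in> zero_mean_functions A \<mu> \<Longrightarrow>
    (\<integral>p. \<psi> p * \<eta> p \<partial>\<mu>) = (\<integral>p. (\<psi> (f p) - \<psi> p) * \<xi> p \<partial>\<mu>)" using CR_dual[OF f assms] by blast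
  obtain B where B: "B > 0" "\<And>p. cmod (\<xi> p) \<le> B" using bounded_continuous[OF \<xi>(1)] by blast
  have cc: "continuous_on UNIV (\<lambda>p. comb a p * \<xi> p)" for a
    by (intro continuous_intros \<xi>(1) continuous_smooth_function smooth_comb)
  show ?thesis
  proof (rule bounded_linear_intro[where K = "suminf (N 0) * B"])
    show "(\<integral>p. solution f (a + b) p * \<eta> p \<partial>\<mu>) = (\<integral>p. solution f a p * \<eta> p \<partial>\<mu>) + (\<integral>p. solution f b p * \<eta> p \<partial>\<mu>)" for a b
      using int by (simp add: solution_add distrib_right)
    show "(\<integral>p. solution f (t *\<^sub>R a) p * \<eta> p \<partial>\<mu>) = t *\<^sub>R (\<integral>p. solution f a p * \<eta> p \<partial>\<mu>)" for t a
      by (simp add: solution_scaleR mult.assoc scaleR_conv_of_real)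
    fix a
    have "norm (\<integral>p. solution f a p * \<eta> p \<partial>\<mu>) = norm (\<integral>p. comb a p * \<xi> p \<partial>\<mu>)"
      using \<xi>(2)[OF solution(1)] solution(2) by simp
    also have "\<dots> \<le> (\<integral>p. norm (comb a p * \<xi> p) \<partial>\<mu>)" by (rule integral_norm_bound)
    also have "\<dots> \<le> (\<integral>p. norm a * suminf (N 0) * B \<partial>\<mu>)"
    proof (intro integral_mono integrable_norm integrable_continuous cc)
      fix p
      show "norm (comb a p * \<xi> p) \<le> norm a * suminf (N 0) * B"
        unfolding norm_mult using norm_comb[of a p] B(2)[of p]
        by (intro mult_mono mult_nonneg_nonneg suminf_nonneg[OF summable_N N_nonneg]) auto
    qed simp
    also have "\<dots> = norm a * (suminf (N 0) * B)" by (simp add: prob_space)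
    finally show "norm (\<integral>p. solution f a p * \<eta> p \<partial>\<mu>) \<le> norm a * (suminf (N 0) * B)" .
  qed
qed

lemma bounded_linear_evaluation: "bounded_linear (\<lambda>a. solution f a p)"
proof -
  obtain \<eta> where \<eta>: "\<And>n. \<eta> n \<in> smooth_functions A"
    "\<And>\<psi>. \<psi> \<in> smooth_functions A \<Longrightarrow> (\<lambda>n. \<integral>q. \<psi> q * \<eta> n q \<partial>\<mu>) \<longlonglongrightarrow> \<psi> p"
    using evaluation_as_limit[of p] by blast
  show ?thesis
    by (rule bounded_linear_pointwise_limit[OF bounded_linear_pairing[OF \<eta>(1)] \<eta>(2)[OF zero_mean_smooth[OF solution(1)]]])
qed

text \<open>Evaluation is bounded linear, and each further derivative is a pointwise limit of
  difference quotients of functionals already known to be bounded linear.\<close>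

lemma bounded_linear_partials:
  assumes c: "c \<in> A"
  shows "x \<in> chart_img c \<Longrightarrow> bounded_linear (\<lambda>a. iter_partial is (solution f a \<circ> chart_inv c) x)"
proof (induction "is" arbitrary: x)
  case Nil
  then show ?case using bounded_linear_evaluation by (simp add: comp_def)
next
  case (Cons i "is")
  obtain \<epsilon> where \<epsilon>: "\<epsilon> > 0" "ball x \<epsilon> \<subseteq> chart_img c"
    using open_chart_img[OF c] Cons.prems open_contains_ball by blast
  \<comment> \<open>Discarding the first \<open>n0\<close> quotients keeps the shifted points inside
    the chart image, where the induction hypothesis applies.\<close>
  obtain n0 where n0: "inverse (real (Suc n0)) < \<epsilon>" using reals_Archimedean[OF \<epsilon>(1)] by blast
  let ?g = "\<lambda>a. iter_partial is (solution f a \<circ> chart_inv c)"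
  let ?q = "\<lambda>n a. real (Suc (n + n0)) *\<^sub>R (?g a (x + inverse (real (Suc (n + n0))) *\<^sub>R axis i 1) - ?g a x)"
  have "bounded_linear (\<lambda>a. partial_deriv i (?g a) x)"
  proof (rule bounded_linear_pointwise_limit)
    show "bounded_linear (?q n)" for n
    proof -
      have "inverse (real (Suc (n + n0))) \<le> inverse (real (Suc n0))" by (rule le_imp_inverse_le) auto
      then have "inverse (real (Suc (n + n0))) < \<epsilon>" using n0 by linarith
      then have "x + inverse (real (Suc (n + n0))) *\<^sub>R axis i 1 \<in> chart_img c"
        by (intro subsetD[OF \<epsilon>(2)]) (simp add: dist_norm del: of_nat_Suc)
      then show ?thesis
        by (intro bounded_linear_compose[OF bounded_linear_scaleR_right] bounded_linear_sub Cons.IH Cons.prems)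
    qed
    show "(\<lambda>n. ?q n a) \<longlonglongrightarrow> partial_deriv i (?g a) x" for a
    proof -
      have "?g a differentiable (at x)"
        by (rule smooth_on_differentiable[OF smooth_on_iter_partial[OF smooth_functionsD[OF zero_mean_smooth[OF solution(1)] c]] Cons.prems])
      from LIMSEQ_ignore_initial_segment[OF partial_deriv_tendsto[OF this, of i], of n0]
      show ?thesis .
    qed
  qed
  then show ?case unfolding iter_partial.simps .
qed

text \<open>For fixed \<open>a\<close> the solution is smooth, so its derivatives up to order k are
  bounded on the compact balls of the cover. Uniform boundedness makes the constant independent of
  \<open>a\<close> in the unit ball, and every e_j is the combination of such an
  \<open>a\<close>.\<close>

lemma CR_uniform_bound:
  "\<exists>C\<ge>0. \<forall>j. \<exists>\<psi>\<in>zero_mean_functions A \<mu>. (\<forall>p. \<psi> (f p) - \<psi> p = e j p) \<and> cover_jet_le F k \<psi> C"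
proof -
  define \<L> where "\<L> = {\<lambda>a. iter_partial is (solution f a \<circ> chart_inv c) x | is c z r x.
     length is \<le> k \<and> (c, z, r) \<in> F \<and> x \<in> cball z r}"
  have "\<exists>C\<ge>0. \<forall>l\<in>\<L>. \<forall>a. norm (l a) \<le> C * norm a"
  proof (rule uniform_boundedness)
    show "bounded_linear l" if "l \<in> \<L>" for l
      using that ball_coverD[OF cover] bounded_linear_partials unfolding \<L>_def by blast
    fix a
    obtain M where "cover_jet_le F k (solution f a) M"
      using ex_cover_jet_bound[OF cover zero_mean_smooth[OF solution(1)]] by blast
    then have "\<forall>l\<in>\<L>. norm (l a) \<le> M" unfolding \<L>_def using jet_leD cover_jet_leD by blast
    then show "\<exists>C. \<forall>l\<in>\<L>. norm (l a) \<le> C" by blast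
  qed
  then obtain C where C: "C \<ge> 0" "\<And>l a. l \<in> \<L> \<Longrightarrow> norm (l a) \<le> C * norm a" by blast
  have "\<exists>\<psi>\<in>zero_mean_functions A \<mu>. (\<forall>p. \<psi> (f p) - \<psi> p = e j p) \<and> cover_jet_le F k \<psi> C" for j
  proof -
    \<comment> \<open>A tent over \<open>j\<close> of height 1 that vanishes at all other integers:
      it encodes the j-th unit sequence and has norm at most 1.\<close>
    let ?hat = "\<lambda>x. max 0 (1 - \<bar>x - real j\<bar>)"
    define a where "a = Bcontfun ?hat"
    have "?hat \<in> bcontfun"
      by (rule bcontfun_normI[where b = 1]) (auto intro!: continuous_intros)
    then have hat: "apply_bcontfun a = ?hat" by (simp add: a_def Bcontfun_inverse)
    then have na: "norm a \<le> 1" by (intro norm_bound) auto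
    have a: "apply_bcontfun a (real i) = (if i = j then 1 else 0)" for i
      unfolding hat by (cases i j rule: linorder_cases) auto
    have "comb a p = (\<Sum>i. if i = j then e i p else 0)" for p
      unfolding comb_def a by (intro suminf_cong) auto
    then have ca: "comb a p = e j p" for p using sums_unique[OF sums_single[of j "\<lambda>i. e i p"]] by simp
    have "cover_jet_le F k (solution f a) C"
    proof (rule cover_jet_leI)
      fix c z r x assume l: "(c, z, r) \<in> F" "x \<in> cball z r"
      have "norm (iter_partial is (solution f a \<circ> chart_inv c) x) \<le> C" if "length is \<le> k" for "is"
      proof -
        have "(\<lambda>a. iter_partial is (solution f a \<circ> chart_inv c) x) \<in> \<L>" using that l unfolding \<L>_def by blast
        from C(2)[OF this, of a] show ?thesis using mult_left_mono[OF na C(1)] by linarith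
      qed
      then show "jet_le k (solution f a \<circ> chart_inv c) x C" by (simp add: jet_le_def)
    qed
    then show ?thesis using solution[of a] ca by (intro bexI[of _ "solution f a"]) auto
  qed
  then show ?thesis using C(1) by blast
qed

end

end

section \<open>Stability in the smooth topology and the meagre cover\<close>

context closed_manifold
begin

lemma openin_cinf_nbhd:
  assumes "c \<in> A" "d \<in> A" "compact K" "K \<subseteq> chart_dom c" "f \<in> smooth_maps A" "f ` K \<subseteq> chart_dom d" "\<epsilon> > 0"
  shows "openin (cinf_topology A) (cinf_nbhd A c d K k \<epsilon> f)"
  unfolding cinf_topology_def by (rule topology_generated_by_Basis) (use assms in blast)

text \<open>Jets of \<psi> are controlled only on the balls of the cover. So around \<open>x\<close>
  the images under \<open>f\<close> and under nearby \<open>g\<close> are kept in one closed ball of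
  the cover, where \<open>compose_stable\<close> applies. The neighbourhood depends on \<epsilon>
  and k but serves all \<psi> and \<open>M\<close>.\<close>

lemma local_stability:
  assumes F: "ball_cover A F" and f: "f \<in> smooth_maps A" and l: "(c, z, r) \<in> F" and x: "x \<in> cball z r" and \<epsilon>: "\<epsilon> > 0"
  shows "\<exists>s>0. \<exists>U. openin (cinf_topology A) U \<and> f \<in> U \<and> (\<forall>g\<in>U. g \<in> smooth_maps A \<longrightarrow>
    (\<forall>\<psi>\<in>smooth_functions A. \<forall>M\<ge>0. cover_jet_le F (Suc k) \<psi> M \<longrightarrow>
       (\<forall>y\<in>cball x s. jet_le k ((\<lambda>p. \<psi> (g p) - \<psi> (f p)) \<circ> chart_inv c) y (M * \<epsilon>))))"
proof -
  note c = ball_coverD[OF F l]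
  have xi: "x \<in> chart_img c" using c(3) x by blast
  let ?p = "chart_inv c x"
  obtain d z' r' where d: "(d, z', r') \<in> F" "f ?p \<in> chart_dom d" "chart_map d (f ?p) \<in> ball z' r'" using ball_coverE[OF F] .
  note dD = ball_coverD[OF F d(1)]
  let ?W = "\<lambda>g. chart_img c \<inter> chart_inv c -` (g -` chart_dom d)"
  let ?R = "local_rep c d"
  have W: "open (?W f)" by (rule open_local_rep_domain[OF f c(1) dD(1)])
  have sR: "smooth_on (?W f) (?R f)" by (rule smooth_on_local_rep[OF f c(1) dD(1)])
  have xW: "x \<in> ?W f" using xi d(2) by simp
  have Rx: "?R f x \<in> ball z' r'" using d(3) by (simp add: local_rep_def)
  \<comment> \<open>A radius strictly between that of the image of \<open>x\<close> and
    \<open>r'\<close>: \<open>f\<close> stays within it near \<open>x\<close>, and the remaining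
    margin absorbs the displacement from \<open>f\<close> to \<open>g\<close>.\<close>
  define r'' where "r'' = (dist z' (?R f x) + r') / 2"
  have r'': "dist z' (?R f x) < r''" "r'' < r'" using Rx by (auto simp: r''_def)
  have "open (?W f \<inter> ?R f -` ball z' r'')"
    by (rule continuous_open_preimage[OF smooth_on_continuous[OF sR] W open_ball])
  moreover have "x \<in> ?W f \<inter> ?R f -` ball z' r''" using xW r''(1) by simp
  ultimately obtain s where s: "s > 0" "cball x s \<subseteq> ?W f \<inter> ?R f -` ball z' r''"
    using open_contains_cball by blast
  let ?P = "cball x s"
  have PW: "?P \<subseteq> ?W f" using s by blast
  obtain B where B: "B \<ge> 0" "\<forall>y\<in>?P. jet_le k (?R f) y B"
    using smooth_on_jet_bound[OF sR compact_cball PW] by blast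
  have img: "?R g ` ?W g \<subseteq> chart_img d" for g using local_rep_eq(2)[OF dD(1)] by blast
  obtain C where C: "C \<ge> 0" "\<forall>(\<psi> :: real^'n \<Rightarrow> complex) G W' \<delta> M x.
     smooth_on (chart_img d) \<psi> \<and> (\<forall>y\<in>cball z' r'. jet_le (Suc k) \<psi> y M) \<and> M \<ge> 0 \<and> open W' \<and> smooth_on W' G \<and> G ` W' \<subseteq> chart_img d \<and>
     x \<in> ?P \<and> x \<in> W' \<and> ?R f x \<in> cball z' r' \<and> G x \<in> cball z' r' \<and> \<delta> \<le> 1 \<and>
     (\<forall>js. length js \<le> k \<longrightarrow> norm (iter_partial js G x - iter_partial js (?R f) x) \<le> \<delta>) \<longrightarrow>
     jet_le k (\<lambda>x. \<psi> (G x) - \<psi> (?R f x)) x (C * M * \<delta>)"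
    using compose_stable[OF convex_cball dD(3) W sR img PW B(2,1)] by blast
  \<comment> \<open>The three bounds serve the hypothesis \<delta> \<le> 1 of the composition
    estimate, the margin around the image of \<open>f\<close>, and the final error. The summand 1 in
    C + 1 avoids division by 0.\<close>
  define \<delta> where "\<delta> = min 1 (min (r' - r'') (\<epsilon> / (C + 1)))"
  have \<delta>: "\<delta> > 0" "\<delta> \<le> 1" "\<delta> \<le> r' - r''" "\<delta> \<le> \<epsilon> / (C + 1)" using r'' \<epsilon> C(1) by (auto simp: \<delta>_def)
  have C\<delta>: "C * \<delta> \<le> \<epsilon>"
  proof -
    have "C * \<delta> \<le> (C + 1) * \<delta>" using \<delta>(1) by (simp add: mult_right_mono)
    also have "\<dots> \<le> (C + 1) * (\<epsilon> / (C + 1))" using \<delta>(4) C(1) by (intro mult_left_mono) auto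
    also have "\<dots> = \<epsilon>" using C(1) by simp
    finally show ?thesis .
  qed
  let ?K = "chart_inv c ` ?P"
  define U where "U = cinf_nbhd A c d ?K k \<delta> f"
  have fK: "f ` ?K \<subseteq> chart_dom d" using PW by auto
  have U: "openin (cinf_topology A) U"
    unfolding U_def using PW chart_inv_dom[OF c(1)]
    by (intro openin_cinf_nbhd c(1) dD(1) compact_chart_inv compact_cball f fK \<delta>(1)) auto
  have fU: "f \<in> U" using f fK \<delta>(1) by (simp add: U_def cinf_nbhd_def)
  have main: "jet_le k ((\<lambda>p. \<psi> (g p) - \<psi> (f p)) \<circ> chart_inv c) y (M * \<epsilon>)"
    if g: "g \<in> U" and \<psi>: "\<psi> \<in> smooth_functions A" and M: "M \<ge> 0" "cover_jet_le F (Suc k) \<psi> M" and y: "y \<in> ?P" for g \<psi> M y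
  proof -
    have gs: "g \<in> smooth_maps A" and gK: "g ` ?K \<subseteq> chart_dom d"
      and near: "\<And>js. length js \<le> k \<Longrightarrow> norm (iter_partial js (?R g) (chart_map c (chart_inv c y)) - iter_partial js (?R f) (chart_map c (chart_inv c y))) < \<delta>"
      using g y by (auto simp: U_def cinf_nbhd_def)
    have yi: "y \<in> chart_img c" using y PW by blast
    have near': "norm (iter_partial js (?R g) y - iter_partial js (?R f) y) \<le> \<delta>" if "length js \<le> k" for js
      using near[OF that] chart_map_inv[OF c(1) yi] by simp
    have yf: "y \<in> ?W f" and yg: "y \<in> ?W g" using y PW gK yi by auto
    have Rf: "dist z' (?R f y) < r''" using s(2) y by auto
    have "dist z' (?R g y) \<le> dist z' (?R f y) + dist (?R f y) (?R g y)" by (rule dist_triangle)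
    also have "dist (?R f y) (?R g y) \<le> \<delta>" using near'[of "[]"] by (simp add: dist_norm norm_minus_commute)
    finally have Rg: "?R g y \<in> cball z' r'" using Rf \<delta>(3) by simp
    have Wg: "open (?W g)" by (rule open_local_rep_domain[OF gs c(1) dD(1)])
    have "jet_le k (\<lambda>x. (\<psi> \<circ> chart_inv d) (?R g x) - (\<psi> \<circ> chart_inv d) (?R f x)) y (C * M * \<delta>)"
      using cover_jet_leD[OF M(2) d(1)] Rf r''(2) y yg near'
      by (intro C(2)[rule_format, of "\<psi> \<circ> chart_inv d" M "?W g" "?R g"] conjI ballI allI impI smooth_functionsD[OF \<psi> dD(1)] M(1) Wg
          smooth_on_local_rep[OF gs c(1) dD(1)] img Rg \<delta>(2)) auto
    moreover have "C * M * \<delta> \<le> M * \<epsilon>" using mult_left_mono[OF C\<delta> M(1)] by (simp add: mult_ac)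
    ultimately have jet: "jet_le k (\<lambda>x. (\<psi> \<circ> chart_inv d) (?R g x) - (\<psi> \<circ> chart_inv d) (?R f x)) y (M * \<epsilon>)"
      using jet_le_mono by blast
    have "((\<lambda>p. \<psi> (g p) - \<psi> (f p)) \<circ> chart_inv c) y' = (\<psi> \<circ> chart_inv d) (?R g y') - (\<psi> \<circ> chart_inv d) (?R f y')"
      if "y' \<in> ?W f \<inter> ?W g" for y'
      using local_rep_eq(1)[OF dD(1), of y' c g \<psi>] local_rep_eq(1)[OF dD(1), of y' c f \<psi>] that by simp
    then show ?thesis
      using jet jet_le_cong[OF open_Int[OF W Wg] IntI[OF yf yg], of "(\<lambda>p. \<psi> (g p) - \<psi> (f p)) \<circ> chart_inv c"
        "\<lambda>y. (\<psi> \<circ> chart_inv d) (?R g y) - (\<psi> \<circ> chart_inv d) (?R f y)"] by blast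
  qed
  show ?thesis using s(1) U fU main by blast
qed

text \<open>Each compact ball of the finite cover is covered by finitely many of the small balls on
  which \<open>local_stability\<close> holds, so a finite intersection of the corresponding
  neighbourhoods works everywhere.\<close>

lemma stability:
  assumes F: "ball_cover A F" and f: "f \<in> smooth_maps A" "f \<in> topspace (cinf_topology A)" and \<epsilon>: "\<epsilon> > 0"
  shows "\<exists>U. openin (cinf_topology A) U \<and> f \<in> U \<and> (\<forall>g\<in>U. g \<in> smooth_maps A \<longrightarrow>
    (\<forall>\<psi>\<in>smooth_functions A. \<forall>M\<ge>0. cover_jet_le F (Suc k) \<psi> M \<longrightarrow> cover_jet_le F k (\<lambda>p. \<psi> (g p) - \<psi> (f p)) (M * \<epsilon>)))"
proof -
  define good where "good c y g \<longleftrightarrow> (g \<in> smooth_maps A \<longrightarrow> (\<forall>\<psi>\<in>smooth_functions A. \<forall>M\<ge>0. cover_jet_le F (Suc k) \<psi> M \<longrightarrow>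
       jet_le k ((\<lambda>p. \<psi> (g p) - \<psi> (f p)) \<circ> chart_inv c) y (M * \<epsilon>)))" for c :: "('m, 'n) chart" and y g
  have fin: "finite F" using F by (simp add: ball_cover_def)
  have "\<forall>l\<in>F. \<exists>U. openin (cinf_topology A) U \<and> f \<in> U \<and> (\<forall>c z r. l = (c, z, r) \<longrightarrow> (\<forall>g\<in>U. \<forall>y\<in>cball z r. good c y g))"
  proof
    fix l assume "l \<in> F"
    obtain c z r where lq: "l = (c, z, r)" by (cases l)
    have l: "(c, z, r) \<in> F" using \<open>l \<in> F\<close> lq by simp
    have "\<forall>x\<in>cball z r. \<exists>sU. fst sU > 0 \<and> openin (cinf_topology A) (snd sU) \<and> f \<in> snd sU \<and> (\<forall>g\<in>snd sU. \<forall>y\<in>cball x (fst sU). good c y g)"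
    proof
      fix x assume x: "x \<in> cball z r"
      obtain s U where "s > 0" "openin (cinf_topology A) U" "f \<in> U" "\<forall>g\<in>U. g \<in> smooth_maps A \<longrightarrow>
        (\<forall>\<psi>\<in>smooth_functions A. \<forall>M\<ge>0. cover_jet_le F (Suc k) \<psi> M \<longrightarrow>
         (\<forall>y\<in>cball x s. jet_le k ((\<lambda>p. \<psi> (g p) - \<psi> (f p)) \<circ> chart_inv c) y (M * \<epsilon>)))"
        using local_stability[OF F f(1) l x \<epsilon>] by blast
      then show "\<exists>sU. fst sU > 0 \<and> openin (cinf_topology A) (snd sU) \<and> f \<in> snd sU \<and> (\<forall>g\<in>snd sU. \<forall>y\<in>cball x (fst sU). good c y g)"
        unfolding good_def by (intro exI[of _ "(s, U)"]) auto
    qed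
    from bchoice[OF this] obtain sU where sU: "\<forall>x\<in>cball z r. fst (sU x) > 0 \<and> openin (cinf_topology A) (snd (sU x)) \<and>
        f \<in> snd (sU x) \<and> (\<forall>g\<in>snd (sU x). \<forall>y\<in>cball x (fst (sU x)). good c y g)" by (elim exE)
    obtain T where T: "T \<subseteq> cball z r" "finite T" "cball z r \<subseteq> (\<Union>x\<in>T. ball x (fst (sU x)))"
    proof (rule compactE_image[OF compact_cball[of z r], of "cball z r" "\<lambda>x. ball x (fst (sU x))"])
      show "cball z r \<subseteq> (\<Union>x\<in>cball z r. ball x (fst (sU x)))" using sU by force
    qed auto
    let ?U = "(\<Inter>x\<in>T. snd (sU x)) \<inter> topspace (cinf_topology A)"
    have "openin (cinf_topology A) ?U" by (rule openin_INT[OF T(2)]) (use sU T(1) in blast)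
    moreover have "f \<in> ?U" using sU T(1) f(2) by blast
    moreover have "good c y g" if g: "g \<in> ?U" and y: "y \<in> cball z r" for g y
    proof -
      obtain x where x: "x \<in> T" "y \<in> ball x (fst (sU x))" using T(3) y by blast
      then have "y \<in> cball x (fst (sU x))" using ball_subset_cball by blast
      then show ?thesis using sU x(1) g T(1) by blast
    qed
    ultimately show "\<exists>U. openin (cinf_topology A) U \<and> f \<in> U \<and> (\<forall>c z r. l = (c, z, r) \<longrightarrow> (\<forall>g\<in>U. \<forall>y\<in>cball z r. good c y g))"
      using lq by (intro exI[of _ ?U]) auto
  qed
  from bchoice[OF this] obtain U where U: "\<forall>l\<in>F. openin (cinf_topology A) (U l) \<and> f \<in> U l \<and>
      (\<forall>c z r. l = (c, z, r) \<longrightarrow> (\<forall>g\<in>U l. \<forall>y\<in>cball z r. good c y g))" by (elim exE)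
  let ?U = "(\<Inter>l\<in>F. U l) \<inter> topspace (cinf_topology A)"
  have "openin (cinf_topology A) ?U" by (rule openin_INT[OF fin]) (use U in blast)
  moreover have "f \<in> ?U" using U f(2) by blast
  moreover have "cover_jet_le F k (\<lambda>p. \<psi> (g p) - \<psi> (f p)) (M * \<epsilon>)"
    if g: "g \<in> ?U" "g \<in> smooth_maps A" and \<psi>: "\<psi> \<in> smooth_functions A" and M: "M \<ge> 0" "cover_jet_le F (Suc k) \<psi> M" for g \<psi> M
  proof (rule cover_jet_leI)
    fix c z r y assume l: "(c, z, r) \<in> F" "y \<in> cball z r"
    have "\<forall>g\<in>U (c, z, r). \<forall>y\<in>cball z r. good c y g" using bspec[OF U l(1)] by simp
    moreover have "g \<in> U (c, z, r)" using g(1) l(1) by blast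
    ultimately have "good c y g" using l(2) by blast
    then show "jet_le k ((\<lambda>p. \<psi> (g p) - \<psi> (f p)) \<circ> chart_inv c) y (M * \<epsilon>)"
      using g(2) \<psi> M unfolding good_def by blast
  qed
  ultimately show ?thesis by blast
qed

end

context weighted_basis
begin

lemma expansion_coefficient:
  assumes "has_expansion A \<mu> \<phi> u a"
  shows "u (\<lambda>p. cnj (\<phi> i p)) = a i"
proof -
  have "(\<lambda>k. a k * (\<integral>p. \<phi> k p * cnj (\<phi> i p) \<partial>\<mu>)) sums u (\<lambda>p. cnj (\<phi> i p))"
    using bspec[OF assms[unfolded has_expansion_def] smooth_functions_cnj[OF basis_smooth[of i]]] .
  moreover have "(\<lambda>k. a k * (\<integral>p. \<phi> k p * cnj (\<phi> i p) \<partial>\<mu>)) = (\<lambda>k. if k = i then a k else 0)"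
    by (auto simp: basis_orthonormal)
  ultimately show ?thesis using sums_single[of i a] sums_unique2 by metis
qed

lemma H_dot_separated:
  assumes f: "f \<in> H_dot A \<mu> ev \<phi> (- \<sigma>)" and m: "\<sigma> \<le> real m" and top: "f \<in> topspace (cinf_topology A)" and n: "n \<ge> 0"
  shows "\<exists>U. openin (cinf_topology A) U \<and> f \<in> U \<and> (\<forall>g\<in>U. g \<in> smooth_maps A \<longrightarrow>
     \<not> (\<forall>j. \<exists>\<psi>\<in>zero_mean_functions A \<mu>. (\<forall>p. \<psi> (g p) - \<psi> p = e j p) \<and> cover_jet_le F (Suc (m * 2)) \<psi> n))"
proof -
  obtain u where u: "u \<in> sobolev_dot A \<mu> ev \<phi> (- \<sigma>)" "\<exists>\<psi>\<in>smooth_functions A. u \<psi> \<noteq> 0" "preserves_distribution A f u"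
    and fD: "f \<in> Diff_mu A \<mu>" using f unfolding H_dot_def by blast
  obtain a where a: "has_expansion A \<mu> \<phi> u a" "a 0 = 0" and du: "distribution A u"
    using u(1) unfolding sobolev_dot_def by blast
  have cm: "\<forall>a. \<forall>\<psi>\<in>smooth_functions A. u (\<lambda>p. a * \<psi> p) = a * u \<psi>" using du unfolding distribution_def by blast
  have add: "\<forall>\<psi>\<in>smooth_functions A. \<forall>\<psi>'\<in>smooth_functions A. u (\<lambda>p. \<psi> p + \<psi>' p) = u \<psi> + u \<psi>'"
    using du unfolding distribution_def by blast
  have diff: "u (\<lambda>p. \<psi> p - \<psi>' p) = u \<psi> - u \<psi>'" if "\<psi> \<in> smooth_functions A" "\<psi>' \<in> smooth_functions A" for \<psi> \<psi>'
    using bspec[OF bspec[OF add that(1)] smooth_functions_cmult[OF that(2), of "-1"]] bspec[OF spec[OF cm, of "-1"] that(2)] by simp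
  have "\<exists>i. a i \<noteq> 0"
  proof (rule ccontr)
    assume "\<not> (\<exists>i. a i \<noteq> 0)"
    then have "u \<psi> = 0" if "\<psi> \<in> smooth_functions A" for \<psi>
      using bspec[OF a(1)[unfolded has_expansion_def] that] sums_unique2[OF _ sums_zero] by auto
    then show False using u(2) by blast
  qed
  \<comment> \<open>As \<open>a 0\<close> is 0, the non-zero coefficient has positive index, so it
    is seen by one of the e_j.\<close>
  then obtain j where j: "a (Suc j) \<noteq> 0" using a(2) by (metis not0_implies_Suc)
  have ue: "u (e j) = of_real (w j) * a (Suc j)"
    using bspec[OF spec[OF cm, of "of_real (w j)"] smooth_functions_cnj[OF basis_smooth[of "Suc j"]]]
      expansion_coefficient[OF a(1), of "Suc j"] by (simp add: e_def[abs_def])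
  obtain C where C: "C \<ge> 0" "\<And>h M. h \<in> smooth_functions A \<Longrightarrow> M \<ge> 0 \<Longrightarrow> cover_jet_le F (m * 2) h M \<Longrightarrow> cmod (u h) \<le> C * M"
    using sobolev_distribution_bound[OF u(1) m cover] unfolding cover_jet_le_def by blast
  define t where "t = cmod (u (e j))"
  have t: "t > 0" using j w_pos[of j] by (simp add: t_def ue)
  \<comment> \<open>Chosen so that C n \<epsilon> stays below \<open>t\<close>; the added 1 keeps
    the denominator positive when C n = 0.\<close>
  define \<epsilon> where "\<epsilon> = t / (2 * (C * n + 1))"
  have Cn: "C * n \<ge> 0" using C(1) n by simp
  have \<epsilon>: "\<epsilon> > 0" using t Cn by (simp add: \<epsilon>_def)
  have small: "C * (n * \<epsilon>) < t"
  proof -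
    have "C * n < 2 * (C * n + 1)" using Cn by simp
    then have "C * n / (2 * (C * n + 1)) < 1" using Cn by simp
    then have "C * n / (2 * (C * n + 1)) * t < 1 * t" using t by (rule mult_strict_right_mono)
    then show ?thesis by (simp add: \<epsilon>_def mult.assoc)
  qed
  obtain U where U: "openin (cinf_topology A) U" "f \<in> U" "\<forall>g\<in>U. g \<in> smooth_maps A \<longrightarrow>
    (\<forall>\<psi>\<in>smooth_functions A. \<forall>M\<ge>0. cover_jet_le F (Suc (m * 2)) \<psi> M \<longrightarrow> cover_jet_le F (m * 2) (\<lambda>p. \<psi> (g p) - \<psi> (f p)) (M * \<epsilon>))"
    using stability[OF cover Diff_mu_smooth[OF fD] top \<epsilon>, of "m * 2"] by blast
  have False if g: "g \<in> U" "g \<in> smooth_maps A" and \<psi>: "\<psi> \<in> zero_mean_functions A \<mu>"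
    "\<And>p. \<psi> (g p) - \<psi> p = e j p" "cover_jet_le F (Suc (m * 2)) \<psi> n" for g \<psi>
  proof -
    note s = zero_mean_smooth[OF \<psi>(1)]
    have sg: "\<psi> \<circ> g \<in> smooth_functions A" and sf: "\<psi> \<circ> f \<in> smooth_functions A"
      using smooth_functions_compose[OF s] g(2) Diff_mu_smooth[OF fD] by auto
    have "u (\<lambda>p. (\<psi> \<circ> g) p - (\<psi> \<circ> f) p) = u (\<psi> \<circ> g) - u \<psi>"
      using diff[OF sg sf] u(3) s unfolding preserves_distribution_def by simp
    also have "\<dots> = u (\<lambda>p. (\<psi> \<circ> g) p - \<psi> p)" using diff[OF sg s] by simp
    also have "(\<lambda>p. (\<psi> \<circ> g) p - \<psi> p) = e j" using \<psi>(2) by auto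
    finally have "t = cmod (u (\<lambda>p. (\<psi> \<circ> g) p - (\<psi> \<circ> f) p))" by (simp add: t_def)
    also have "\<dots> \<le> C * (n * \<epsilon>)"
      by (rule C(2)[OF smooth_functions_diff[OF sg sf]]) (use U(3) g s n \<psi>(3) \<epsilon> in \<open>auto simp: comp_def\<close>)
    finally show False using small by simp
  qed
  then show ?thesis using U(1,2) by blast
qed

lemma CR_meagre:
  assumes S: "S \<subseteq> topspace (cinf_topology A)" "S \<subseteq> Diff_mu A \<mu>"
    and dense: "subtopology (cinf_topology A) S closure_of (H_dot A \<mu> ev \<phi> (- \<sigma>) \<inter> S) = S"
  shows "meagre_in (subtopology (cinf_topology A) S) (CR A \<mu> \<inter> S)"
proof -
  let ?X = "subtopology (cinf_topology A) S"
  have topX: "topspace ?X = S" using S(1) by (auto simp: topspace_subtopology)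
  obtain m where m: "\<sigma> \<le> real m" using real_arch_simple by blast
  \<comment> \<open>The distribution is bounded by jets of order 2m and stability loses one
    derivative, which gives the order \<open>Suc (m * 2)\<close>. The real \<sigma> enters only
    through the integer \<open>m\<close> above it, so the sets are the same for all distributions
    considered.\<close>
  define B where "B n = {f \<in> CR A \<mu> \<inter> S. \<forall>j. \<exists>\<psi>\<in>zero_mean_functions A \<mu>.
      (\<forall>p. \<psi> (f p) - \<psi> p = e j p) \<and> cover_jet_le F (Suc (m * 2)) \<psi> (real n)}" for n :: nat
  have "CR A \<mu> \<inter> S \<subseteq> (\<Union>n. B n)"
  proof
    fix f assume f: "f \<in> CR A \<mu> \<inter> S"
    obtain C where C: "\<forall>j. \<exists>\<psi>\<in>zero_mean_functions A \<mu>. (\<forall>p. \<psi> (f p) - \<psi> p = e j p) \<and> cover_jet_le F (Suc (m * 2)) \<psi> C"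
      using CR_uniform_bound[of f "Suc (m * 2)"] f by blast
    obtain n where "C \<le> real n" using real_arch_simple by blast
    then have "f \<in> B n" using C f cover_jet_le_mono[OF _ order_refl] unfolding B_def by blast
    then show "f \<in> (\<Union>n. B n)" by blast
  qed
  then have eq: "CR A \<mu> \<inter> S = (\<Union>n. B n)" by (auto simp: B_def)
  have "nowhere_dense_in ?X (B n)" for n
    unfolding nowhere_dense_in_def
  proof (intro conjI)
    show "B n \<subseteq> topspace ?X" unfolding topX B_def by blast
    show "?X interior_of (?X closure_of B n) = {}"
    proof (rule ccontr)
      let ?I = "?X interior_of (?X closure_of B n)"
      assume "?I \<noteq> {}"
      then obtain f0 where f0: "f0 \<in> ?I" by blast
      \<comment> \<open>The supposed interior is a non-empty open part of \<open>S\<close>, so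
        density puts a map with an invariant distribution inside it, and that map lies in the
        closure of \<open>B n\<close>.\<close>
      have "?I \<subseteq> S" using interior_of_subset_topspace[of ?X] topX by blast
      then have "f0 \<in> ?X closure_of (H_dot A \<mu> ev \<phi> (- \<sigma>) \<inter> S)" using f0 dense by blast
      then have cl: "\<forall>T. f0 \<in> T \<and> openin ?X T \<longrightarrow> (\<exists>f. f \<in> H_dot A \<mu> ev \<phi> (- \<sigma>) \<inter> S \<and> f \<in> T)"
        unfolding in_closure_of by (rule conjunct2)
      obtain f where f: "f \<in> H_dot A \<mu> ev \<phi> (- \<sigma>) \<inter> S" "f \<in> ?I"
        using mp[OF spec[OF cl, of ?I] conjI[OF f0 openin_interior_of]] by (elim exE conjE) (rule that)
      have fcl: "f \<in> ?X closure_of B n" by (rule subsetD[OF interior_of_subset f(2)])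
      obtain U where U: "openin (cinf_topology A) U" "f \<in> U" "\<forall>g\<in>U. g \<in> smooth_maps A \<longrightarrow>
         \<not> (\<forall>j. \<exists>\<psi>\<in>zero_mean_functions A \<mu>. (\<forall>p. \<psi> (g p) - \<psi> p = e j p) \<and> cover_jet_le F (Suc (m * 2)) \<psi> (real n))"
        using H_dot_separated[OF _ m, of f "real n"] f(1) S(1) by auto
      have "openin ?X (U \<inter> S)" using U(1) by (auto simp: openin_subtopology)
      moreover have "\<forall>T. f \<in> T \<and> openin ?X T \<longrightarrow> (\<exists>g. g \<in> B n \<and> g \<in> T)"
        using fcl unfolding in_closure_of by (rule conjunct2)
      ultimately obtain g where g: "g \<in> B n" "g \<in> U \<inter> S" using U(2) f(1) by blast
      have "g \<in> smooth_maps A" using g(2) S(2) Diff_mu_smooth by blast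
      moreover have "g \<in> U" using g(2) by blast
      ultimately have "\<not> (\<forall>j. \<exists>\<psi>\<in>zero_mean_functions A \<mu>. (\<forall>p. \<psi> (g p) - \<psi> p = e j p) \<and> cover_jet_le F (Suc (m * 2)) \<psi> (real n))"
        by (rule U(3)[rule_format, rotated])
      then show False using g(1) unfolding B_def by (elim notE CollectE conjE)
    qed
  qed
  then show ?thesis unfolding meagre_in_def using eq by blast
qed

end

theorem theorem4p1:
  fixes A :: "('m::{t2_space, second_countable_topology}, 'n::finite) chart set"
    and \<omega> :: "('m, 'n) chart \<Rightarrow> 'm \<Rightarrow> real"
    and \<mu> :: "'m measure"
    and G :: "('m, 'n) chart \<Rightarrow> 'm \<Rightarrow> real^'n^'n"
    and ev :: "nat \<Rightarrow> real"
    and \<phi> :: "nat \<Rightarrow> 'm \<Rightarrow> complex"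
    and S :: "('m \<Rightarrow> 'm) set"
    and \<sigma> :: real
  assumes "closed_oriented_manifold A"
    and "volume_form A \<omega>"
    and "measure_of_volume_form A \<omega> \<mu>"
    and "prob_space \<mu>"
    and "riemannian_metric A G"
    and "metric_induces A G \<omega>"
    and "laplace_eigenbasis A G \<mu> ev \<phi>"
    and "closedin (subtopology (cinf_topology A) (Diff_mu A \<mu>)) S"
    and "\<sigma> \<ge> 0"
    and "subtopology (cinf_topology A) S closure_of (H_dot A \<mu> ev \<phi> (- \<sigma>) \<inter> S) = S"
  shows "meagre_in (subtopology (cinf_topology A) S) (CR A \<mu> \<inter> S)"
proof -
  interpret riemannian_setup A \<omega> \<mu> G ev \<phi>
    using assms(1-7) by (simp add: riemannian_setup_def riemannian_setup_axioms_def closed_manifold_def)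
  obtain F where "ball_cover A F" using ex_ball_cover by blast
  then obtain w N where "weighted_basis A \<omega> \<mu> G ev \<phi> F w N" using ex_weighted_basis by blast
  then interpret weighted_basis A \<omega> \<mu> G ev \<phi> F w N .
  have "S \<subseteq> topspace (cinf_topology A)" "S \<subseteq> Diff_mu A \<mu>"
    using closedin_subset[OF assms(8)] by (auto simp: topspace_subtopology)
  then show ?thesis using CR_meagre assms(10) by blast
qed

end
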